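(* Let $\mathcal{U},\mathcal{V},\mathcal{X},\mathcal{Y}$ be finite alphabets with $0\in\mathcal{X}$ and $\mathcal{X}\setminus\{0\}\neq\emptyset$, let $P_{UV},Q_{UV}$ be pmfs on $\mathcal{U}\times\mathcal{V}$ with $Q_{UV}(u,v)>0$ for all $(u,v)$, let $\Gamma_{Y|X}$ be a discrete memoryless channel from $\mathcal{X}$ to $\mathcal{Y}$, and let $c:\mathcal{X}\to[0,\infty)$ satisfy $c(x)=0$ if and only if $x=0$. Define $$E_1=\min_{\pi_{UV}:\ \pi_U=P_U,\ \pi_V=P_V}D(\pi_{UV}\|Q_{UV}),$$ $$E_2=D(P_V\|Q_V)+\max_{\hat x\in\mathcal{X}\setminus\{0\}}D(\Gamma_{Y|X=0}\|\Gamma_{Y|X=\hat x}),$$ $$E_3=\min_{\pi_{UV}:\ \pi_U=Q_U,\ \pi_V=P_V}D(\pi_{UV}\|Q_{UV}),$$ where the minima are over pmfs $\pi_{UV}$ on $\mathcal{U}\times\mathcal{V}$ with the indicated marginals. Fix $\epsilon\in[0,1)$ and a sequence of cost constraints $\{C_n\}$ with $\lim_{n\to\infty}C_n=\infty$ and $\lim_{n\to\infty}C_n/n=0$. Let $\theta^\star_{\mathrm{Exp\text{-}cost},\mathcal{H}=0}(\epsilon,\{C_n\})$ and $\theta^\star_{\mathrm{Exp\text{-}cost,both}}(\epsilon,\{C_n\})$ be the Stein-exponents under the expected cost constraint imposed only under $\mathcal{H}=0$, respectively under both hypotheses (defined in the context). 1) If there exist two inputs $x_0,x_1\in\mathcal{X}$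 and an output $y^*\in\mathcal{Y}$ with $\Gamma_{Y|X}(y^*|x_0)>0$ and $\Gamma_{Y|X}(y^*|x_1)=0$, then $$\theta^\star_{\mathrm{Exp\text{-}cost,both}}(\epsilon,\{C_n\})=\theta^\star_{\mathrm{Exp\text{-}cost},\mathcal{H}=0}(\epsilon,\{C_n\})=E_1.$$ 2) Otherwise (if no such triple $(x_0,x_1,y^* )$ exists), $$\theta^\star_{\mathrm{Exp\text{-}cost},\mathcal{H}=0}(\epsilon,\{C_n\})=\min\{E_1,E_2\}$$ and $$\theta^\star_{\mathrm{Exp\text{-}cost,both}}(\epsilon,\{C_n\})=\min\{E_1,E_2,E_3\}.$$
   Context: Setup. For each blocklength $n$, a sensor observes $U^n$ and a decision center observes $V^n$. Under hypothesis $\mathcal{H}=0$ the pairs $(U_i,V_i)$, $i=1,\dots,n$, are i.i.d. $\sim P_{UV}$; under $\mathcal{H}=1$ they are i.i.d. $\sim Q_{UV}$. Marginals are denoted $P_U,P_V,Q_U,Q_V$. The sensor communicates to the decision center over $n$ uses of the discrete memoryless channel $\Gamma_{Y|X}$: an encoding function $f^{(n)}:\mathcal{U}^n\to\mathcal{X}^n$ produces $X^n=f^{(n)}(U^n)$; given $X^n=x^n$ (and whatever the values of $U^n$, $V^n$ and the hypothesis), the output $Y^n$ has pmf $\prod_{i=1}^n\Gamma_{Y|X}(y_i|x_i)$; a decision function $g^{(n)}:\mathcal{V}^n\times\mathcal{Y}^n\to\{0,1\}$ produces $\hat{\mathcal{H}}=g^{(n)}(V^n,Y^n)$. Error probabilities: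 $\alpha_n=\Pr[\hat{\mathcal{H}}=1|\mathcal{H}=0]$ and $\beta_n=\Pr[\hat{\mathcal{H}}=0|\mathcal{H}=1]$. Expected cost constraint under hypothesis $\mathsf{H}\in\{0,1\}$: for every $n$, $\sum_{i=1}^n\mathbb{E}[c(X_i)\,|\,\mathcal{H}=\mathsf{H}]\le C_n$. $\theta^\star_{\mathrm{Exp\text{-}cost},\mathcal{H}=0}(\epsilon,\{C_n\})$ (respectively $\theta^\star_{\mathrm{Exp\text{-}cost,both}}(\epsilon,\{C_n\})$) is the supremum of all $\theta>0$ for which there exists a sequence $\{(f^{(n)},g^{(n)})\}_{n\ge1}$ satisfying the expected cost constraint under $\mathsf{H}=0$ (respectively under both $\mathsf{H}=0$ and $\mathsf{H}=1$), together with $\limsup_{n\to\infty}\alpha_n\le\epsilon$ and $\liminf_{n\to\infty}-\frac1n\log\beta_n\ge\theta$. The supremum of the empty set is taken to be $0$. $\Gamma_{Y|X=x}$ denotes the pmf $\Gamma_{Y|X}(\cdot|x)$ on $\mathcal{Y}$. $D(\cdot\|\cdot)$ is the Kullback–Leibler divergence, with the same logarithm base throughout.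
   Formalization: The cost constraints are additionally assumed nonnegative, C_n ≥ 0 for all n ≥ 1; if some C_n were negative, no code could satisfy the constraint at that n, both exponents would be 0, and the claimed equalities would fail whenever the right-hand side is positive. *)

theory Defs
  imports "HOL-Probability.Probability" "HOL-Real_Asymp.Real_Asymp"
begin

datatype hypothesis = H0 | H1

text \<open>
  \<open>kl_div b p q\<close> is $D(p\|q)$ with logarithms to base \<open>b\<close>.  The library's \<open>KL_divergence\<close> takes
  the reference distribution first and is real-valued, so the value \<open>\<infinity>\<close> is added here for \<open>p\<close>
  not absolutely continuous with respect to \<open>q\<close>.
\<close>

definition kl_div :: "real \<Rightarrow> 'a pmf \<Rightarrow> 'a pmf \<Rightarrow> ereal" where
  "kl_div b p q =
     (if absolutely_continuous (measure_pmf q) (measure_pmf p)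
      then ereal (KL_divergence b (measure_pmf q) (measure_pmf p)) else \<infinity>)"

definition couplings :: "'u pmf \<Rightarrow> 'v pmf \<Rightarrow> ('u \<times> 'v) pmf set" where
  "couplings p q = {\<pi>. map_pmf fst \<pi> = p \<and> map_pmf snd \<pi> = q}"

text \<open>The infimum is attained if \<open>Q\<close> is positive on finite alphabets; see \<open>min_kl_div_attained\<close> below.\<close>

definition min_kl_div :: "real \<Rightarrow> 'u pmf \<Rightarrow> 'v pmf \<Rightarrow> ('u \<times> 'v) pmf \<Rightarrow> ereal" where
  "min_kl_div b p q Q = (INF \<pi>\<in>couplings p q. kl_div b \<pi> Q)"

lemma kl_div_eq_sum:
  fixes p q :: "'a::finite pmf"
  assumes "b > 1" "set_pmf p \<subseteq> set_pmf q"
  shows "kl_div b p q = ereal (\<Sum>x\<in>UNIV. pmf p x * log b (pmf p x / pmf q x))"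
proof -
  interpret sigma_finite_measure "count_space (UNIV :: 'a set)"
    by (simp add: sigma_finite_measure_count_space_finite)
  have ac0: "pmf p x = 0" if "pmf q x = 0" for x
    using assms(2) that by (auto simp: set_pmf_eq)
  have "absolutely_continuous (measure_pmf q) (measure_pmf p)"
    using assms(2)
    by (auto simp: absolutely_continuous_def null_sets_def measure_pmf.emeasure_eq_measure
          measure_pmf_zero_iff)
  moreover have "KL_divergence b (measure_pmf q) (measure_pmf p) =
      (\<integral>x. pmf p x * log b (pmf p x / pmf q x) \<partial>count_space UNIV)"
    unfolding measure_pmf_eq_density
    using assms(1) ac0 by (intro KL_density_density) (auto simp: AE_count_space)
  ultimately show ?thesis
    by (simp add: kl_div_def lebesgue_integral_count_space_finite)
qed

lemma continuous_on_mult_log: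
  fixes b q :: real
  assumes "b > 1" "q > 0"
  shows "continuous_on {0..} (\<lambda>t. t * log b (t / q))"
proof -
  have "continuous (at t within {0..}) (\<lambda>t. t * log b (t / q))" if "t \<ge> 0" for t
  proof (cases "t = 0")
    case True
    have "((\<lambda>t. t * log b (t / q)) \<longlongrightarrow> 0) (at_right 0)"
      using assms unfolding log_def by real_asymp
    moreover have "at (0::real) within {0..} = at_right 0"
      by (rule at_within_nhd[of 0 UNIV]) auto
    ultimately show ?thesis
      using True by (simp add: continuous_within)
  next
    case False
    with that assms have "isCont (\<lambda>t. t * log b (t / q)) t"
      by (intro continuous_intros) auto
    then show ?thesis
      by (rule continuous_at_imp_continuous_at_within)
  qed
  then show ?thesis
    by (auto simp: continuous_on_eq_continuous_within)
qed

lemma pmf_fst: "pmf (map_pmf fst \<pi>) u = (\<Sum>v\<in>UNIV. pmf \<pi> (u, v))"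
  for \<pi> :: "('u::finite \<times> 'v::finite) pmf"
proof -
  have "pmf (map_pmf fst \<pi>) u = (\<Sum>z\<in>Pair u ` UNIV. pmf \<pi> z)"
    by (subst pmf_map, subst measure_measure_pmf_finite, simp)
       (intro sum.cong, auto)
  then show ?thesis by (simp add: sum.reindex inj_on_def)
qed

lemma pmf_snd: "pmf (map_pmf snd \<pi>) v = (\<Sum>u\<in>UNIV. pmf \<pi> (u, v))"
  for \<pi> :: "('u::finite \<times> 'v::finite) pmf"
proof -
  have "pmf (map_pmf snd \<pi>) v = (\<Sum>z\<in>(\<lambda>u. (u, v)) ` UNIV. pmf \<pi> z)"
    by (subst pmf_map, subst measure_measure_pmf_finite, simp)
       (intro sum.cong, auto)
  then show ?thesis by (simp add: sum.reindex inj_on_def)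
qed

lemma min_kl_div_attained:
  fixes p :: "'u::finite pmf" and q :: "'v::finite pmf"
  assumes "b > 1" and Q: "\<And>u v. pmf Q (u, v) > 0"
  shows "\<exists>\<pi>\<in>couplings p q. kl_div b \<pi> Q = min_kl_div b p q Q"
proof -
  define K where "K = {x :: real ^ ('u \<times> 'v). (\<forall>z. 0 \<le> x $ z) \<and>
    (\<forall>u. (\<Sum>v\<in>UNIV. x $ (u, v)) = pmf p u) \<and> (\<forall>v. (\<Sum>u\<in>UNIV. x $ (u, v)) = pmf q v)}"
  define F where "F x = (\<Sum>z\<in>UNIV. x $ z * log b (x $ z / pmf Q z))" for x :: "real ^ ('u \<times> 'v)"
  have Q': "pmf Q z > 0" for z using Q by (cases z) auto
  have kl: "kl_div b \<pi> Q = ereal (F (\<chi> z. pmf \<pi> z))" for \<pi>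
    using Q' by (subst kl_div_eq_sum[OF \<open>b > 1\<close>]) (auto simp: F_def set_pmf_eq less_le)
  have inK: "(\<chi> z. pmf \<pi> z) \<in> K" if "\<pi> \<in> couplings p q" for \<pi>
    using that by (auto simp: K_def couplings_def pmf_fst pmf_snd)
  have "closed K"
    unfolding K_def by (intro closed_Collect_conj closed_Collect_all closed_Collect_le
      closed_Collect_eq continuous_intros)
  moreover have "bounded K"
  proof -
    have "x \<in> cbox 0 1" if "x \<in> K" for x
    proof -
      have "x $ (u, v) \<le> 1" for u v
      proof -
        have "x $ (u, v) \<le> (\<Sum>v\<in>UNIV. x $ (u, v))"
          using that by (intro member_le_sum) (auto simp: K_def)
        then show ?thesis using that pmf_le_1[of p u] by (auto simp: K_def)
      qed
      then show ?thesis using that by (auto simp: K_def mem_box_cart)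
    qed
    then show ?thesis by (intro bounded_subset[OF bounded_cbox]) blast
  qed
  ultimately have "compact K" by (simp add: compact_eq_bounded_closed)
  moreover have "pair_pmf p q \<in> couplings p q"
    by (simp add: couplings_def map_fst_pair_pmf map_snd_pair_pmf)
  then have "K \<noteq> {}" using inK by blast
  moreover have "continuous_on K F"
    unfolding F_def
  proof (intro continuous_on_sum)
    fix z
    show "continuous_on K (\<lambda>x. x $ z * log b (x $ z / pmf Q z))"
      by (rule continuous_on_compose2[OF continuous_on_mult_log[OF \<open>b > 1\<close> Q']])
         (auto intro!: continuous_on_component continuous_on_id simp: K_def simp del: split_paired_All)
  qed
  ultimately obtain x where x: "x \<in> K" "\<And>y. y \<in> K \<Longrightarrow> F x \<le> F y"
    using continuous_attains_inf by metis
  have nonneg: "x $ z \<ge> 0" for z using x(1) by (simp add: K_def del: split_paired_All)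
  have "(\<Sum>z\<in>UNIV. x $ z) = (\<Sum>u\<in>UNIV. \<Sum>v\<in>UNIV. x $ (u, v))"
    by (simp add: sum.cartesian_product)
  also have "\<dots> = 1"
    using x(1) sum_pmf_eq_1[of UNIV p] by (simp add: K_def)
  finally have "(\<integral>\<^sup>+z. ennreal (x $ z) \<partial>count_space UNIV) = 1"
    using nonneg by (simp add: nn_integral_count_space_finite sum_ennreal)
  then have emb: "pmf (embed_pmf (($) x)) z = x $ z" for z
    using nonneg by (intro pmf_embed_pmf) auto
  define \<pi> where "\<pi> = embed_pmf (($) x)"
  have \<pi>: "\<pi> \<in> couplings p q"
    using x(1) by (auto simp: couplings_def \<pi>_def emb K_def pmf_fst pmf_snd intro!: pmf_eqI)
  have "kl_div b \<pi> Q = ereal (F x)"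
    by (simp add: kl \<pi>_def emb)
  then have "kl_div b \<pi> Q \<le> kl_div b \<pi>' Q" if "\<pi>' \<in> couplings p q" for \<pi>'
    using x(2)[OF inK[OF that]] by (simp add: kl[of \<pi>'])
  then have "kl_div b \<pi> Q = min_kl_div b p q Q"
    unfolding min_kl_div_def using \<pi> by (intro antisym INF_greatest INF_lower) auto
  then show ?thesis using \<pi> by blast
qed

primrec dmc :: "('x \<Rightarrow> 'y pmf) \<Rightarrow> 'x list \<Rightarrow> 'y list pmf" where
  "dmc \<Gamma> [] = return_pmf []"
| "dmc \<Gamma> (x # xs) = do {y \<leftarrow> \<Gamma> x; ys \<leftarrow> dmc \<Gamma> xs; return_pmf (y # ys)}"

text \<open>
  Length-\<open>n\<close> sequences are lists of length \<open>n\<close>.  An encoder is a function on lists that maps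
  lists of length \<open>n\<close> to lists of length \<open>n\<close>; its values on other lists play no role.
\<close>

type_synonym ('u, 'x) encoder = "'u list \<Rightarrow> 'x list"
type_synonym ('v, 'y) decider = "'v list \<Rightarrow> 'y list \<Rightarrow> hypothesis"

definition block_encoder :: "nat \<Rightarrow> ('u, 'x) encoder \<Rightarrow> bool" where
  "block_encoder n f \<longleftrightarrow> (\<forall>us. length us = n \<longrightarrow> length (f us) = n)"

text \<open>Distribution of the decision when the source pairs are i.i.d. with law \<open>S\<close>.\<close>

definition decision_pmf ::
  "('u \<times> 'v) pmf \<Rightarrow> ('x \<Rightarrow> 'y pmf) \<Rightarrow> nat \<Rightarrow> ('u, 'x) encoder \<Rightarrow> ('v, 'y) decider \<Rightarrow> hypothesis pmf"
where
  "decision_pmf S \<Gamma> n f g =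
     do {uvs \<leftarrow> replicate_pmf n S;
         ys \<leftarrow> dmc \<Gamma> (f (map fst uvs));
         return_pmf (g (map snd uvs) ys)}"

definition type_I_error ::
  "('u \<times> 'v) pmf \<Rightarrow> ('x \<Rightarrow> 'y pmf) \<Rightarrow> nat \<Rightarrow> ('u, 'x) encoder \<Rightarrow> ('v, 'y) decider \<Rightarrow> real"
where "type_I_error P \<Gamma> n f g = pmf (decision_pmf P \<Gamma> n f g) H1"

definition type_II_error ::
  "('u \<times> 'v) pmf \<Rightarrow> ('x \<Rightarrow> 'y pmf) \<Rightarrow> nat \<Rightarrow> ('u, 'x) encoder \<Rightarrow> ('v, 'y) decider \<Rightarrow> real"
where "type_II_error Q \<Gamma> n f g = pmf (decision_pmf Q \<Gamma> n f g) H0"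

definition expected_cost ::
  "('u \<times> 'v) pmf \<Rightarrow> ('x \<Rightarrow> real) \<Rightarrow> nat \<Rightarrow> ('u, 'x) encoder \<Rightarrow> real" where
  "expected_cost S c n f =
     (\<Sum>i<n. measure_pmf.expectation (replicate_pmf n S) (\<lambda>uvs. c (f (map fst uvs) ! i)))"

text \<open>$-\frac1n\log_b\beta$, with value \<open>\<infinity>\<close> for \<open>\<beta> = 0\<close> (where the library has \<open>log b 0 = 0\<close>).\<close>

definition error_exponent :: "real \<Rightarrow> nat \<Rightarrow> real \<Rightarrow> ereal" where
  "error_exponent b n \<beta> = (if \<beta> = 0 then \<infinity> else ereal (- (1 / real n) * log b \<beta>))"

text \<open>
  \<open>\<H>\<close> is the set of hypotheses under which the cost constraint is imposed.
  Block lengths start at 1; the members of the sequences with index 0 are irrelevant.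
\<close>

definition achievable_exponents ::
  "real \<Rightarrow> ('u \<times> 'v) pmf \<Rightarrow> ('u \<times> 'v) pmf \<Rightarrow> ('x \<Rightarrow> 'y pmf) \<Rightarrow> ('x \<Rightarrow> real) \<Rightarrow>
   hypothesis set \<Rightarrow> real \<Rightarrow> (nat \<Rightarrow> real) \<Rightarrow> real set"
where
  "achievable_exponents b P Q \<Gamma> c \<H> \<epsilon> C =
     {\<theta>. \<theta> > 0 \<and>
       (\<exists>(f :: nat \<Rightarrow> ('u, 'x) encoder) (g :: nat \<Rightarrow> ('v, 'y) decider).
          (\<forall>n\<ge>1. block_encoder n (f n)) \<and>
          (\<forall>n\<ge>1. \<forall>h\<in>\<H>. expected_cost (case h of H0 \<Rightarrow> P | H1 \<Rightarrow> Q) c n (f n) \<le> C n) \<and>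
          limsup (\<lambda>n. ereal (type_I_error P \<Gamma> n (f n) (g n))) \<le> ereal \<epsilon> \<and>
          liminf (\<lambda>n. error_exponent b n (type_II_error Q \<Gamma> n (f n) (g n))) \<ge> ereal \<theta>)}"

definition stein_exponent ::
  "real \<Rightarrow> ('u \<times> 'v) pmf \<Rightarrow> ('u \<times> 'v) pmf \<Rightarrow> ('x \<Rightarrow> 'y pmf) \<Rightarrow> ('x \<Rightarrow> real) \<Rightarrow>
   hypothesis set \<Rightarrow> real \<Rightarrow> (nat \<Rightarrow> real) \<Rightarrow> ereal"
where
  "stein_exponent b P Q \<Gamma> c \<H> \<epsilon> C =
     (let A = achievable_exponents b P Q \<Gamma> c \<H> \<epsilon> C in if A = {} then 0 else (SUP \<theta>\<in>A. ereal \<theta>))"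

definition theta_expcost_H0 ::
  "real \<Rightarrow> ('u \<times> 'v) pmf \<Rightarrow> ('u \<times> 'v) pmf \<Rightarrow> ('x \<Rightarrow> 'y pmf) \<Rightarrow> ('x \<Rightarrow> real) \<Rightarrow>
   real \<Rightarrow> (nat \<Rightarrow> real) \<Rightarrow> ereal"
where "theta_expcost_H0 b P Q \<Gamma> c = stein_exponent b P Q \<Gamma> c {H0}"

definition theta_expcost_both ::
  "real \<Rightarrow> ('u \<times> 'v) pmf \<Rightarrow> ('u \<times> 'v) pmf \<Rightarrow> ('x \<Rightarrow> 'y pmf) \<Rightarrow> ('x \<Rightarrow> real) \<Rightarrow>
   real \<Rightarrow> (nat \<Rightarrow> real) \<Rightarrow> ereal"
where "theta_expcost_both b P Q \<Gamma> c = stein_exponent b P Q \<Gamma> c {H0, H1}"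

end

theory Submission
  imports Defs
begin

text \<open>
  Converse.  For a coupling \<open>\<pi>\<close> of \<open>\<mu>\<close>, \<open>\<nu>\<close> and \<open>\<kappa> > 0\<close>, every small enough exponent \<open>r\<close> satisfies
  \<open>\<E>\<^sub>Q[f(U) g(V)] \<ge> exp(- D(\<pi>\<parallel>Q) - \<kappa>) \<cdot> \<parallel>f\<parallel>\<^sub>r \<cdot> \<parallel>g\<parallel>\<^sub>r\<close>, with norms taken under \<open>\<mu>\<close> and \<open>\<nu>\<close>:
  as \<open>r \<rightarrow> 0\<close> the norms become geometric means, for which this is the variational formula for
  \<open>D\<close>.  The inequality tensorizes, so sets whose \<open>\<mu>\<^sup>n\<close>- and \<open>\<nu>\<^sup>n\<close>-probabilities are merely
  subexponentially small have a \<open>Q\<^sup>n\<close>-probability of exponent at most \<open>D(\<pi>\<parallel>Q)\<close>; this replaces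
  the blowing-up lemma.  A sublinear cost leaves only subexponentially many likely codewords, which
  gives \<open>E\<^sub>1\<close>.  If all outputs have a common support, codewords of sublinear weight change output
  probabilities only by subexponential factors, so acceptance is likely already for the all-zero
  codeword, which gives \<open>E\<^sub>2\<close> and, when the codewords are also cheap under \<open>Q\<close>, \<open>E\<^sub>3\<close>.

  Achievability.  A minimizer of \<open>D(\<cdot>\<parallel>Q)\<close> has the form \<open>Q(u,v) a(u) b(v)\<close>, so the sets
  where the products of \<open>a\<close> and \<open>b\<close> are typically large separate \<open>P\<close> from \<open>Q\<close> with the right
  exponent by Markov's inequality.  Atypical \<open>U\<^sup>n\<close> have probability \<open>O(1/n)\<close>, so signalling them by a
  constant nonzero word costs \<open>O(1)\<close> on average; in the zero-error case a number of symbols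
  proportional to \<open>C\<^sub>n\<close> suffices.
\<close>

subsection \<open>Expectations over finite alphabets\<close>

abbreviation \<E> :: "'a pmf \<Rightarrow> ('a \<Rightarrow> real) \<Rightarrow> real" where
  "\<E> p f \<equiv> measure_pmf.expectation p f"

lemma expectation_mono:
  assumes "finite (set_pmf p)" "\<And>x. x \<in> set_pmf p \<Longrightarrow> f x \<le> g x"
  shows "\<E> p f \<le> \<E> p g"
  using assms by (intro integral_mono_AE) (auto intro: integrable_measure_pmf_finite simp: AE_measure_pmf_iff)

lemma expectation_cong:
  assumes "\<And>x. x \<in> set_pmf p \<Longrightarrow> f x = g x"
  shows "\<E> p f = \<E> p g"
  using assms by (intro integral_cong_AE) (auto simp: AE_measure_pmf_iff)

lemma expectation_nonneg: "(\<And>x. x \<in> set_pmf p \<Longrightarrow> 0 \<le> f x) \<Longrightarrow> 0 \<le> \<E> p f"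
  by (intro integral_nonneg_AE) (auto simp: AE_measure_pmf_iff)

lemma expectation_add:
  "finite (set_pmf p) \<Longrightarrow> \<E> p (\<lambda>x. f x + g x) = \<E> p f + \<E> p g"
  by (intro Bochner_Integration.integral_add) (auto intro: integrable_measure_pmf_finite)

lemma expectation_sum:
  "finite (set_pmf p) \<Longrightarrow> \<E> p (\<lambda>x. \<Sum>i\<in>I. f i x) = (\<Sum>i\<in>I. \<E> p (f i))"
  by (intro Bochner_Integration.integral_sum) (auto intro: integrable_measure_pmf_finite)

lemma expectation_bind:
  fixes f :: "'a \<Rightarrow> 'b pmf"
  assumes "finite (set_pmf p)" "\<And>x. finite (set_pmf (f x))"
  shows "\<E> (bind_pmf p f) h = \<E> p (\<lambda>x. \<E> (f x) h)"
proof -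
  have "\<E> (bind_pmf p f) h = (\<Sum>a\<in>set_pmf p. pmf p a *\<^sub>R \<E> (f a) h)"
    using assms by (intro pmf_expectation_bind) auto
  also have "\<dots> = \<E> p (\<lambda>x. \<E> (f x) h)"
    using assms by (intro integral_measure_pmf[symmetric]) auto
  finally show ?thesis .
qed

lemma expectation_eq_sum: "\<E> p f = (\<Sum>x\<in>UNIV. pmf p x * f x)" for p :: "'a::finite pmf"
  by (subst integral_measure_pmf[of UNIV]) auto

lemma finite_set_replicate_pmf [simp]: "finite (set_pmf (replicate_pmf n p))"
  for p :: "'a::finite pmf"
proof -
  have "set_pmf (replicate_pmf n p) \<subseteq> {xs. set xs \<subseteq> UNIV \<and> length xs = n}"
    by (auto simp: set_replicate_pmf)
  then show ?thesis
    by (rule finite_subset) (intro finite_lists_length_eq finite)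
qed

lemma length_replicate_pmf: "xs \<in> set_pmf (replicate_pmf n p) \<Longrightarrow> length xs = n"
  by (simp add: set_replicate_pmf)

lemma finite_set_dmc [simp]: "finite (set_pmf (dmc \<Gamma> xs))" for \<Gamma> :: "'x \<Rightarrow> 'y::finite pmf"
  by (induction xs) auto

lemma expectation_replicate_Suc:
  fixes p :: "'a::finite pmf"
  shows "\<E> (replicate_pmf (Suc n) p) h = \<E> p (\<lambda>x. \<E> (replicate_pmf n p) (\<lambda>xs. h (x # xs)))"
  by (simp add: expectation_bind)

lemma expectation_dmc_Cons:
  fixes \<Gamma> :: "'x \<Rightarrow> 'y::finite pmf"
  shows "\<E> (dmc \<Gamma> (x # xs)) h = \<E> (\<Gamma> x) (\<lambda>y. \<E> (dmc \<Gamma> xs) (\<lambda>ys. h (y # ys)))"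
  by (simp add: expectation_bind)

text \<open>Words repeating a single letter link the channel to i.i.d. sequences: the all-zero word
  in the converse, the constant words in the coding schemes.\<close>

lemma dmc_replicate: "dmc \<Gamma> (replicate n x) = replicate_pmf n (\<Gamma> x)"
  by (induction n) auto

lemma map_replicate_pmf: "map_pmf (map f) (replicate_pmf n p) = replicate_pmf n (map_pmf f p)"
proof (induction n)
  case (Suc n)
  have "replicate_pmf (Suc n) (map_pmf f p) =
      map_pmf f p \<bind> (\<lambda>x. map_pmf (map f) (replicate_pmf n p) \<bind> (\<lambda>xs. return_pmf (x # xs)))"
    by (simp add: Suc.IH)
  then show ?case
    by (simp add: map_pmf_def bind_assoc_pmf bind_return_pmf)
qed simp

lemma expectation_map_replicate:
  "\<E> (replicate_pmf n p) (\<lambda>xs. h (map f xs)) = \<E> (replicate_pmf n (map_pmf f p)) h"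
  by (simp flip: map_replicate_pmf)

text \<open>Divergence in nats; terms with \<open>pmf p x = 0\<close> vanish because \<open>ln 0 = 0\<close>.\<close>

definition kl :: "'a::finite pmf \<Rightarrow> 'a pmf \<Rightarrow> real" where
  "kl p q = \<E> p (\<lambda>x. ln (pmf p x / pmf q x))"

text \<open>All estimates are made in nats; the base \<open>b\<close> enters only through the factor
  \<open>1 / ln b\<close>.\<close>

lemma kl_div_eq_kl:
  assumes "b > 1" "set_pmf p \<subseteq> set_pmf q"
  shows "kl_div b p q = ereal (kl p q / ln b)"
  by (simp add: kl_div_eq_sum[OF assms] kl_def expectation_eq_sum log_def sum_divide_distrib)

text \<open>Variational formula for the divergence: with \<open>S\<close> the mean of
  \<open>F\<close> under \<open>q\<close>, the inequality \<open>ln x \<le> x - 1\<close> at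
  \<open>x = F q / (S p)\<close> is averaged under \<open>p\<close>, where its right side has mean
  at most 0.\<close>

lemma donsker_varadhan:
  assumes "set_pmf p \<subseteq> set_pmf q" and F: "\<And>x. 0 < F x"
  shows "\<E> p (\<lambda>x. ln (F x)) \<le> ln (\<E> q F) + kl p q"
proof -
  have q: "pmf q x > 0" if "x \<in> set_pmf p" for x
    using that assms(1) by (auto simp: pmf_positive)
  define S where "S = \<E> q F"
  obtain x0 where "x0 \<in> set_pmf q" using set_pmf_not_empty by fast
  then have "0 < (\<Sum>x\<in>UNIV. pmf q x * F x)"
    by (intro sum_pos2[of _ x0]) (auto simp: F less_imp_le pmf_positive)
  then have S: "S > 0" by (simp add: S_def expectation_eq_sum)
  have "\<E> p (\<lambda>x. ln (F x) - ln S - ln (pmf p x / pmf q x)) \<le> \<E> p (\<lambda>x. F x * pmf q x / (S * pmf p x) - 1)"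
  proof (rule expectation_mono)
    fix x assume x: "x \<in> set_pmf p"
    then have p: "pmf p x > 0" by (simp add: pmf_positive)
    have "ln (F x) - ln S - ln (pmf p x / pmf q x) = ln (F x * pmf q x / (S * pmf p x))"
      using p q[OF x] F[of x] S by (simp add: ln_div ln_mult)
    also have "\<dots> \<le> F x * pmf q x / (S * pmf p x) - 1"
      using p q[OF x] F[of x] S by (intro ln_le_minus_one) auto
    finally show "ln (F x) - ln S - ln (pmf p x / pmf q x) \<le> F x * pmf q x / (S * pmf p x) - 1" .
  qed simp
  also have "\<dots> = (\<Sum>x\<in>UNIV. pmf p x * (F x * pmf q x / (S * pmf p x))) - 1"
    by (simp add: expectation_eq_sum right_diff_distrib sum_subtractf sum_pmf_eq_1)
  \<comment> \<open>Only an inequality: where \<open>pmf p x = 0\<close> the left summand is 0,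
    while \<open>q\<close> may still have mass there.\<close>
  also have "\<dots> \<le> (\<Sum>x\<in>UNIV. pmf q x * F x / S) - 1"
    by (intro diff_right_mono sum_mono) (auto simp: S less_imp_le F mult.commute)
  also have "\<dots> = 0"
    using S by (simp add: S_def expectation_eq_sum flip: sum_divide_distrib)
  finally have "\<E> p (\<lambda>x. ln (F x)) - ln S - kl p q \<le> 0"
    by (simp add: kl_def expectation_eq_sum right_diff_distrib sum_subtractf sum_pmf_eq_1 flip: sum_distrib_right)
  then show ?thesis by (simp add: S_def)
qed

lemma kl_nonneg: "set_pmf p \<subseteq> set_pmf q \<Longrightarrow> 0 \<le> kl p q"
  using donsker_varadhan[of p q "\<lambda>_. 1"] by simp

subsection \<open>Reverse Hoelder inequalities\<close>

text \<open>The product of \<open>1 + x + x^2/2\<close> and \<open>1 - x + x^2/2\<close> is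
  \<open>1 + x^4/4\<close>, hence at least 1, and the second factor is at most
  \<open>exp (- x)\<close> by Taylor's lower bound at the nonnegative point
  \<open>- x\<close>.\<close>

lemma exp_le_quadratic_nonpos:
  fixes x :: real
  assumes "x \<le> 0"
  shows "exp x \<le> 1 + x + x\<^sup>2 / 2"
proof -
  have "0 \<le> (x\<^sup>2)\<^sup>2 / 4" by simp
  also have "\<dots> = (1 + x + x\<^sup>2 / 2) * (1 - x + x\<^sup>2 / 2) - 1"
    by (simp add: power2_eq_square algebra_simps)
  finally have 1: "1 \<le> (1 + x + x\<^sup>2 / 2) * (1 - x + x\<^sup>2 / 2)" by simp
  have 2: "1 - x + x\<^sup>2 / 2 \<le> exp (- x)"
    using exp_lower_Taylor_quadratic[of "- x"] assms by simp
  have 3: "0 \<le> 1 + x + x\<^sup>2 / 2"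
    using sum_squares_ge_zero[of "x + 1" 1] by (simp add: power2_eq_square algebra_simps)
  have "1 \<le> (1 + x + x\<^sup>2 / 2) * exp (- x)"
    using 1 mult_left_mono[OF 2 3] by linarith
  then show ?thesis by (simp add: exp_minus field_simps)
qed

text \<open>Quantitative form of the convergence of \<open>r\<close>-norms to the geometric mean.
  Truncation at \<open>t\<close> keeps the logarithm finite; since \<open>f\<close> is at most 1,
  the exponent \<open>r * ln (max (f x) t)\<close> is nonpositive and the quadratic bound on
  \<open>exp\<close> applies. The error depends on \<open>r\<close> and \<open>t\<close> alone, not
  on \<open>f\<close>.\<close>

lemma power_mean_le_truncated_geometric_mean:
  fixes \<mu> :: "'a::finite pmf"
  assumes f: "\<And>x. x \<in> set_pmf \<mu> \<Longrightarrow> 0 \<le> f x" "\<And>x. x \<in> set_pmf \<mu> \<Longrightarrow> f x \<le> 1"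
    and t: "0 < t" "t \<le> 1" and r: "0 < r"
  shows "\<E> \<mu> (\<lambda>x. f x powr r) powr (1 / r) \<le> exp (\<E> \<mu> (\<lambda>x. ln (max (f x) t)) + r * (ln t)\<^sup>2 / 2)"
proof -
  let ?a = "\<lambda>x. ln (max (f x) t)"
  have a: "f x powr r \<le> 1 + r * ?a x + (r * ln t)\<^sup>2 / 2" if x: "x \<in> set_pmf \<mu>" for x
  proof -
    have "f x powr r \<le> max (f x) t powr r"
      using f(1)[OF x] r by (intro powr_mono2) auto
    also have "\<dots> = exp (r * ?a x)"
      using t by (simp add: powr_def max_def)
    also have "\<dots> \<le> 1 + r * ?a x + (r * ?a x)\<^sup>2 / 2"
      using f(2)[OF x] t r by (intro exp_le_quadratic_nonpos mult_nonneg_nonpos) auto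
    also have "(r * ?a x)\<^sup>2 \<le> (r * ln t)\<^sup>2"
    proof -
      have "ln t \<le> ?a x" "?a x \<le> 0" using f(2)[OF x] t by auto
      then have "\<bar>?a x\<bar> \<le> \<bar>ln t\<bar>" by linarith
      then show ?thesis using r by (simp add: power_mult_distrib abs_le_square_iff)
    qed
    finally show ?thesis by simp
  qed
  have "\<E> \<mu> (\<lambda>x. f x powr r) \<le> \<E> \<mu> (\<lambda>x. 1 + r * ?a x + (r * ln t)\<^sup>2 / 2)"
    by (intro expectation_mono a) auto
  also have "\<dots> = 1 + (r * \<E> \<mu> ?a + (r * ln t)\<^sup>2 / 2)"
    by (simp add: expectation_add)
  also have "\<dots> \<le> exp (r * \<E> \<mu> ?a + (r * ln t)\<^sup>2 / 2)"
    by (rule exp_ge_add_one_self)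
  finally have "\<E> \<mu> (\<lambda>x. f x powr r) powr (1 / r) \<le> exp (r * \<E> \<mu> ?a + (r * ln t)\<^sup>2 / 2) powr (1 / r)"
    using r by (intro powr_mono2 expectation_nonneg) auto
  also have "\<dots> = exp (\<E> \<mu> ?a + r * (ln t)\<^sup>2 / 2)"
    using r by (simp add: powr_def power2_eq_square field_simps)
  finally show ?thesis .
qed

text \<open>The variational formula for the truncated product of \<open>f\<close> and
  \<open>g\<close>. Truncation raises the mean under \<open>Q\<close> by at most
  \<open>3 * t\<close>, which is a small relative error because the point \<open>(u, v)\<close>,
  where both functions equal 1, already contributes \<open>q\<close>. Hence the conditions on
  \<open>t\<close> and \<open>r\<close> do not involve \<open>f\<close> and
  \<open>g\<close>.\<close>

lemma reverse_holder_pair_normalized: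
  fixes Q \<pi> :: "('u::finite \<times> 'v::finite) pmf"
  defines "\<mu> \<equiv> map_pmf fst \<pi>" and "\<nu> \<equiv> map_pmf snd \<pi>"
  assumes q: "0 < q" "\<And>u v. u \<in> set_pmf \<mu> \<Longrightarrow> v \<in> set_pmf \<nu> \<Longrightarrow> q \<le> pmf Q (u, v)"
    and t: "0 < t" "t \<le> 1" "3 * t / q \<le> \<kappa> / 2" and r: "0 < r" "r * (ln t)\<^sup>2 \<le> \<kappa> / 2"
    and f: "\<And>u. 0 \<le> f u" "\<And>u. u \<in> set_pmf \<mu> \<Longrightarrow> f u \<le> 1" and u: "u \<in> set_pmf \<mu>" "f u = 1"
    and g: "\<And>v. 0 \<le> g v" "\<And>v. v \<in> set_pmf \<nu> \<Longrightarrow> g v \<le> 1" and v: "v \<in> set_pmf \<nu>" "g v = 1"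
  shows "exp (- (kl \<pi> Q + \<kappa>)) * \<E> \<mu> (\<lambda>u. f u powr r) powr (1 / r) * \<E> \<nu> (\<lambda>v. g v powr r) powr (1 / r)
    \<le> \<E> Q (\<lambda>z. f (fst z) * g (snd z))"
proof -
  \<comment> \<open>The bound by 1 is available only on the supports. Setting the functions to 0
    elsewhere leaves the norms unchanged and can only lower the mean under \<open>Q\<close>.\<close>
  define f' where "f' u = (if u \<in> set_pmf \<mu> then f u else 0)" for u
  define g' where "g' v = (if v \<in> set_pmf \<nu> then g v else 0)" for v
  have f': "0 \<le> f' u" "f' u \<le> 1" "f' u \<le> f u" for u using f by (auto simp: f'_def)
  have g': "0 \<le> g' v" "g' v \<le> 1" "g' v \<le> g v" for v using g by (auto simp: g'_def)
  define F where "F z = max (f' (fst z)) t * max (g' (snd z)) t" for z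
  define I where "I = \<E> Q (\<lambda>z. f' (fst z) * g' (snd z))"
  define a where "a = \<E> \<mu> (\<lambda>u. ln (max (f u) t))"
  define b where "b = \<E> \<nu> (\<lambda>v. ln (max (g v) t))"
  have "set_pmf \<pi> \<subseteq> set_pmf Q"
  proof
    fix z assume "z \<in> set_pmf \<pi>"
    then have "q \<le> pmf Q (fst z, snd z)" by (intro q) (auto simp: \<mu>_def \<nu>_def)
    then show "z \<in> set_pmf Q" using q(1) by (auto simp: set_pmf_eq)
  qed
  then have "\<E> \<pi> (\<lambda>z. ln (F z)) \<le> ln (\<E> Q F) + kl \<pi> Q"
    using t by (intro donsker_varadhan) (auto simp: F_def intro!: mult_pos_pos simp: less_max_iff_disj)
  moreover have "\<E> \<pi> (\<lambda>z. ln (F z)) = a + b"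
  proof -
    have "\<E> \<pi> (\<lambda>z. ln (F z)) = \<E> \<pi> (\<lambda>z. ln (max (f (fst z)) t) + ln (max (g (snd z)) t))"
      using t by (intro expectation_cong)
        (auto simp: F_def f'_def g'_def \<mu>_def \<nu>_def ln_mult less_max_iff_disj image_iff intro!: ln_mult_pos split: if_splits; force)
    also have "\<dots> = a + b"
      by (simp add: expectation_add a_def b_def \<mu>_def \<nu>_def)
    finally show ?thesis .
  qed
  moreover have Iq: "q \<le> I"
  proof -
    have "q \<le> pmf Q (u, v) * (f' u * g' v)"
      using u v q by (simp add: f'_def g'_def)
    also have "\<dots> \<le> I"
      unfolding I_def expectation_eq_sum
      using member_le_sum[of "(u, v)" UNIV "\<lambda>z. pmf Q z * (f' (fst z) * g' (snd z))"] f' g' by auto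
    finally show ?thesis .
  qed
  moreover have FI: "\<E> Q F \<le> I * exp (\<kappa> / 2)"
  proof -
    have "F z \<le> f' (fst z) * g' (snd z) + 3 * t" for z
    proof -
      have "F z \<le> (f' (fst z) + t) * (g' (snd z) + t)"
        unfolding F_def using f'[of "fst z"] g'[of "snd z"] t by (intro mult_mono) auto
      also have "\<dots> = f' (fst z) * g' (snd z) + t * (f' (fst z) + g' (snd z) + t)"
        by (simp add: algebra_simps)
      also have "t * (f' (fst z) + g' (snd z) + t) \<le> t * 3"
        using f'(2)[of "fst z"] g'(2)[of "snd z"] t by (intro mult_left_mono) auto
      finally show ?thesis by (simp add: mult.commute)
    qed
    then have "\<E> Q F \<le> \<E> Q (\<lambda>z. f' (fst z) * g' (snd z) + 3 * t)"
      by (intro expectation_mono) auto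
    also have "\<dots> = I + q * (3 * t / q)"
      using q by (simp add: expectation_add I_def)
    also have "q * (3 * t / q) \<le> I * (\<kappa> / 2)"
      using Iq t q by (intro mult_mono) auto
    also have "I + I * (\<kappa> / 2) = I * (1 + \<kappa> / 2)" by (simp add: algebra_simps)
    also have "\<dots> \<le> I * exp (\<kappa> / 2)"
      using Iq q by (intro mult_left_mono exp_ge_add_one_self) auto
    finally show ?thesis by simp
  qed
  moreover have "0 < \<E> Q F"
  proof -
    obtain z where "z \<in> set_pmf Q" using set_pmf_not_empty by fast
    then have "0 < (\<Sum>z\<in>UNIV. pmf Q z * F z)"
      using t by (intro sum_pos2[of _ z]) (auto simp: F_def pmf_positive less_max_iff_disj intro!: mult_pos_pos mult_nonneg_nonneg)
    then show ?thesis by (simp only: expectation_eq_sum)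
  qed
  ultimately have "a + b \<le> ln (I * exp (\<kappa> / 2)) + kl \<pi> Q"
    by (smt (verit) ln_le_cancel_iff)
  also have "\<dots> = ln I + \<kappa> / 2 + kl \<pi> Q"
    using Iq q by (simp add: ln_mult)
  finally have ab: "a + b \<le> ln I + \<kappa> / 2 + kl \<pi> Q" .
  have "exp (- (kl \<pi> Q + \<kappa>)) * \<E> \<mu> (\<lambda>u. f u powr r) powr (1 / r) * \<E> \<nu> (\<lambda>v. g v powr r) powr (1 / r)
     \<le> exp (- (kl \<pi> Q + \<kappa>)) * exp (a + r * (ln t)\<^sup>2 / 2) * exp (b + r * (ln t)\<^sup>2 / 2)"
    unfolding a_def b_def using f g t r
    by (intro mult_mono power_mean_le_truncated_geometric_mean) auto
  also have "\<dots> = exp (a + b + r * (ln t)\<^sup>2 - kl \<pi> Q - \<kappa>)"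
    by (simp flip: exp_add)
  \<comment> \<open>One half of \<open>\<kappa>\<close> pays for the truncation, the other half for
    the second-order terms \<open>r * (ln t)^2\<close>.\<close>
  also have "\<dots> \<le> exp (ln I)"
    using ab r by simp
  also have "\<dots> = I" using Iq q by simp
  also have "\<dots> \<le> \<E> Q (\<lambda>z. f (fst z) * g (snd z))"
    unfolding I_def using f' g' f g by (intro expectation_mono mult_mono) auto
  finally show ?thesis .
qed

text \<open>Division by the maximum over the support gives a function bounded by 1 that attains 1; a
  nonvanishing norm makes this maximum positive.\<close>

lemma exists_normalizer:
  fixes \<mu> :: "'a::finite pmf"
  assumes f: "\<And>x. 0 \<le> f x" and nz: "\<E> \<mu> (\<lambda>x. f x powr r) \<noteq> 0"
  obtains x where "x \<in> set_pmf \<mu>" "0 < f x" "\<And>y. y \<in> set_pmf \<mu> \<Longrightarrow> f y / f x \<le> 1"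
    "\<E> \<mu> (\<lambda>y. f y powr r) = f x powr r * \<E> \<mu> (\<lambda>y. (f y / f x) powr r)"
proof -
  have "Max (f ` set_pmf \<mu>) \<in> f ` set_pmf \<mu>" by (intro Max_in) (auto simp: set_pmf_not_empty)
  then obtain x where x: "x \<in> set_pmf \<mu>" "f x = Max (f ` set_pmf \<mu>)" by auto
  have le: "f y \<le> f x" if "y \<in> set_pmf \<mu>" for y
    using that by (simp add: x(2))
  have "f x \<noteq> 0"
  proof
    assume "f x = 0"
    with le have "f y = 0" if "y \<in> set_pmf \<mu>" for y
      using f that by (metis antisym)
    then have "\<E> \<mu> (\<lambda>y. f y powr r) = \<E> \<mu> (\<lambda>_. 0)" by (intro expectation_cong) auto
    with nz show False by simp
  qed
  with f have pos: "0 < f x" by (metis less_eq_real_def)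
  show ?thesis
  proof (rule that[OF x(1) pos])
    show "f y / f x \<le> 1" if "y \<in> set_pmf \<mu>" for y using le[OF that] pos by simp
    show "\<E> \<mu> (\<lambda>y. f y powr r) = f x powr r * \<E> \<mu> (\<lambda>y. (f y / f x) powr r)"
      unfolding integral_mult_right_zero[symmetric]
      using pos f by (intro expectation_cong) (simp add: powr_divide)
  qed
qed

text \<open>Both sides are homogeneous of degree 1 in \<open>f\<close> and in \<open>g\<close>, so
  the normalized case suffices. The threshold for \<open>r\<close> is fixed before \<open>f\<close>
  and \<open>g\<close>; this uniformity is what allows tensorization.\<close>

lemma reverse_holder_pair:
  fixes Q \<pi> :: "('u::finite \<times> 'v::finite) pmf"
  defines "\<mu> \<equiv> map_pmf fst \<pi>" and "\<nu> \<equiv> map_pmf snd \<pi>"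
  assumes Q: "set_pmf \<mu> \<times> set_pmf \<nu> \<subseteq> set_pmf Q" and \<kappa>: "0 < \<kappa>"
  shows "\<forall>\<^sub>F r in at_right 0. \<forall>f g. (\<forall>u. 0 \<le> f u) \<longrightarrow> (\<forall>v. 0 \<le> g v) \<longrightarrow>
    exp (- (kl \<pi> Q + \<kappa>)) * \<E> \<mu> (\<lambda>u. f u powr r) powr (1 / r) * \<E> \<nu> (\<lambda>v. g v powr r) powr (1 / r)
    \<le> \<E> Q (\<lambda>z. f (fst z) * g (snd z))"
proof -
  define q where "q = Min (pmf Q ` set_pmf Q)"
  have q: "0 < q" "\<And>u v. u \<in> set_pmf \<mu> \<Longrightarrow> v \<in> set_pmf \<nu> \<Longrightarrow> q \<le> pmf Q (u, v)"
    using Q by (auto simp: q_def pmf_positive set_pmf_not_empty intro!: Min_le)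
  define t where "t = min 1 (q * \<kappa> / 6)"
  have t: "0 < t" "t \<le> 1" "3 * t / q \<le> \<kappa> / 2"
    using q \<kappa> by (auto simp: t_def field_simps min_def)
  \<comment> \<open>The summand 1 avoids a zero denominator when \<open>t = 1\<close>.\<close>
  define r0 where "r0 = \<kappa> / (2 * ((ln t)\<^sup>2 + 1))"
  have r0: "0 < r0" using \<kappa> by (auto simp: r0_def intro!: divide_pos_pos add_nonneg_pos)
  have "exp (- (kl \<pi> Q + \<kappa>)) * \<E> \<mu> (\<lambda>u. f u powr r) powr (1 / r) * \<E> \<nu> (\<lambda>v. g v powr r) powr (1 / r)
    \<le> \<E> Q (\<lambda>z. f (fst z) * g (snd z))"
    if r: "0 < r" "r < r0" and f: "\<forall>u. 0 \<le> f u" and g: "\<forall>v. 0 \<le> g v" for r f g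
  proof (cases "\<E> \<mu> (\<lambda>u. f u powr r) = 0 \<or> \<E> \<nu> (\<lambda>v. g v powr r) = 0")
    case True
    then show ?thesis using f g by (auto intro!: expectation_nonneg)
  next
    case False
    obtain u where u: "u \<in> set_pmf \<mu>" "0 < f u" "\<And>y. y \<in> set_pmf \<mu> \<Longrightarrow> f y / f u \<le> 1"
      "\<E> \<mu> (\<lambda>y. f y powr r) = f u powr r * \<E> \<mu> (\<lambda>y. (f y / f u) powr r)"
      using exists_normalizer[of f \<mu> r] f False by auto
    obtain v where v: "v \<in> set_pmf \<nu>" "0 < g v" "\<And>y. y \<in> set_pmf \<nu> \<Longrightarrow> g y / g v \<le> 1"
      "\<E> \<nu> (\<lambda>y. g y powr r) = g v powr r * \<E> \<nu> (\<lambda>y. (g y / g v) powr r)"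
      using exists_normalizer[of g \<nu> r] g False by auto
    have "r * (ln t)\<^sup>2 \<le> r0 * ((ln t)\<^sup>2 + 1)"
      using r by (intro mult_mono) auto
    also have "\<dots> = \<kappa> / 2" by (simp add: r0_def field_simps add_nonneg_eq_0_iff)
    finally have "exp (- (kl \<pi> Q + \<kappa>)) * \<E> \<mu> (\<lambda>y. (f y / f u) powr r) powr (1 / r) *
        \<E> \<nu> (\<lambda>y. (g y / g v) powr r) powr (1 / r) \<le> \<E> Q (\<lambda>z. f (fst z) / f u * (g (snd z) / g v))"
      unfolding \<mu>_def \<nu>_def using q t r f g u v
      by (intro reverse_holder_pair_normalized[where q = q and t = t and u = u and v = v])
         (auto simp: \<mu>_def \<nu>_def)
    then have "f u * g v * (exp (- (kl \<pi> Q + \<kappa>)) * \<E> \<mu> (\<lambda>y. (f y / f u) powr r) powr (1 / r) *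
        \<E> \<nu> (\<lambda>y. (g y / g v) powr r) powr (1 / r)) \<le> f u * g v * \<E> Q (\<lambda>z. f (fst z) / f u * (g (snd z) / g v))"
      using u v by (intro mult_left_mono) auto
    also have "\<dots> = \<E> Q (\<lambda>z. f (fst z) * g (snd z))"
      unfolding integral_mult_right_zero[symmetric]
      using u v by (intro expectation_cong) simp
    finally show ?thesis
      using u(2) v(2) r(1)
      by (simp add: u(4) v(4) powr_mult powr_powr expectation_nonneg mult_ac)
  qed
  then show ?thesis
    unfolding eventually_at_right_field using r0 by blast
qed

text \<open>The inequality for pairs, with a second alphabet of one point.\<close>

lemma reverse_holder:
  fixes p q :: "'a::finite pmf"
  assumes "set_pmf p \<subseteq> set_pmf q" and "0 < \<kappa>"
  shows "\<forall>\<^sub>F r in at_right 0. \<forall>f. (\<forall>x. 0 \<le> f x) \<longrightarrow>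
    exp (- (kl p q + \<kappa>)) * \<E> p (\<lambda>x. f x powr r) powr (1 / r) \<le> \<E> q f"
proof -
  define r1 where "r1 = return_pmf ()"
  have fst: "\<E> (pair_pmf s r1) (\<lambda>z. f (fst z)) = \<E> s f" for s :: "'a pmf" and f :: "'a \<Rightarrow> real"
    by (simp flip: integral_map_pmf add: map_fst_pair_pmf)
  have "kl (pair_pmf p r1) (pair_pmf q r1) = \<E> (pair_pmf p r1) (\<lambda>z. ln (pmf p (fst z) / pmf q (fst z)))"
    unfolding kl_def by (intro expectation_cong) (auto simp: pmf_pair r1_def)
  then have kl: "kl (pair_pmf p r1) (pair_pmf q r1) = kl p q"
    unfolding fst[of p "\<lambda>x. ln (pmf p x / pmf q x)"] kl_def[of p q] .
  have "\<forall>\<^sub>F r in at_right 0. \<forall>f g. (\<forall>x. 0 \<le> f x) \<longrightarrow> (\<forall>v. 0 \<le> g v) \<longrightarrow>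
      exp (- (kl p q + \<kappa>)) * \<E> p (\<lambda>x. f x powr r) powr (1 / r) * \<E> r1 (\<lambda>v. g v powr r) powr (1 / r)
      \<le> \<E> (pair_pmf q r1) (\<lambda>z. f (fst z) * g (snd z))"
    using reverse_holder_pair[of "pair_pmf p r1" "pair_pmf q r1" \<kappa>] assms
    by (simp add: map_fst_pair_pmf map_snd_pair_pmf kl) fast
  then show ?thesis
  proof (rule eventually_mono, intro allI impI)
    fix r and f :: "'a \<Rightarrow> real"
    assume *: "\<forall>f g. (\<forall>x. 0 \<le> f x) \<longrightarrow> (\<forall>v. 0 \<le> g v) \<longrightarrow>
      exp (- (kl p q + \<kappa>)) * \<E> p (\<lambda>x. f x powr r) powr (1 / r) * \<E> r1 (\<lambda>v. g v powr r) powr (1 / r)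
      \<le> \<E> (pair_pmf q r1) (\<lambda>z. f (fst z) * g (snd z))" and "\<forall>x. 0 \<le> f x"
    then show "exp (- (kl p q + \<kappa>)) * \<E> p (\<lambda>x. f x powr r) powr (1 / r) \<le> \<E> q f"
      using *[rule_format, of f "\<lambda>_. 1"] by (simp add: fst[of q f])
  qed
qed

section \<open>Tensorization over blocks and channel uses\<close>

text \<open>The norm over the remaining letters is a function of the first letter, to which the
  one-letter inequality applies. Its \<open>r\<close>-th power is again an expectation, so the
  nested norms recombine into the norm over the whole block.\<close>

lemma reverse_holder_pair_replicate:
  fixes Q :: "('u::finite \<times> 'v::finite) pmf"
  assumes K: "0 \<le> K" and r: "0 < r"
    and single: "\<And>f g. (\<And>u. 0 \<le> f u) \<Longrightarrow> (\<And>v. 0 \<le> g v) \<Longrightarrow>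
      K * \<E> \<mu> (\<lambda>u. f u powr r) powr (1 / r) * \<E> \<nu> (\<lambda>v. g v powr r) powr (1 / r)
      \<le> \<E> Q (\<lambda>z. f (fst z) * g (snd z))"
    and "\<And>us. 0 \<le> F us" "\<And>vs. 0 \<le> G vs"
  shows "K ^ n * \<E> (replicate_pmf n \<mu>) (\<lambda>us. F us powr r) powr (1 / r) *
      \<E> (replicate_pmf n \<nu>) (\<lambda>vs. G vs powr r) powr (1 / r)
    \<le> \<E> (replicate_pmf n Q) (\<lambda>zs. F (map fst zs) * G (map snd zs))"
  using assms(4,5)
proof (induction n arbitrary: F G)
  case 0
  then show ?case using r by (simp add: powr_powr)
next
  case (Suc n)
  define f where "f u = \<E> (replicate_pmf n \<mu>) (\<lambda>us. F (u # us) powr r) powr (1 / r)" for u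
  define g where "g v = \<E> (replicate_pmf n \<nu>) (\<lambda>vs. G (v # vs) powr r) powr (1 / r)" for v
  have f: "f u powr r = \<E> (replicate_pmf n \<mu>) (\<lambda>us. F (u # us) powr r)" for u
    using r by (simp add: f_def powr_powr expectation_nonneg)
  have g: "g u powr r = \<E> (replicate_pmf n \<nu>) (\<lambda>us. G (u # us) powr r)" for u
    using r by (simp add: g_def powr_powr expectation_nonneg)
  have "K ^ Suc n * \<E> \<mu> (\<lambda>u. f u powr r) powr (1 / r) * \<E> \<nu> (\<lambda>v. g v powr r) powr (1 / r)
     = K ^ n * (K * \<E> \<mu> (\<lambda>u. f u powr r) powr (1 / r) * \<E> \<nu> (\<lambda>v. g v powr r) powr (1 / r))"
    by (simp add: mult_ac)
  also have "\<dots> \<le> K ^ n * \<E> Q (\<lambda>z. f (fst z) * g (snd z))"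
    using K by (intro mult_left_mono single) (auto simp: f_def g_def)
  also have "\<dots> = \<E> Q (\<lambda>z. K ^ n * f (fst z) * g (snd z))"
    by (simp add: mult.assoc flip: integral_mult_right_zero)
  also have "\<dots> \<le> \<E> Q (\<lambda>z. \<E> (replicate_pmf n Q) (\<lambda>zs. F (fst z # map fst zs) * G (snd z # map snd zs)))"
    unfolding f_def g_def by (intro expectation_mono Suc.IH) (auto simp: Suc.prems)
  finally show ?case
    by (simp only: expectation_replicate_Suc f g list.map)
qed

text \<open>The same induction with a fixed reference law \<open>\<nu>\<close> and a varying output
  law: one pair of constants \<open>K\<close> and \<open>r\<close> has to serve all input
  letters.\<close>

lemma reverse_holder_dmc:
  fixes \<Gamma> :: "'x \<Rightarrow> 'y::finite pmf"
  assumes K: "0 \<le> K" and r: "0 < r"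
    and single: "\<And>x f. x \<in> set xs \<Longrightarrow> (\<And>y. 0 \<le> f y) \<Longrightarrow> K * \<E> \<nu> (\<lambda>y. f y powr r) powr (1 / r) \<le> \<E> (\<Gamma> x) f"
    and "\<And>ys. 0 \<le> F ys"
  shows "K ^ length xs * \<E> (replicate_pmf (length xs) \<nu>) (\<lambda>ys. F ys powr r) powr (1 / r) \<le> \<E> (dmc \<Gamma> xs) F"
  using assms(3,4)
proof (induction xs arbitrary: F)
  case Nil
  then show ?case using r by (simp add: powr_powr)
next
  case (Cons x xs)
  define f where "f y = \<E> (replicate_pmf (length xs) \<nu>) (\<lambda>ys. F (y # ys) powr r) powr (1 / r)" for y
  have f: "f y powr r = \<E> (replicate_pmf (length xs) \<nu>) (\<lambda>ys. F (y # ys) powr r)" for y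
    using r by (simp add: f_def powr_powr expectation_nonneg)
  have "K ^ Suc (length xs) * \<E> \<nu> (\<lambda>y. f y powr r) powr (1 / r)
     = K ^ length xs * (K * \<E> \<nu> (\<lambda>y. f y powr r) powr (1 / r))"
    by (simp add: mult_ac)
  also have "\<dots> \<le> K ^ length xs * \<E> (\<Gamma> x) f"
    using K by (intro mult_left_mono Cons.prems) (auto simp: f_def)
  also have "\<dots> = \<E> (\<Gamma> x) (\<lambda>y. K ^ length xs * f y)"
    by (simp flip: integral_mult_right_zero)
  also have "\<dots> \<le> \<E> (\<Gamma> x) (\<lambda>y. \<E> (dmc \<Gamma> xs) (\<lambda>ys. F (y # ys)))"
    unfolding f_def by (intro expectation_mono Cons.IH) (auto simp: Cons.prems)
  finally show ?case
    by (simp only: expectation_replicate_Suc expectation_dmc_Cons f length_Cons)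
qed

text \<open>An i.i.d. block is the output of a channel with a one-point input alphabet.\<close>

lemma reverse_holder_replicate:
  fixes q :: "'a::finite pmf"
  assumes "0 \<le> K" "0 < r"
    and "\<And>f. (\<And>y. 0 \<le> f y) \<Longrightarrow> K * \<E> p (\<lambda>y. f y powr r) powr (1 / r) \<le> \<E> q f"
    and "\<And>ys. 0 \<le> F ys"
  shows "K ^ n * \<E> (replicate_pmf n p) (\<lambda>ys. F ys powr r) powr (1 / r) \<le> \<E> (replicate_pmf n q) F"
  using reverse_holder_dmc[of K r "replicate n ()" p "\<lambda>_. q" F] assms by (simp add: dmc_replicate)

subsection \<open>Typicality and information projection\<close>

text \<open>
  One-sided typicality for the weights \<open>a\<close>, stated multiplicatively so that a sequence with a
  letter of weight 0 is never typical.
\<close>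

definition typical :: "'a pmf \<Rightarrow> ('a \<Rightarrow> real) \<Rightarrow> real \<Rightarrow> 'a list set" where
  "typical p a \<kappa> = {xs. exp (real (length xs) * (\<E> p (\<lambda>x. ln (a x)) - \<kappa>)) \<le> prod_list (map a xs)}"

lemma expectation_prod_list:
  "\<E> (replicate_pmf n q) (\<lambda>xs. prod_list (map w xs)) = \<E> q w ^ n" for q :: "'a::finite pmf"
proof (induction n)
  case (Suc n)
  have "\<E> (replicate_pmf (Suc n) q) (\<lambda>xs. prod_list (map w xs)) = \<E> q (\<lambda>x. w x * \<E> q w ^ n)"
    by (simp only: expectation_replicate_Suc list.map prod_list.Cons integral_mult_right_zero Suc.IH)
  then show ?case by simp
qed simp

lemma markov_inequality:
  assumes "finite (set_pmf p)" and "0 < t"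
    and "\<And>x. x \<in> set_pmf p \<Longrightarrow> 0 \<le> f x" and "\<And>x. x \<in> set_pmf p \<Longrightarrow> x \<in> A \<Longrightarrow> t \<le> f x"
  shows "measure_pmf.prob p A \<le> \<E> p f / t"
proof -
  have "t * measure_pmf.prob p A = \<E> p (\<lambda>x. t * indicator A x)" by simp
  also have "\<dots> \<le> \<E> p f"
    using assms by (intro expectation_mono) (auto simp: indicator_def)
  finally show ?thesis using \<open>0 < t\<close> by (simp add: field_simps)
qed

lemma expectation_sum_list_centered:
  fixes p :: "'a::finite pmf"
  assumes "\<E> p \<psi> = 0"
  shows "\<E> (replicate_pmf n p) (\<lambda>xs. sum_list (map \<psi> xs)) = 0"
    and "\<E> (replicate_pmf n p) (\<lambda>xs. (sum_list (map \<psi> xs))\<^sup>2) = real n * \<E> p (\<lambda>x. (\<psi> x)\<^sup>2)"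
proof -
  show 1: "\<E> (replicate_pmf n p) (\<lambda>xs. sum_list (map \<psi> xs)) = 0" for n
  proof (induction n)
    case (Suc n)
    then show ?case
      by (simp add: expectation_replicate_Suc expectation_add assms del: replicate_pmf.simps)
  qed simp
  show "\<E> (replicate_pmf n p) (\<lambda>xs. (sum_list (map \<psi> xs))\<^sup>2) = real n * \<E> p (\<lambda>x. (\<psi> x)\<^sup>2)"
  proof (induction n)
    case (Suc n)
    have "\<E> (replicate_pmf (Suc n) p) (\<lambda>xs. (sum_list (map \<psi> xs))\<^sup>2) =
      \<E> p (\<lambda>x. \<E> (replicate_pmf n p) (\<lambda>xs. (\<psi> x)\<^sup>2 + 2 * \<psi> x * sum_list (map \<psi> xs) + (sum_list (map \<psi> xs))\<^sup>2))"
      by (simp add: expectation_replicate_Suc power2_sum ac_simps del: replicate_pmf.simps)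
    also have "\<dots> = \<E> p (\<lambda>x. (\<psi> x)\<^sup>2) + real n * \<E> p (\<lambda>x. (\<psi> x)\<^sup>2)"
      by (simp add: expectation_add 1 Suc.IH)
    finally show ?case by (simp add: algebra_simps)
  qed simp
qed

text \<open>Chebyshev's inequality for the sum of the centred log-weights. The rate
  \<open>1/n\<close> matters: a word of \<open>n\<close> costly letters sent only on this event has
  bounded expected cost.\<close>

lemma prob_not_typical:
  fixes p :: "'a::finite pmf"
  assumes a: "\<And>x. x \<in> set_pmf p \<Longrightarrow> 0 < a x" and "0 < \<kappa>"
  shows "\<exists>K. \<forall>n\<ge>1. measure_pmf.prob (replicate_pmf n p) (- typical p a \<kappa>) \<le> K / real n"
proof -
  define m where "m = \<E> p (\<lambda>x. ln (a x))"
  define \<psi> where "\<psi> x = ln (a x) - m" for x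
  have \<psi>0: "\<E> p \<psi> = 0"
    by (simp add: expectation_eq_sum \<psi>_def m_def right_diff_distrib sum_subtractf sum_pmf_eq_1 flip: sum_distrib_right)
  have prod: "prod_list (map a xs) = exp (sum_list (map \<psi> xs) + real (length xs) * m)"
    if "set xs \<subseteq> set_pmf p" for xs
    using that
  proof (induction xs)
    case (Cons x xs)
    then show ?case using a[of x] by (simp add: \<psi>_def exp_add exp_diff algebra_simps)
  qed simp
  have "measure_pmf.prob (replicate_pmf n p) (- typical p a \<kappa>) \<le> (\<E> p (\<lambda>x. (\<psi> x)\<^sup>2) / \<kappa>\<^sup>2) / real n"
    if "n \<ge> 1" for n
  proof -
    have "measure_pmf.prob (replicate_pmf n p) (- typical p a \<kappa>)
      \<le> \<E> (replicate_pmf n p) (\<lambda>xs. (sum_list (map \<psi> xs))\<^sup>2) / (real n * \<kappa>)\<^sup>2"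
    proof (rule markov_inequality)
      fix xs assume xs: "xs \<in> set_pmf (replicate_pmf n p)" "xs \<in> - typical p a \<kappa>"
      then have "set xs \<subseteq> set_pmf p" "length xs = n"
        by (auto simp: set_replicate_pmf)
      with xs(2) have "real n * \<kappa> \<le> - sum_list (map \<psi> xs)"
        by (simp add: typical_def prod m_def[symmetric] algebra_simps)
      then show "(real n * \<kappa>)\<^sup>2 \<le> (sum_list (map \<psi> xs))\<^sup>2"
        using \<open>0 < \<kappa>\<close> power_mono[of "real n * \<kappa>" "- sum_list (map \<psi> xs)" 2] by simp
    qed (use that \<open>0 < \<kappa>\<close> in auto)
    then show ?thesis
      unfolding expectation_sum_list_centered(2)[OF \<psi>0]
      using that by (simp add: power2_eq_square field_simps)
  qed
  then show ?thesis by blast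
qed

text \<open>Markov's inequality for the product of the weights, whose mean is the
  \<open>n\<close>-th power of a number in \<open>[0, 1]\<close>.\<close>

lemma prob_typical_le:
  fixes q :: "'a::finite pmf"
  assumes "\<And>x. 0 \<le> a x" "\<E> q a \<le> 1"
  shows "measure_pmf.prob (replicate_pmf n q) (typical p a \<kappa>) \<le> exp (- (real n * (\<E> p (\<lambda>x. ln (a x)) - \<kappa>)))"
proof -
  have "measure_pmf.prob (replicate_pmf n q) (typical p a \<kappa>)
      \<le> \<E> (replicate_pmf n q) (\<lambda>xs. prod_list (map a xs)) / exp (real n * (\<E> p (\<lambda>x. ln (a x)) - \<kappa>))"
    using assms by (intro markov_inequality prod_list_nonneg) (auto simp: typical_def dest: length_replicate_pmf)
  also have "\<dots> \<le> 1 / exp (real n * (\<E> p (\<lambda>x. ln (a x)) - \<kappa>))"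
    using assms by (intro divide_right_mono) (auto simp: expectation_prod_list intro!: power_le_one expectation_nonneg)
  finally show ?thesis by (simp add: exp_minus divide_inverse)
qed

text \<open>Markov's inequality again: the product weight \<open>a u * b v\<close> splits along the
  two coordinates, so a test made separately on each coordinate controls it.\<close>

lemma prob_pair_typical_le:
  fixes Q :: "('u::finite \<times> 'v::finite) pmf"
  assumes "\<And>u. 0 \<le> a u" "\<And>v. 0 \<le> b v" "\<E> Q (\<lambda>z. a (fst z) * b (snd z)) \<le> 1"
  shows "measure_pmf.prob (replicate_pmf n Q) {zs. map fst zs \<in> typical \<mu> a \<kappa> \<and> map snd zs \<in> typical \<nu> b \<kappa>}
    \<le> exp (- (real n * (\<E> \<mu> (\<lambda>u. ln (a u)) + \<E> \<nu> (\<lambda>v. ln (b v)) - 2 * \<kappa>)))"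
proof -
  let ?w = "\<lambda>z. a (fst z) * b (snd z)"
  define r where "r = \<E> \<mu> (\<lambda>u. ln (a u)) + \<E> \<nu> (\<lambda>v. ln (b v)) - 2 * \<kappa>"
  have prod: "prod_list (map ?w zs) = prod_list (map a (map fst zs)) * prod_list (map b (map snd zs))" for zs
    by (induction zs) (auto simp: mult_ac)
  have "measure_pmf.prob (replicate_pmf n Q) {zs. map fst zs \<in> typical \<mu> a \<kappa> \<and> map snd zs \<in> typical \<nu> b \<kappa>}
      \<le> \<E> (replicate_pmf n Q) (\<lambda>zs. prod_list (map ?w zs)) / exp (real n * r)"
  proof (rule markov_inequality)
    fix zs assume "zs \<in> set_pmf (replicate_pmf n Q)"
      and zs: "zs \<in> {zs. map fst zs \<in> typical \<mu> a \<kappa> \<and> map snd zs \<in> typical \<nu> b \<kappa>}"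
    then have len: "length zs = n" by (simp add: length_replicate_pmf)
    have "exp (real n * r) = exp (real n * (\<E> \<mu> (\<lambda>u. ln (a u)) - \<kappa>)) * exp (real n * (\<E> \<nu> (\<lambda>v. ln (b v)) - \<kappa>))"
      by (simp add: r_def algebra_simps flip: exp_add)
    also have "\<dots> \<le> prod_list (map a (map fst zs)) * prod_list (map b (map snd zs))"
      using zs len assms by (intro mult_mono prod_list_nonneg) (auto simp: typical_def)
    finally show "exp (real n * r) \<le> prod_list (map ?w zs)"
      by (simp only: prod)
  qed (use assms in \<open>auto intro!: prod_list_nonneg\<close>)
  also have "\<dots> \<le> 1 / exp (real n * r)"
    using assms by (intro divide_right_mono) (auto simp: expectation_prod_list intro!: power_le_one expectation_nonneg)
  finally show ?thesis by (simp add: r_def exp_minus divide_inverse)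
qed

section \<open>Minimizers of the divergence over couplings\<close>

lemma coupling_of_weights:
  fixes \<mu> :: "'u::finite pmf" and \<nu> :: "'v::finite pmf"
  assumes nonneg: "\<And>z. 0 \<le> w z"
    and marg: "\<And>u. (\<Sum>v\<in>UNIV. w (u, v)) = pmf \<mu> u" "\<And>v. (\<Sum>u\<in>UNIV. w (u, v)) = pmf \<nu> v"
  shows "\<exists>\<rho>\<in>couplings \<mu> \<nu>. \<forall>z. pmf \<rho> z = w z"
proof -
  have "(\<Sum>z\<in>UNIV. w z) = (\<Sum>u\<in>UNIV. \<Sum>v\<in>UNIV. w (u, v))"
    by (simp add: sum.cartesian_product)
  also have "\<dots> = 1" by (simp add: marg sum_pmf_eq_1)
  finally have "(\<integral>\<^sup>+z. ennreal (w z) \<partial>count_space UNIV) = 1"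
    using nonneg by (simp add: nn_integral_count_space_finite sum_ennreal)
  then have w: "pmf (embed_pmf w) z = w z" for z
    using nonneg by (intro pmf_embed_pmf) auto
  then have "embed_pmf w \<in> couplings \<mu> \<nu>"
    by (auto simp: couplings_def pmf_fst pmf_snd marg intro!: pmf_eqI)
  then show ?thesis using w by blast
qed

lemma sum_diff_indicator:
  "(\<Sum>x\<in>UNIV. (indicator {a} x - indicator {b} x) * f x) = f a - (f b :: real)" for a :: "'a::finite"
  by (simp add: left_diff_distrib sum_subtractf indicator_def if_distrib[of "\<lambda>c. c * _"] cong: if_cong)

lemma mult_ln_tangent:
  fixes t w q :: real
  assumes "0 \<le> t" "0 < w" "0 < q"
  shows "w * ln (w / q) + (ln (w / q) + 1) * (t - w) \<le> t * ln (t / q)"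
proof (cases "t = 0")
  case True
  then show ?thesis using assms by (simp add: algebra_simps)
next
  case False
  then have t: "0 < t" using assms by simp
  have "t * ln (w / t) \<le> t * (w / t - 1)"
    using assms t by (intro mult_left_mono ln_le_minus_one) auto
  then show ?thesis
    using assms t by (simp add: ln_div algebra_simps)
qed

text \<open>Both endpoints lie above the tangent at the mixture; in the weighted sum of these two
  bounds the linear terms cancel.\<close>

lemma mult_ln_convex:
  fixes x y q s :: real
  assumes "0 < x" "0 \<le> y" "0 < q" "0 \<le> s" "s < 1"
  shows "((1 - s) * x + s * y) * ln (((1 - s) * x + s * y) / q) \<le> (1 - s) * (x * ln (x / q)) + s * (y * ln (y / q))"
proof -
  define w where "w = (1 - s) * x + s * y"
  define l where "l = ln (w / q)"
  have w: "0 < w" using assms by (auto simp: w_def intro!: add_pos_nonneg)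
  have "(1 - s) * (w * l + (l + 1) * (x - w)) + s * (w * l + (l + 1) * (y - w))
    \<le> (1 - s) * (x * ln (x / q)) + s * (y * ln (y / q))"
    unfolding l_def using assms w by (intro add_mono mult_left_mono mult_ln_tangent) auto
  moreover have "(1 - s) * (w * l + (l + 1) * (x - w)) + s * (w * l + (l + 1) * (y - w)) = w * l"
    unfolding w_def by (simp add: algebra_simps)
  ultimately show ?thesis by (simp add: w_def l_def)
qed

text \<open>
  Moving the minimizer towards the product coupling would decrease the divergence at infinite rate
  if the minimizer vanished somewhere on the product of the supports.
\<close>

lemma information_projection_positive:
  fixes Q :: "('u::finite \<times> 'v::finite) pmf"
  assumes Q: "\<And>z. 0 < pmf Q z" and \<pi>: "\<pi> \<in> couplings \<mu> \<nu>"
    and min: "\<And>\<rho>. \<rho> \<in> couplings \<mu> \<nu> \<Longrightarrow> kl \<pi> Q \<le> kl \<rho> Q"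
    and uv: "u \<in> set_pmf \<mu>" "v \<in> set_pmf \<nu>"
  shows "0 < pmf \<pi> (u, v)"
proof (rule ccontr)
  assume "\<not> 0 < pmf \<pi> (u, v)"
  then have z0: "pmf \<pi> (u, v) = 0"
    using pmf_nonneg[of \<pi> "(u, v)"] by linarith
  define \<rho> where "\<rho> = pair_pmf \<mu> \<nu>"
  define h where "h z t = t * ln (t / pmf Q z)" for z t
  \<comment> \<open>The mass that the product coupling puts on the zeros of
    \<open>\<pi>\<close>.\<close>
  define m where "m = (\<Sum>z\<in>UNIV. if pmf \<pi> z = 0 then pmf \<rho> z else 0)"
  have kl_h: "kl \<sigma> Q = (\<Sum>z\<in>UNIV. h z (pmf \<sigma> z))" for \<sigma>
    by (simp add: kl_def expectation_eq_sum h_def)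
  have m: "0 < m"
    unfolding m_def using uv z0
    by (intro sum_pos2[of _ "(u, v)"]) (auto simp: \<rho>_def pmf_pair pmf_positive)
  \<comment> \<open>Chosen so that \<open>ln s * m\<close> is below the bounded first-order change
    of the divergence.\<close>
  define s where "s = exp (- (\<bar>kl \<rho> Q - kl \<pi> Q\<bar> + 1) / m)"
  have s: "0 < s" "s < 1" using m by (auto simp: s_def divide_neg_pos)
  have \<rho>: "\<rho> \<in> couplings \<mu> \<nu>"
    by (simp add: \<rho>_def couplings_def map_fst_pair_pmf map_snd_pair_pmf)
  have marg: "(\<Sum>v\<in>UNIV. pmf \<sigma> (u, v)) = pmf \<mu> u" "(\<Sum>u\<in>UNIV. pmf \<sigma> (u, v)) = pmf \<nu> v"
    if "\<sigma> \<in> couplings \<mu> \<nu>" for u v \<sigma>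
    using that by (auto simp: couplings_def pmf_fst pmf_snd)
  have "\<exists>\<sigma>\<in>couplings \<mu> \<nu>. \<forall>z. pmf \<sigma> z = (1 - s) * pmf \<pi> z + s * pmf \<rho> z"
  proof (rule coupling_of_weights)
    show "0 \<le> (1 - s) * pmf \<pi> z + s * pmf \<rho> z" for z
      using s by (intro add_nonneg_nonneg mult_nonneg_nonneg) auto
  qed (simp_all add: sum.distrib marg[OF \<pi>] marg[OF \<rho>] flip: sum_distrib_left, simp_all add: algebra_simps)
  then obtain \<sigma> where \<sigma>: "\<sigma> \<in> couplings \<mu> \<nu>" "\<And>z. pmf \<sigma> z = (1 - s) * pmf \<pi> z + s * pmf \<rho> z" by blast
  \<comment> \<open>Convexity, with an extra gain at the zeros of \<open>\<pi>\<close>: there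
    \<open>\<sigma>\<close> equals \<open>s * \<rho>\<close>, and the factor \<open>s\<close> inside
    the logarithm contributes \<open>s * ln s * \<rho>\<close>.\<close>
  have "h z (pmf \<sigma> z) \<le> (1 - s) * h z (pmf \<pi> z) + s * h z (pmf \<rho> z) + s * ln s * (if pmf \<pi> z = 0 then pmf \<rho> z else 0)" for z
  proof (cases "pmf \<pi> z = 0")
    case True
    then show ?thesis
      using s Q[of z] by (cases "pmf \<rho> z = 0") (auto simp: \<sigma>(2) h_def ln_mult ln_div algebra_simps)
  next
    case False
    then show ?thesis
      using mult_ln_convex[of "pmf \<pi> z" "pmf \<rho> z" "pmf Q z" s] s Q by (simp add: \<sigma>(2) h_def pmf_pos)
  qed
  then have "kl \<sigma> Q \<le> (1 - s) * kl \<pi> Q + s * kl \<rho> Q + s * ln s * m"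
    unfolding kl_h m_def sum_distrib_left sum.distrib[symmetric] by (intro sum_mono) auto
  with min[OF \<sigma>(1)] have "0 \<le> s * (kl \<rho> Q - kl \<pi> Q + ln s * m)"
    by (simp add: algebra_simps)
  with s have "0 \<le> kl \<rho> Q - kl \<pi> Q + ln s * m"
    by (simp add: zero_le_mult_iff)
  moreover have "ln s * m = - (\<bar>kl \<rho> Q - kl \<pi> Q\<bar> + 1)"
    using m by (simp add: s_def)
  ultimately show False by linarith
qed

text \<open>
  Stationarity of the minimizer under perturbations supported on the corners of a rectangle: the
  density with respect to \<open>Q\<close> has rank one on the product of the supports.
\<close>

lemma information_projection_rectangle:
  fixes Q :: "('u::finite \<times> 'v::finite) pmf"
  assumes Q: "\<And>z. 0 < pmf Q z" and \<pi>: "\<pi> \<in> couplings \<mu> \<nu>"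
    and min: "\<And>\<rho>. \<rho> \<in> couplings \<mu> \<nu> \<Longrightarrow> kl \<pi> Q \<le> kl \<rho> Q"
    and u: "u \<in> set_pmf \<mu>" "u' \<in> set_pmf \<mu>" and v: "v \<in> set_pmf \<nu>" "v' \<in> set_pmf \<nu>"
  defines "l \<equiv> \<lambda>u v. ln (pmf \<pi> (u, v) / pmf Q (u, v))"
  shows "l u v - l u v' - l u' v + l u' v' = 0"
proof -
  \<comment> \<open>Signs \<open>+1, -1, -1, +1\<close> on the corners of the rectangle: all row and
    column sums vanish, so the marginals are preserved.\<close>
  define d :: "'u \<times> 'v \<Rightarrow> real" where
    "d z = (indicator {u} (fst z) - indicator {u'} (fst z)) * (indicator {v} (snd z) - indicator {v'} (snd z))" for z
  have sum_d: "(\<Sum>z\<in>UNIV. d z * L z) = L (u, v) - L (u, v') - L (u', v) + L (u', v')" for L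
  proof -
    have "(\<Sum>z\<in>UNIV. d z * L z) = (\<Sum>x\<in>UNIV. \<Sum>y\<in>UNIV. d (x, y) * L (x, y))"
      by (simp add: sum.cartesian_product)
    also have "\<dots> = L (u, v) - L (u, v') - (L (u', v) - L (u', v'))"
      by (simp add: d_def mult.assoc sum_diff_indicator flip: sum_distrib_left)
    finally show ?thesis by simp
  qed
  have pos: "0 < pmf \<pi> z" if "d z \<noteq> 0" for z
  proof -
    have "fst z \<in> {u, u'}" "snd z \<in> {v, v'}"
      using that by (auto simp: d_def split: split_indicator_asm)
    then have "0 < pmf \<pi> (fst z, snd z)"
      using u v by (intro information_projection_positive[OF Q \<pi> min]) auto
    then show ?thesis by simp
  qed
  \<comment> \<open>The smallest positive mass of \<open>\<pi>\<close>: perturbations of size below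
    \<open>e\<close> in either direction stay nonnegative, because \<open>d\<close> is supported
    where \<open>\<pi>\<close> is positive.\<close>
  define e where "e = Min (pmf \<pi> ` set_pmf \<pi>)"
  have e: "0 < e" by (simp add: e_def set_pmf_not_empty pmf_positive)
  define G where "G s = (\<Sum>z\<in>UNIV. (pmf \<pi> z + s * d z) * ln ((pmf \<pi> z + s * d z) / pmf Q z))" for s
  have marg: "(\<Sum>v\<in>UNIV. pmf \<pi> (u, v)) = pmf \<mu> u" "(\<Sum>u\<in>UNIV. pmf \<pi> (u, v)) = pmf \<nu> v" for u v
    using \<pi> by (auto simp: couplings_def pmf_fst pmf_snd)
  have d0: "(\<Sum>y\<in>UNIV. d (x, y)) = 0" "(\<Sum>x\<in>UNIV. d (x, y)) = 0" for x y
    using sum_diff_indicator[of v v' "\<lambda>_. 1"] sum_diff_indicator[of u u' "\<lambda>_. 1"]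
    by (simp_all add: d_def flip: sum_distrib_left sum_distrib_right)
  have "G 0 \<le> G s" if s: "\<bar>0 - s\<bar> < e" for s
  proof -
    have "0 \<le> pmf \<pi> z + s * d z" for z
    proof (cases "d z = 0")
      case False
      then have "e \<le> pmf \<pi> z"
        using pos[OF False] by (auto simp: e_def set_pmf_iff intro!: Min_le)
      moreover have "\<bar>s * d z\<bar> \<le> \<bar>s\<bar> * 1"
        unfolding abs_mult by (intro mult_left_mono) (auto simp: d_def indicator_def)
      ultimately show ?thesis using s by linarith
    qed simp
    then have "\<exists>\<rho>\<in>couplings \<mu> \<nu>. \<forall>z. pmf \<rho> z = pmf \<pi> z + s * d z"
      by (intro coupling_of_weights) (auto simp: sum.distrib marg d0 simp flip: sum_distrib_left)
    then obtain \<rho> where "\<rho> \<in> couplings \<mu> \<nu>" "\<And>z. pmf \<rho> z = pmf \<pi> z + s * d z" by blast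
    then show ?thesis
      using min[of \<rho>] by (simp add: G_def kl_def expectation_eq_sum)
  qed
  moreover have "(G has_real_derivative (\<Sum>z\<in>UNIV. d z * (ln (pmf \<pi> z / pmf Q z) + 1))) (at 0)"
    unfolding G_def
  proof (rule DERIV_sum)
    fix z
    show "((\<lambda>s. (pmf \<pi> z + s * d z) * ln ((pmf \<pi> z + s * d z) / pmf Q z)) has_real_derivative
        d z * (ln (pmf \<pi> z / pmf Q z) + 1)) (at 0)"
    proof (cases "d z = 0")
      case False
      show ?thesis
        using pos[OF False] Q[of z] by (auto intro!: derivative_eq_intros simp: field_simps)
    qed simp
  qed
  ultimately have "(\<Sum>z\<in>UNIV. d z * (ln (pmf \<pi> z / pmf Q z) + 1)) = 0"
    using DERIV_local_min[OF _ e] by blast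
  \<comment> \<open>The constants \<open>+ 1\<close> from the derivative cancel in the alternating
    sum over the corners.\<close>
  then show ?thesis by (simp add: sum_d l_def)
qed

text \<open>The density of the minimizer has rank one on the product of the supports, so one row and
  one column of it give the factors \<open>a\<close> and \<open>b\<close>. They vanish off the
  supports, hence the mean of their product under \<open>Q\<close> is the total mass of
  \<open>\<pi>\<close>.\<close>

lemma information_projection:
  fixes Q :: "('u::finite \<times> 'v::finite) pmf" and \<mu> :: "'u pmf" and \<nu> :: "'v pmf"
  assumes Q: "\<And>u v. 0 < pmf Q (u, v)"
  obtains \<pi> a b where "\<pi> \<in> couplings \<mu> \<nu>"
    and "\<And>c. c > 1 \<Longrightarrow> min_kl_div c \<mu> \<nu> Q = ereal (kl \<pi> Q / ln c)"
    and "\<And>u. 0 \<le> a u" and "\<And>v. 0 \<le> b v"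
    and "\<And>u. u \<in> set_pmf \<mu> \<Longrightarrow> 0 < a u" and "\<And>v. v \<in> set_pmf \<nu> \<Longrightarrow> 0 < b v"
    and "\<E> Q (\<lambda>z. a (fst z) * b (snd z)) = 1"
    and "\<E> \<mu> (\<lambda>u. ln (a u)) + \<E> \<nu> (\<lambda>v. ln (b v)) = kl \<pi> Q"
proof -
  have Q': "0 < pmf Q z" for z using Q by (cases z) auto
  have kl: "kl_div c \<rho> Q = ereal (kl \<rho> Q / ln c)" if "c > 1" for c \<rho>
    using Q' that by (intro kl_div_eq_kl) (auto simp: set_pmf_eq less_le)
  \<comment> \<open>Base 2 is arbitrary: a change of base rescales all divergences by the same
    positive factor and keeps the minimizer.\<close>
  obtain \<pi> where \<pi>: "\<pi> \<in> couplings \<mu> \<nu>" "kl_div 2 \<pi> Q = min_kl_div 2 \<mu> \<nu> Q"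
    using min_kl_div_attained[of 2 Q \<mu> \<nu>] Q by auto
  have min: "kl \<pi> Q \<le> kl \<rho> Q" if "\<rho> \<in> couplings \<mu> \<nu>" for \<rho>
  proof -
    have "kl_div 2 \<pi> Q \<le> kl_div 2 \<rho> Q"
      unfolding \<pi>(2) min_kl_div_def using that by (intro INF_lower)
    then show ?thesis by (simp add: kl divide_le_cancel)
  qed
  have mkl: "min_kl_div c \<mu> \<nu> Q = ereal (kl \<pi> Q / ln c)" if c: "c > 1" for c
    unfolding min_kl_div_def
  proof (rule antisym)
    show "(INF \<rho>\<in>couplings \<mu> \<nu>. kl_div c \<rho> Q) \<le> ereal (kl \<pi> Q / ln c)"
      using INF_lower[OF \<pi>(1), of "\<lambda>\<rho>. kl_div c \<rho> Q"] by (simp add: kl[OF c])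
    show "ereal (kl \<pi> Q / ln c) \<le> (INF \<rho>\<in>couplings \<mu> \<nu>. kl_div c \<rho> Q)"
      using c min by (intro INF_greatest) (simp add: kl divide_right_mono)
  qed
  obtain u0 where u0: "u0 \<in> set_pmf \<mu>" using set_pmf_not_empty by fast
  obtain v0 where v0: "v0 \<in> set_pmf \<nu>" using set_pmf_not_empty by fast
  define R where "R u v = pmf \<pi> (u, v) / pmf Q (u, v)" for u v
  have pos: "0 < R u v" if "u \<in> set_pmf \<mu>" "v \<in> set_pmf \<nu>" for u v
    using information_projection_positive[OF Q' \<pi>(1) min that] Q by (simp add: R_def)
  define a where "a u = (if u \<in> set_pmf \<mu> then R u v0 else 0)" for u
  define b where "b v = (if v \<in> set_pmf \<nu> then R u0 v / R u0 v0 else 0)" for v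
  have ab: "a u * b v = R u v" if uv: "u \<in> set_pmf \<mu>" "v \<in> set_pmf \<nu>" for u v
  proof -
    have "ln (R u v) - ln (R u v0) - ln (R u0 v) + ln (R u0 v0) = 0"
      unfolding R_def using information_projection_rectangle[OF Q' \<pi>(1) min uv(1) u0 uv(2) v0] by simp
    moreover have R: "0 < R u v" "0 < R u v0" "0 < R u0 v" "0 < R u0 v0"
      using pos uv u0 v0 by auto
    ultimately have "ln (R u v) = ln (R u v0 * (R u0 v / R u0 v0))"
      by (simp add: ln_mult ln_div)
    then have "exp (ln (R u v)) = exp (ln (R u v0 * (R u0 v / R u0 v0)))" by simp
    then have "R u v = R u v0 * (R u0 v / R u0 v0)"
      using R by simp
    then show ?thesis using uv by (simp add: a_def b_def)
  qed
  have supp: "fst z \<in> set_pmf \<mu> \<and> snd z \<in> set_pmf \<nu>" if "z \<in> set_pmf \<pi>" for z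
    using \<pi>(1) that by (auto simp: couplings_def)
  have "\<E> Q (\<lambda>z. a (fst z) * b (snd z)) = (\<Sum>z\<in>UNIV. pmf \<pi> z)"
    unfolding expectation_eq_sum
  proof (rule sum.cong)
    fix z :: "'u \<times> 'v"
    show "pmf Q z * (a (fst z) * b (snd z)) = pmf \<pi> z"
    proof (cases "fst z \<in> set_pmf \<mu> \<and> snd z \<in> set_pmf \<nu>")
      case True
      then show ?thesis using Q'[of z] by (simp add: ab R_def)
    next
      case False
      then have "pmf \<pi> z = 0" using supp[of z] by (auto simp: pmf_eq_0_set_pmf)
      then show ?thesis using False by (auto simp: a_def b_def)
    qed
  qed simp
  then have 1: "\<E> Q (\<lambda>z. a (fst z) * b (snd z)) = 1" by (simp add: sum_pmf_eq_1)
  have nn: "0 \<le> a u" "0 \<le> b v" for u v by (auto simp: a_def b_def R_def)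
  have ap: "0 < a u" if "u \<in> set_pmf \<mu>" for u using that pos v0 by (simp add: a_def)
  have bp: "0 < b v" if "v \<in> set_pmf \<nu>" for v using that pos u0 v0 by (simp add: b_def)
  have "\<E> \<mu> (\<lambda>u. ln (a u)) + \<E> \<nu> (\<lambda>v. ln (b v)) = \<E> \<pi> (\<lambda>z. ln (a (fst z)) + ln (b (snd z)))"
    using \<pi>(1) by (auto simp: couplings_def expectation_add)
  also have "\<dots> = kl \<pi> Q"
    unfolding kl_def
  proof (rule expectation_cong)
    fix z assume "z \<in> set_pmf \<pi>"
    note z = supp[OF this]
    have "ln (a (fst z)) + ln (b (snd z)) = ln (a (fst z) * b (snd z))"
      using z ap[of "fst z"] bp[of "snd z"] by (simp add: ln_mult)
    also have "\<dots> = ln (pmf \<pi> z / pmf Q z)" using z by (simp add: ab R_def)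
    finally show "ln (a (fst z)) + ln (b (snd z)) = ln (pmf \<pi> z / pmf Q z)" .
  qed
  finally show ?thesis using that \<pi>(1) mkl nn ap bp 1 by blast
qed

subsection \<open>Converse bounds\<close>

definition acceptance :: "('x \<Rightarrow> 'y pmf) \<Rightarrow> ('v, 'y) decider \<Rightarrow> 'x list \<Rightarrow> 'v list \<Rightarrow> real" where
  "acceptance \<Gamma> g xs vs = measure_pmf.prob (dmc \<Gamma> xs) {ys. g vs ys = H0}"

lemma acceptance_nonneg [simp]: "0 \<le> acceptance \<Gamma> g xs vs"
  and acceptance_le_1 [simp]: "acceptance \<Gamma> g xs vs \<le> 1"
  by (simp_all add: acceptance_def)

text \<open>Stated for any source law: with \<open>P\<close> in place of \<open>S\<close> it gives
  the probability of correctly accepting, the complement of the type I error.\<close>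

lemma type_II_error_eq:
  "type_II_error S \<Gamma> n f g = \<E> (replicate_pmf n S) (\<lambda>zs. acceptance \<Gamma> g (f (map fst zs)) (map snd zs))"
proof -
  have "pmf (dmc \<Gamma> xs \<bind> (\<lambda>ys. return_pmf (g vs ys))) H0 = acceptance \<Gamma> g xs vs" for xs vs
  proof -
    have "pmf (return_pmf (g vs ys)) H0 = indicator {ys. g vs ys = H0} ys" for ys
      by (simp add: indicator_def)
    then show ?thesis by (simp add: pmf_bind acceptance_def del: pmf_return)
  qed
  then show ?thesis
    by (simp add: type_II_error_def decision_pmf_def pmf_bind[of "replicate_pmf n S"])
qed

lemma type_I_error_eq: "type_I_error S \<Gamma> n f g = 1 - type_II_error S \<Gamma> n f g"
proof -
  have "(\<Sum>h\<in>{H0, H1}. pmf (decision_pmf S \<Gamma> n f g) h) = 1"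
    by (rule sum_pmf_eq_1) (auto intro: hypothesis.exhaust)
  then show ?thesis by (simp add: type_I_error_def type_II_error_def)
qed

section \<open>Weight and cost of codewords\<close>

definition weight :: "'x::zero list \<Rightarrow> nat" where
  "weight xs = length (filter (\<lambda>x. x \<noteq> 0) xs)"

lemma weight_simps [simp]:
  "weight [] = 0" "weight (x # xs) = (if x = 0 then weight xs else Suc (weight xs))"
  by (auto simp: weight_def)

lemma weight_le_cost:
  fixes c :: "'x::zero \<Rightarrow> real"
  assumes "\<And>x. 0 \<le> c x" "\<And>x. x \<noteq> 0 \<Longrightarrow> k \<le> c x"
  shows "real (weight xs) * k \<le> sum_list (map c xs)"
proof (induction xs)
  case (Cons x xs)
  then show ?case using assms(1)[of x] assms(2)[of x] by (auto simp: algebra_simps)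
qed simp

lemma expected_cost_eq:
  fixes S :: "('u::finite \<times> 'v::finite) pmf"
  assumes "block_encoder n f"
  shows "expected_cost S c n f = \<E> (replicate_pmf n S) (\<lambda>zs. sum_list (map c (f (map fst zs))))"
proof -
  have "expected_cost S c n f = \<E> (replicate_pmf n S) (\<lambda>zs. \<Sum>i<n. c (f (map fst zs) ! i))"
    by (simp add: expected_cost_def expectation_sum)
  also have "\<dots> = \<E> (replicate_pmf n S) (\<lambda>zs. sum_list (map c (f (map fst zs))))"
    using assms by (intro expectation_cong)
      (auto simp: block_encoder_def sum_list_sum_nth lessThan_atLeast0 dest!: length_replicate_pmf)
  finally show ?thesis .
qed

text \<open>Markov's inequality for the cost, in which every nonzero letter counts at least
  \<open>k\<close>.\<close>

lemma prob_high_weight_le: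
  fixes S :: "('u::finite \<times> 'v::finite) pmf" and c :: "'x::zero \<Rightarrow> real"
  assumes f: "block_encoder n f" and cost: "expected_cost S c n f \<le> B" "0 < B"
    and c: "\<And>x. 0 \<le> c x" "\<And>x. x \<noteq> 0 \<Longrightarrow> k \<le> c x" and "0 < k" "0 < \<delta>"
  shows "measure_pmf.prob (replicate_pmf n S) {zs. B / (\<delta> * k) < weight (f (map fst zs))} \<le> \<delta>"
proof -
  have "measure_pmf.prob (replicate_pmf n S) {zs. B / (\<delta> * k) < weight (f (map fst zs))}
    \<le> \<E> (replicate_pmf n S) (\<lambda>zs. sum_list (map c (f (map fst zs)))) / (B / \<delta>)"
  proof (rule markov_inequality)
    fix zs assume "zs \<in> {zs. B / (\<delta> * k) < weight (f (map fst zs))}"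
    then have "B / \<delta> \<le> real (weight (f (map fst zs))) * k"
      using \<open>0 < k\<close> \<open>0 < \<delta>\<close> by (simp add: field_simps)
    also have "\<dots> \<le> sum_list (map c (f (map fst zs)))"
      using c by (rule weight_le_cost)
    finally show "B / \<delta> \<le> sum_list (map c (f (map fst zs)))" .
  qed (use assms in \<open>auto intro!: sum_list_nonneg\<close>)
  also have "\<dots> \<le> B / (B / \<delta>)"
    using cost \<open>0 < \<delta>\<close> by (intro divide_right_mono) (auto simp: expected_cost_eq[OF f])
  finally show ?thesis using cost by simp
qed

lemma finite_lists_length: "finite {xs :: 'a::finite list. length xs = n}"
  using finite_lists_length_eq[of "UNIV :: 'a set" n] by simp

lemma sum_prod_list:
  fixes w :: "'a::finite \<Rightarrow> real"
  shows "(\<Sum>xs | length xs = n. prod_list (map w xs)) = (\<Sum>x\<in>UNIV. w x) ^ n"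
proof (induction n)
  case (Suc n)
  have "{xs :: 'a list. length xs = Suc n} = (\<lambda>(x, xs). x # xs) ` (UNIV \<times> {xs. length xs = n})"
    by (auto simp: length_Suc_conv)
  then have "(\<Sum>xs | length xs = Suc n. prod_list (map w xs)) =
      (\<Sum>(x, xs)\<in>UNIV \<times> {xs. length xs = n}. w x * prod_list (map w xs))"
    by (simp add: sum.reindex inj_on_def split_beta prod_eq_iff)
  also have "\<dots> = (\<Sum>x\<in>UNIV. w x) ^ Suc n"
    by (simp add: Suc.IH flip: sum.cartesian_product sum_distrib_left sum_distrib_right)
  finally show ?case .
qed simp

text \<open>
  Pigeonhole: under the product weights giving \<open>s\<close> to every nonzero letter, the words of
  sublinear weight are only subexponentially rare.
\<close>

lemma exists_frequent_word:
  fixes m :: "'x::{finite,zero} list \<Rightarrow> real"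
  assumes s: "0 < s" "s \<le> 1" and "0 < \<delta>"
    and \<delta>: "\<delta> \<le> (\<Sum>xs | length xs = n \<and> real (weight xs) \<le> w. m xs)"
  shows "\<exists>xs. length xs = n \<and> real (weight xs) \<le> w \<and> \<delta> * s powr w * exp (- (real CARD('x) * s * real n)) \<le> m xs"
proof (rule ccontr)
  assume contr: "\<not> ?thesis"
  define L where "L = {xs :: 'x list. length xs = n \<and> real (weight xs) \<le> w}"
  define r where "r = exp (- (real CARD('x) * s * real n))"
  have finL: "finite L" by (rule finite_subset[OF _ finite_lists_length[of n]]) (auto simp: L_def)
  have prod: "prod_list (map (\<lambda>x. if x = 0 then 1 else s) xs) = s ^ weight xs" for xs :: "'x list"
    by (induction xs) auto
  have L: "m xs < \<delta> * r * s ^ weight xs" if "xs \<in> L" for xs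
  proof -
    have "m xs < \<delta> * s powr w * r"
      using contr that by (auto simp: L_def r_def not_le)
    \<comment> \<open>As \<open>s\<close> is at most 1, a word of weight at most \<open>w\<close>
      has product weight at least \<open>s powr w\<close>.\<close>
    also have "s powr w \<le> s powr real (weight xs)"
      using that s by (intro powr_mono') (auto simp: L_def)
    finally show ?thesis
      using s \<open>0 < \<delta>\<close> by (simp add: r_def powr_realpow mult_ac)
  qed
  have "L \<noteq> {}" using \<delta> \<open>0 < \<delta>\<close> unfolding L_def[symmetric] by auto
  then have "(\<Sum>xs\<in>L. m xs) < (\<Sum>xs\<in>L. \<delta> * r * s ^ weight xs)"
    using finL L by (intro sum_strict_mono) auto
  also have "\<dots> \<le> \<delta> * r * (\<Sum>xs | length (xs :: 'x list) = n. s ^ weight xs)"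
    unfolding sum_distrib_left using finite_lists_length[of n] s \<open>0 < \<delta>\<close>
    by (intro sum_mono2) (auto simp: L_def r_def)
  \<comment> \<open>Over all words the product weights sum to an \<open>n\<close>-th power whose
    base is at most \<open>1 + CARD('x) * s\<close>; this cancels the factor
    \<open>r\<close>.\<close>
  also have "(\<Sum>xs | length (xs :: 'x list) = n. s ^ weight xs) = (\<Sum>x\<in>UNIV. if x = (0::'x) then 1 else s) ^ n"
    by (simp add: sum_prod_list flip: prod)
  also have "\<dots> \<le> exp (real CARD('x) * s) ^ n"
  proof (rule power_mono)
    have "(\<Sum>x\<in>UNIV. if x = (0::'x) then 1 else s) \<le> (\<Sum>x\<in>UNIV. (if x = (0::'x) then 1 else 0) + s)"
      using s by (intro sum_mono) auto
    also have "\<dots> = 1 + real CARD('x) * s" by (simp add: sum.distrib)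
    also have "\<dots> \<le> exp (real CARD('x) * s)" by (rule exp_ge_add_one_self)
    finally show "(\<Sum>x\<in>UNIV. if x = (0::'x) then 1 else s) \<le> exp (real CARD('x) * s)" .
  qed (use s in \<open>auto intro!: sum_nonneg\<close>)
  also have "\<delta> * r * exp (real CARD('x) * s) ^ n = \<delta>"
    by (simp add: r_def exp_of_nat_mult[symmetric] mult_ac flip: exp_add)
  finally show False
    using \<delta> \<open>0 < \<delta>\<close> s by (simp add: L_def r_def mult_left_mono)
qed

text \<open>After taking logarithms and dividing by \<open>n\<close>, both
  \<open>ln \<delta> / n\<close> and \<open>(w n / n) * ln s\<close> tend to 0.\<close>

lemma subexponential:
  fixes w :: "nat \<Rightarrow> real"
  assumes w: "(\<lambda>n. w n / real n) \<longlonglongrightarrow> 0" and "0 < \<delta>" "0 < s" "0 < \<eta>"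
  shows "\<forall>\<^sub>F n in sequentially. exp (- (\<eta> * real n)) \<le> \<delta> * s powr w n"
proof -
  have "(\<lambda>n. ln \<delta> / real n + w n / real n * ln s) \<longlonglongrightarrow> 0 + 0 * ln s"
    by (intro tendsto_intros w real_tendsto_divide_at_top filterlim_real_sequentially)
  then have "\<forall>\<^sub>F n in sequentially. - \<eta> < ln \<delta> / real n + w n / real n * ln s"
    using \<open>0 < \<eta>\<close> by (intro order_tendstoD) auto
  then show ?thesis
    using eventually_gt_at_top[of 0]
  proof eventually_elim
    case (elim n)
    then have "- (\<eta> * real n) < ln \<delta> + w n * ln s"
      by (simp add: field_simps)
    then have "exp (- (\<eta> * real n)) < exp (ln \<delta> + w n * ln s)" by simp
    also have "\<dots> = \<delta> * s powr w n" using assms by (simp add: exp_add powr_def)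
    finally show ?case by simp
  qed
qed

text \<open>The powers \<open>1 / r\<close> turn lower bounds
  \<open>exp (- (\<eta> * r * n))\<close> into \<open>exp (- (\<eta> * n))\<close>. As
  \<open>r\<close> is fixed before \<open>n\<close>, subexponentially small \<open>A\<close> and
  \<open>B\<close> lose only an arbitrarily small exponent.\<close>

lemma reverse_holder_bound:
  fixes K \<eta> r A B :: real
  assumes "0 < r" "0 < \<eta>" "exp (- (\<eta> * r * real n)) \<le> A" "exp (- (\<eta> * r * real n)) \<le> B"
  shows "exp (- (real n * (K + 2 * \<eta>))) \<le> exp (- K) ^ n * A powr (1 / r) * B powr (1 / r)"
proof -
  have "exp (- (\<eta> * real n)) \<le> A powr (1 / r)" if "exp (- (\<eta> * r * real n)) \<le> A" for A
    using powr_mono2[OF _ _ that, of "1 / r"] assms by (simp add: powr_def)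
  then have "exp (- K) ^ n * exp (- (\<eta> * real n)) * exp (- (\<eta> * real n)) \<le> exp (- K) ^ n * A powr (1 / r) * B powr (1 / r)"
    using assms by (intro mult_mono) auto
  then show ?thesis
    by (simp add: exp_of_nat_mult[symmetric] algebra_simps flip: exp_add)
qed

lemma powr_ge_self: "0 \<le> x \<Longrightarrow> x \<le> 1 \<Longrightarrow> r \<le> 1 \<Longrightarrow> x \<le> x powr r" for x r :: real
  using powr_mono'[of r 1 x] by (cases "x = 0") auto

lemma at_right_0_witness:
  assumes "\<forall>\<^sub>F r in at_right (0::real). P r"
  obtains r where "0 < r" "r < 1" "P r"
proof -
  have "\<forall>\<^sub>F r in at_right (0::real). P r \<and> 0 < r \<and> r < 1"
    using assms eventually_at_right_less[of 0] eventually_at_right_real[of 0 1]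
    by (auto simp: eventually_conj_iff elim: eventually_mono)
  then show ?thesis using that by (auto dest!: eventually_happens)
qed

section \<open>The converse for each of the three exponents\<close>

text \<open>By pigeonhole some low-weight word \<open>xs\<close> is sent and accepted with
  subexponentially small \<open>P\<close>-probability. So the \<open>U\<close>-event of sending
  \<open>xs\<close> and the acceptance of \<open>xs\<close> as a function of \<open>V\<close> have
  marginal means at least as large, and the reverse Hoelder inequality for \<open>\<pi>\<close>
  carries both to \<open>Q\<close> at once.\<close>

lemma converse_marginals:
  fixes P Q :: "('u::finite \<times> 'v::finite) pmf" and \<Gamma> :: "'x::{finite,zero} \<Rightarrow> 'y::finite pmf"
  assumes Q: "\<And>z. 0 < pmf Q z" and \<pi>: "\<pi> \<in> couplings (map_pmf fst P) (map_pmf snd P)"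
    and f: "\<And>n. n \<ge> 1 \<Longrightarrow> block_encoder n (f n)"
    and w: "(\<lambda>n. w n / real n) \<longlonglongrightarrow> 0" and "0 < \<delta>" "0 < \<eta>"
    and acc: "\<forall>\<^sub>F n in sequentially. \<delta> \<le> \<E> (replicate_pmf n P) (\<lambda>zs. acceptance \<Gamma> (g n) (f n (map fst zs)) (map snd zs) *
       of_bool (real (weight (f n (map fst zs))) \<le> w n))"
  shows "\<forall>\<^sub>F n in sequentially. exp (- (real n * (kl \<pi> Q + \<eta>))) \<le> type_II_error Q \<Gamma> n (f n) (g n)"
proof -
  let ?\<mu> = "map_pmf fst P" and ?\<nu> = "map_pmf snd P"
  have m: "map_pmf fst \<pi> = ?\<mu>" "map_pmf snd \<pi> = ?\<nu>" using \<pi> by (auto simp: couplings_def)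
  have "set_pmf ?\<mu> \<times> set_pmf ?\<nu> \<subseteq> set_pmf Q" using Q by (auto simp: set_pmf_eq less_le)
  then obtain r where r: "0 < r" "r < 1" and "\<forall>h k. (\<forall>u. 0 \<le> h u) \<longrightarrow> (\<forall>v. 0 \<le> k v) \<longrightarrow>
    exp (- (kl \<pi> Q + \<eta> / 3)) * \<E> ?\<mu> (\<lambda>u. h u powr r) powr (1 / r) * \<E> ?\<nu> (\<lambda>v. k v powr r) powr (1 / r)
    \<le> \<E> Q (\<lambda>z. h (fst z) * k (snd z))"
    using reverse_holder_pair[of \<pi> Q "\<eta> / 3"] \<open>0 < \<eta>\<close> unfolding m by (auto elim: at_right_0_witness)
  then have single: "exp (- (kl \<pi> Q + \<eta> / 3)) * \<E> ?\<mu> (\<lambda>u. h u powr r) powr (1 / r) * \<E> ?\<nu> (\<lambda>v. k v powr r) powr (1 / r)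
    \<le> \<E> Q (\<lambda>z. h (fst z) * k (snd z))" if "\<And>u. 0 \<le> h u" "\<And>v. 0 \<le> k v" for h k
    using that by blast
  \<comment> \<open>The factor \<open>r\<close> compensates the powers \<open>1 / r\<close> taken at
    the end. Half of \<open>\<zeta>\<close> is lost to \<open>\<delta>\<close> and the weight bound,
    half to the pigeonhole factor through the choice of \<open>s\<close>.\<close>
  define \<zeta> where "\<zeta> = \<eta> / 3 * r"
  have \<zeta>: "0 < \<zeta>" using \<open>0 < \<eta>\<close> r by (simp add: \<zeta>_def)
  define s where "s = min 1 (\<zeta> / 2 / real CARD('x))"
  have s: "0 < s" "s \<le> 1" "real CARD('x) * s \<le> \<zeta> / 2"
    using \<zeta> by (auto simp: s_def field_simps min_def)
  have "\<forall>\<^sub>F n in sequentially. exp (- (\<zeta> / 2 * real n)) \<le> \<delta> * s powr w n"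
    using w \<open>0 < \<delta>\<close> s \<zeta> by (intro subexponential) auto
  then show ?thesis
    using acc eventually_ge_at_top[of 1]
  proof eventually_elim
    case (elim n)
    have fn: "length (f n us) = n" if "length us = n" for us
      using f[OF elim(3)] that by (simp add: block_encoder_def)
    \<comment> \<open>The \<open>P\<close>-probability that \<open>xs\<close> is sent and
      accepted.\<close>
    define m where "m xs = \<E> (replicate_pmf n P) (\<lambda>zs. acceptance \<Gamma> (g n) xs (map snd zs) * of_bool (f n (map fst zs) = xs))" for xs
    define L where "L = {xs :: 'x list. length xs = n \<and> real (weight xs) \<le> w n}"
    have finL: "finite L" by (rule finite_subset[OF _ finite_lists_length[of n]]) (auto simp: L_def)
    have "\<E> (replicate_pmf n P) (\<lambda>zs. acceptance \<Gamma> (g n) (f n (map fst zs)) (map snd zs) *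
       of_bool (real (weight (f n (map fst zs))) \<le> w n)) = (\<Sum>xs\<in>L. m xs)"
      unfolding m_def
    proof (subst expectation_sum[symmetric], simp, rule expectation_cong)
      fix zs assume "zs \<in> set_pmf (replicate_pmf n P)"
      then have "length (f n (map fst zs)) = n" by (intro fn) (auto dest: length_replicate_pmf)
      then have "(\<Sum>xs\<in>L. acceptance \<Gamma> (g n) xs (map snd zs) * of_bool (f n (map fst zs) = xs)) =
          (if f n (map fst zs) \<in> L then acceptance \<Gamma> (g n) (f n (map fst zs)) (map snd zs) else 0)"
        using finL by (simp add: of_bool_def if_distrib[of "\<lambda>x. _ * x"] cong: if_cong)
      then show "acceptance \<Gamma> (g n) (f n (map fst zs)) (map snd zs) * of_bool (real (weight (f n (map fst zs))) \<le> w n)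
        = (\<Sum>xs\<in>L. acceptance \<Gamma> (g n) xs (map snd zs) * of_bool (f n (map fst zs) = xs))"
        using \<open>length (f n (map fst zs)) = n\<close> by (simp add: L_def)
    qed
    with elim(2) have "\<delta> \<le> (\<Sum>xs | length xs = n \<and> real (weight xs) \<le> w n. m xs)"
      by (simp add: L_def)
    then obtain xs where xs: "\<delta> * s powr w n * exp (- (real CARD('x) * s * real n)) \<le> m xs"
      using exists_frequent_word[of s \<delta>] s \<open>0 < \<delta>\<close> by blast
    have "exp (- (\<zeta> * real n)) = exp (- (\<zeta> / 2 * real n)) * exp (- (\<zeta> / 2 * real n))"
      by (simp flip: exp_add add: algebra_simps)
    also have "\<dots> \<le> \<delta> * s powr w n * exp (- (real CARD('x) * s * real n))"
      using elim(1) s \<open>0 < \<delta>\<close> mult_right_mono[OF s(3), of "real n"] by (intro mult_mono) auto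
    also note xs
    finally have mx: "exp (- (\<zeta> * real n)) \<le> m xs" .
    define F :: "'u list \<Rightarrow> real" where "F us = of_bool (f n us = xs)" for us
    define G where "G vs = acceptance \<Gamma> (g n) xs vs" for vs
    \<comment> \<open>Dropping either factor, each at most 1, leaves a function of one coordinate;
      from here only the marginals of \<open>P\<close> matter.\<close>
    have "m xs \<le> \<E> (replicate_pmf n P) (\<lambda>zs. F (map fst zs))"
      unfolding m_def F_def by (intro expectation_mono) (auto simp: mult_le_cancel_right)
    also have "\<dots> = \<E> (replicate_pmf n ?\<mu>) (\<lambda>us. F us powr r)"
      unfolding expectation_map_replicate by (intro expectation_cong) (simp add: F_def)
    finally have A: "m xs \<le> \<E> (replicate_pmf n ?\<mu>) (\<lambda>us. F us powr r)" .
    have "m xs \<le> \<E> (replicate_pmf n P) (\<lambda>zs. G (map snd zs))"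
      unfolding m_def G_def by (intro expectation_mono) (auto simp: of_bool_def)
    also have "\<dots> = \<E> (replicate_pmf n ?\<nu>) G"
      by (rule expectation_map_replicate)
    also have "\<dots> \<le> \<E> (replicate_pmf n ?\<nu>) (\<lambda>vs. G vs powr r)"
      using r by (intro expectation_mono powr_ge_self) (auto simp: G_def)
    finally have B: "m xs \<le> \<E> (replicate_pmf n ?\<nu>) (\<lambda>vs. G vs powr r)" .
    have "exp (- (real n * (kl \<pi> Q + \<eta>))) = exp (- (real n * (kl \<pi> Q + \<eta> / 3 + 2 * (\<eta> / 3))))"
      by (simp add: algebra_simps)
    also have "\<dots> \<le> exp (- (kl \<pi> Q + \<eta> / 3)) ^ n * \<E> (replicate_pmf n ?\<mu>) (\<lambda>us. F us powr r) powr (1 / r) *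
        \<E> (replicate_pmf n ?\<nu>) (\<lambda>vs. G vs powr r) powr (1 / r)"
      using mx A B r \<open>0 < \<eta>\<close> by (intro reverse_holder_bound) (auto simp: \<zeta>_def)
    also have "\<dots> \<le> \<E> (replicate_pmf n Q) (\<lambda>zs. F (map fst zs) * G (map snd zs))"
      using r by (intro reverse_holder_pair_replicate single) (auto simp: F_def G_def)
    also have "\<dots> \<le> type_II_error Q \<Gamma> n (f n) (g n)"
      unfolding type_II_error_eq by (intro expectation_mono) (auto simp: F_def G_def)
    finally show ?case .
  qed
qed

lemma dmc_const: "dmc (\<lambda>_. p) xs = replicate_pmf (length xs) p"
  by (induction xs) auto

text \<open>Change of channel letter by letter: only a nonzero input costs a factor
  \<open>\<rho>\<close>.\<close>

lemma expectation_dmc_le_weight: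
  fixes \<Gamma> \<Gamma>' :: "'x::zero \<Rightarrow> 'y::finite pmf"
  assumes \<Gamma>: "\<And>y. pmf (\<Gamma> 0) y \<le> pmf (\<Gamma>' 0) y" "\<And>x y. pmf (\<Gamma> x) y \<le> \<rho> * pmf (\<Gamma>' x) y" and "0 \<le> \<rho>"
    and "\<And>ys. 0 \<le> h ys"
  shows "\<E> (dmc \<Gamma> xs) h \<le> \<rho> ^ weight xs * \<E> (dmc \<Gamma>' xs) h"
  using assms(4)
proof (induction xs arbitrary: h)
  case (Cons x xs)
  define k where "k = (if x = 0 then 1 else \<rho>)"
  have "\<E> (dmc \<Gamma> (x # xs)) h \<le> \<E> (\<Gamma> x) (\<lambda>y. \<rho> ^ weight xs * \<E> (dmc \<Gamma>' xs) (\<lambda>ys. h (y # ys)))"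
    unfolding expectation_dmc_Cons by (intro expectation_mono Cons.IH Cons.prems) auto
  also have "\<dots> \<le> k * \<E> (\<Gamma>' x) (\<lambda>y. \<rho> ^ weight xs * \<E> (dmc \<Gamma>' xs) (\<lambda>ys. h (y # ys)))"
    unfolding expectation_eq_sum[of "\<Gamma> x"] expectation_eq_sum[of "\<Gamma>' x"] sum_distrib_left mult.assoc[symmetric]
    using \<Gamma> \<open>0 \<le> \<rho>\<close> Cons.prems
    by (intro sum_mono mult_right_mono expectation_nonneg) (auto simp: k_def intro!: mult_right_mono)
  also have "\<dots> = \<rho> ^ weight (x # xs) * \<E> (dmc \<Gamma>' (x # xs)) h"
    unfolding expectation_dmc_Cons by (simp add: k_def)
  finally show ?case .
qed simp

text \<open>The channel that always acts as \<open>\<Gamma> 0\<close> answers any word as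
  \<open>\<Gamma>\<close> answers the all-zero word; the change of channel is used in both
  directions.\<close>

lemma acceptance_le_zero_input:
  fixes \<Gamma> :: "'x::zero \<Rightarrow> 'y::finite pmf"
  assumes "\<And>x x' y. pmf (\<Gamma> x) y \<le> \<rho> * pmf (\<Gamma> x') y" "0 \<le> \<rho>"
  shows "acceptance \<Gamma> g xs vs \<le> \<rho> ^ weight xs * acceptance \<Gamma> g (replicate (length xs) 0) vs"
    and "acceptance \<Gamma> g (replicate (length xs) 0) vs \<le> \<rho> ^ weight xs * acceptance \<Gamma> g xs vs"
  using expectation_dmc_le_weight[of \<Gamma> "\<lambda>_. \<Gamma> 0" \<rho> "indicator {ys. g vs ys = H0}" xs]
    expectation_dmc_le_weight[of "\<lambda>_. \<Gamma> 0" \<Gamma> \<rho> "indicator {ys. g vs ys = H0}" xs] assms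
  by (simp_all add: acceptance_def dmc_const dmc_replicate)

text \<open>Replacing a codeword of weight at most \<open>w n\<close> by zeros costs a factor
  \<open>\<rho> powr w n\<close>, which is subexponential. Afterwards the acceptance depends on
  \<open>V\<close> alone.\<close>

lemma zero_input_acceptance:
  fixes P :: "('u::finite \<times> 'v::finite) pmf" and \<Gamma> :: "'x::{finite,zero} \<Rightarrow> 'y::finite pmf"
  assumes \<rho>: "\<And>x x' y. pmf (\<Gamma> x) y \<le> \<rho> * pmf (\<Gamma> x') y" "1 \<le> \<rho>"
    and f: "\<And>n. n \<ge> 1 \<Longrightarrow> block_encoder n (f n)"
    and w: "(\<lambda>n. w n / real n) \<longlonglongrightarrow> 0" and "0 < \<delta>" "0 < \<eta>"
    and acc: "\<forall>\<^sub>F n in sequentially. \<delta> \<le> \<E> (replicate_pmf n P) (\<lambda>zs. acceptance \<Gamma> (g n) (f n (map fst zs)) (map snd zs) *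
       of_bool (real (weight (f n (map fst zs))) \<le> w n))"
  shows "\<forall>\<^sub>F n in sequentially. exp (- (\<eta> * real n)) \<le> \<E> (replicate_pmf n (map_pmf snd P)) (acceptance \<Gamma> (g n) (replicate n 0))"
proof -
  have "\<forall>\<^sub>F n in sequentially. exp (- (\<eta> * real n)) \<le> \<delta> * (1 / \<rho>) powr w n"
    using w \<open>0 < \<delta>\<close> \<open>0 < \<eta>\<close> \<rho>(2) by (intro subexponential) auto
  then show ?thesis
    using acc eventually_ge_at_top[of 1]
  proof eventually_elim
    case (elim n)
    have "\<delta> \<le> \<E> (replicate_pmf n P) (\<lambda>zs. \<rho> powr w n * acceptance \<Gamma> (g n) (replicate n 0) (map snd zs))"
      using elim(2)
    proof (rule order_trans, intro expectation_mono)
      fix zs assume "zs \<in> set_pmf (replicate_pmf n P)"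
      then have len: "length (f n (map fst zs)) = n"
        using f[OF elim(3)] by (auto simp: block_encoder_def dest: length_replicate_pmf)
      show "acceptance \<Gamma> (g n) (f n (map fst zs)) (map snd zs) * of_bool (real (weight (f n (map fst zs))) \<le> w n)
        \<le> \<rho> powr w n * acceptance \<Gamma> (g n) (replicate n 0) (map snd zs)"
      proof (cases "real (weight (f n (map fst zs))) \<le> w n")
        case True
        have "acceptance \<Gamma> (g n) (f n (map fst zs)) (map snd zs)
          \<le> \<rho> ^ weight (f n (map fst zs)) * acceptance \<Gamma> (g n) (replicate n 0) (map snd zs)"
          using acceptance_le_zero_input(1)[of \<Gamma> \<rho> "g n" "f n (map fst zs)"] \<rho> len by simp
        also have "\<rho> ^ weight (f n (map fst zs)) = \<rho> powr real (weight (f n (map fst zs)))"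
          using \<rho>(2) by (simp add: powr_realpow)
        also have "\<dots> \<le> \<rho> powr w n"
          using True \<rho>(2) by (intro powr_mono) auto
        finally show ?thesis using True by (simp add: mult_right_mono)
      qed simp
    qed simp
    also have "\<dots> = \<rho> powr w n * \<E> (replicate_pmf n (map_pmf snd P)) (acceptance \<Gamma> (g n) (replicate n 0))"
      by (simp flip: map_replicate_pmf)
    finally have "\<delta> * (1 / \<rho>) powr w n \<le> \<E> (replicate_pmf n (map_pmf snd P)) (acceptance \<Gamma> (g n) (replicate n 0))"
      using \<rho>(2) by (simp add: powr_divide field_simps)
    with elim(1) show ?case by linarith
  qed
qed

text \<open>For every codeword, cheap or not, the output can imitate that of the all-zero word at
  exponent \<open>D\<close>, and independently \<open>V\<close> can imitate its law under
  \<open>P\<close>. The two reverse Hoelder inequalities are chained through the function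
  \<open>A powr (1 / r)\<close>, where \<open>A\<close> is the acceptance of the all-zero
  word.\<close>

lemma converse_channel:
  fixes P Q :: "('u::finite \<times> 'v::finite) pmf" and \<Gamma> :: "'x::{finite,zero} \<Rightarrow> 'y::finite pmf"
  assumes Q: "set_pmf (map_pmf snd P) \<subseteq> set_pmf (map_pmf snd Q)"
    and \<rho>: "\<And>x x' y. pmf (\<Gamma> x) y \<le> \<rho> * pmf (\<Gamma> x') y" "1 \<le> \<rho>"
    and D: "\<And>x. kl (\<Gamma> 0) (\<Gamma> x) \<le> D"
    and f: "\<And>n. n \<ge> 1 \<Longrightarrow> block_encoder n (f n)"
    and w: "(\<lambda>n. w n / real n) \<longlonglongrightarrow> 0" and "0 < \<delta>" "0 < \<eta>"
    and acc: "\<forall>\<^sub>F n in sequentially. \<delta> \<le> \<E> (replicate_pmf n P) (\<lambda>zs. acceptance \<Gamma> (g n) (f n (map fst zs)) (map snd zs) *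
       of_bool (real (weight (f n (map fst zs))) \<le> w n))"
  shows "\<forall>\<^sub>F n in sequentially. exp (- (real n * (kl (map_pmf snd P) (map_pmf snd Q) + D + \<eta>))) \<le> type_II_error Q \<Gamma> n (f n) (g n)"
proof -
  let ?\<nu> = "map_pmf snd P" and ?q = "map_pmf snd Q"
  define \<kappa> where "\<kappa> = \<eta> / 3"
  have \<kappa>: "0 < \<kappa>" using \<open>0 < \<eta>\<close> by (simp add: \<kappa>_def)
  have supp: "set_pmf (\<Gamma> 0) \<subseteq> set_pmf (\<Gamma> x)" for x
  proof
    fix y assume "y \<in> set_pmf (\<Gamma> 0)"
    then show "y \<in> set_pmf (\<Gamma> x)" using \<rho>(1)[of 0 y x] by (auto simp: set_pmf_eq pmf_pos dest: antisym)
  qed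
  \<comment> \<open>There are finitely many input letters, so one \<open>r\<close> serves all of
    them.\<close>
  have "\<forall>\<^sub>F r in at_right 0. \<forall>x. \<forall>h. (\<forall>y. 0 \<le> h y) \<longrightarrow>
      exp (- (kl (\<Gamma> 0) (\<Gamma> x) + \<kappa>)) * \<E> (\<Gamma> 0) (\<lambda>y. h y powr r) powr (1 / r) \<le> \<E> (\<Gamma> x) h"
    using reverse_holder[OF supp \<kappa>] by (intro eventually_all_finite) auto
  with reverse_holder[OF Q \<kappa>]
  have "\<forall>\<^sub>F r in at_right 0. (\<forall>x. \<forall>h. (\<forall>y. 0 \<le> h y) \<longrightarrow>
      exp (- (kl (\<Gamma> 0) (\<Gamma> x) + \<kappa>)) * \<E> (\<Gamma> 0) (\<lambda>y. h y powr r) powr (1 / r) \<le> \<E> (\<Gamma> x) h) \<and>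
    (\<forall>h. (\<forall>x. 0 \<le> h x) \<longrightarrow> exp (- (kl ?\<nu> ?q + \<kappa>)) * \<E> ?\<nu> (\<lambda>x. h x powr r) powr (1 / r) \<le> \<E> ?q h)"
    by eventually_elim auto
  then obtain r where r: "0 < r" "r < 1" and
    *: "(\<forall>x. \<forall>h. (\<forall>y. 0 \<le> h y) \<longrightarrow>
      exp (- (kl (\<Gamma> 0) (\<Gamma> x) + \<kappa>)) * \<E> (\<Gamma> 0) (\<lambda>y. h y powr r) powr (1 / r) \<le> \<E> (\<Gamma> x) h) \<and>
    (\<forall>h. (\<forall>x. 0 \<le> h x) \<longrightarrow> exp (- (kl ?\<nu> ?q + \<kappa>)) * \<E> ?\<nu> (\<lambda>x. h x powr r) powr (1 / r) \<le> \<E> ?q h)"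
    by (rule at_right_0_witness)
  have singleq: "exp (- (kl ?\<nu> ?q + \<kappa>)) * \<E> ?\<nu> (\<lambda>x. h x powr r) powr (1 / r) \<le> \<E> ?q h"
    if "\<And>x. 0 \<le> h x" for h
    using * that by blast
  define K where "K = exp (- (D + \<kappa>))"
  have single0: "K * \<E> (\<Gamma> 0) (\<lambda>y. h y powr r) powr (1 / r) \<le> \<E> (\<Gamma> x) h" if "\<And>y. 0 \<le> h y" for x h
  proof -
    have "K * \<E> (\<Gamma> 0) (\<lambda>y. h y powr r) powr (1 / r) \<le>
        exp (- (kl (\<Gamma> 0) (\<Gamma> x) + \<kappa>)) * \<E> (\<Gamma> 0) (\<lambda>y. h y powr r) powr (1 / r)"
      using D[of x] by (intro mult_right_mono) (auto simp: K_def)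
    also have "\<dots> \<le> \<E> (\<Gamma> x) h" using * that by blast
    finally show ?thesis .
  qed
  have "\<forall>\<^sub>F n in sequentially. exp (- (\<kappa> * r * real n)) \<le> \<E> (replicate_pmf n ?\<nu>) (acceptance \<Gamma> (g n) (replicate n 0))"
    using \<rho> f w \<open>0 < \<delta>\<close> acc r \<kappa> by (intro zero_input_acceptance[where w = w]) auto
  then show ?thesis
    using eventually_ge_at_top[of 1]
  proof eventually_elim
    case (elim n)
    define A where "A vs = acceptance \<Gamma> (g n) (replicate n 0) vs" for vs
    have A: "0 \<le> A vs" for vs by (simp add: A_def)
    have chan: "K ^ n * A vs powr (1 / r) \<le> acceptance \<Gamma> (g n) xs vs" if "length xs = n" for xs vs
    proof -
      let ?I = "indicator {ys. g n vs ys = H0} :: _ \<Rightarrow> real"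
      have "K ^ length xs * \<E> (replicate_pmf (length xs) (\<Gamma> 0)) (\<lambda>ys. ?I ys powr r) powr (1 / r) \<le> \<E> (dmc \<Gamma> xs) ?I"
        using r by (intro reverse_holder_dmc single0) (auto simp: K_def)
      moreover have "?I ys powr r = ?I ys" for ys by (simp add: indicator_def)
      ultimately show ?thesis
        using that by (simp add: A_def acceptance_def dmc_replicate)
    qed
    \<comment> \<open>Of \<open>\<eta> = 3 * \<kappa>\<close>, one \<open>\<kappa>\<close> each goes
      to the channel, to the source and to the acceptance of the all-zero word.\<close>
    have "exp (- (real n * (kl ?\<nu> ?q + D + \<eta>))) \<le> exp (- (real n * (kl ?\<nu> ?q + D + 2 * \<kappa> + 2 * (\<kappa> / 2))))"
      by (simp add: \<kappa>_def algebra_simps)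
    also have "\<dots> \<le> exp (- (kl ?\<nu> ?q + D + 2 * \<kappa>)) ^ n * \<E> (replicate_pmf n ?\<nu>) A powr (1 / r) * 1 powr (1 / r)"
    proof (rule order_trans[OF _ eq_refl])
      show "exp (- (real n * (kl ?\<nu> ?q + D + 2 * \<kappa> + 2 * (\<kappa> / 2)))) \<le> 
        exp (- (kl ?\<nu> ?q + D + 2 * \<kappa>)) ^ n * (\<E> (replicate_pmf n ?\<nu>) A powr (1 / r))"
      proof -
        have "exp (- (\<kappa> * real n)) \<le> \<E> (replicate_pmf n ?\<nu>) A powr (1 / r)"
          using powr_mono2[OF _ _ elim(1), of "1 / r"] r by (simp add: powr_def A_def[abs_def])
        then have "exp (- (kl ?\<nu> ?q + D + 2 * \<kappa>)) ^ n * exp (- (\<kappa> * real n)) \<le>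
            exp (- (kl ?\<nu> ?q + D + 2 * \<kappa>)) ^ n * \<E> (replicate_pmf n ?\<nu>) A powr (1 / r)"
          by (intro mult_left_mono) auto
        then show ?thesis by (simp add: exp_of_nat_mult[symmetric] algebra_simps flip: exp_add)
      qed
    qed simp
    \<comment> \<open>The \<open>r\<close>-th power in the source norm undoes the power
      \<open>1 / r\<close> produced by the channel bound.\<close>
    also have "\<dots> = K ^ n * (exp (- (kl ?\<nu> ?q + \<kappa>)) ^ n * \<E> (replicate_pmf n ?\<nu>) (\<lambda>vs. (A vs powr (1 / r)) powr r) powr (1 / r))"
      using r A by (simp add: K_def powr_powr exp_of_nat_mult[symmetric] algebra_simps flip: exp_add)
    also have "\<dots> \<le> K ^ n * \<E> (replicate_pmf n ?q) (\<lambda>vs. A vs powr (1 / r))"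
      using r by (intro mult_left_mono reverse_holder_replicate singleq) (auto simp: K_def)
    also have "\<dots> = \<E> (replicate_pmf n Q) (\<lambda>zs. K ^ n * A (map snd zs) powr (1 / r))"
      by (simp flip: map_replicate_pmf)
    also have "\<dots> \<le> type_II_error Q \<Gamma> n (f n) (g n)"
      unfolding type_II_error_eq
      using f[OF elim(2)] by (intro expectation_mono chan) (auto simp: block_encoder_def dest: length_replicate_pmf)
    finally show ?case .
  qed
qed

text \<open>Under \<open>Q\<close> the codeword is light with probability at least
  \<open>\<delta>\<close>, an event of \<open>U\<close> alone, and the all-zero word is accepted
  with subexponential probability over \<open>V\<close> from \<open>P\<close>. The reverse Hoelder
  inequality joins the two at exponent \<open>kl \<pi> Q\<close>, and on the light event the true
  codeword replaces the all-zero word at a subexponential loss.\<close>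

lemma converse_both:
  fixes P Q :: "('u::finite \<times> 'v::finite) pmf" and \<Gamma> :: "'x::{finite,zero} \<Rightarrow> 'y::finite pmf"
  assumes Q: "\<And>z. 0 < pmf Q z" and \<pi>: "\<pi> \<in> couplings (map_pmf fst Q) (map_pmf snd P)"
    and \<rho>: "\<And>x x' y. pmf (\<Gamma> x) y \<le> \<rho> * pmf (\<Gamma> x') y" "1 \<le> \<rho>"
    and f: "\<And>n. n \<ge> 1 \<Longrightarrow> block_encoder n (f n)"
    and w: "(\<lambda>n. w n / real n) \<longlonglongrightarrow> 0" and "0 < \<delta>" "0 < \<eta>"
    and acc: "\<forall>\<^sub>F n in sequentially. \<delta> \<le> \<E> (replicate_pmf n P) (\<lambda>zs. acceptance \<Gamma> (g n) (f n (map fst zs)) (map snd zs) *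
       of_bool (real (weight (f n (map fst zs))) \<le> w n))"
    and low: "\<forall>\<^sub>F n in sequentially. \<delta> \<le> measure_pmf.prob (replicate_pmf n Q) {zs. real (weight (f n (map fst zs))) \<le> w n}"
  shows "\<forall>\<^sub>F n in sequentially. exp (- (real n * (kl \<pi> Q + \<eta>))) \<le> type_II_error Q \<Gamma> n (f n) (g n)"
proof -
  let ?\<mu> = "map_pmf fst Q" and ?\<nu> = "map_pmf snd P"
  \<comment> \<open>Four equal losses: the reverse Hoelder constant, its two norms, and the return
    from the all-zero word to the codeword.\<close>
  define \<kappa> where "\<kappa> = \<eta> / 4"
  have \<kappa>: "0 < \<kappa>" using \<open>0 < \<eta>\<close> by (simp add: \<kappa>_def)
  have m: "map_pmf fst \<pi> = ?\<mu>" "map_pmf snd \<pi> = ?\<nu>" using \<pi> by (auto simp: couplings_def)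
  have "set_pmf ?\<mu> \<times> set_pmf ?\<nu> \<subseteq> set_pmf Q" using Q by (auto simp: set_pmf_eq less_le)
  then obtain r where r: "0 < r" "r < 1" and "\<forall>h k. (\<forall>u. 0 \<le> h u) \<longrightarrow> (\<forall>v. 0 \<le> k v) \<longrightarrow>
    exp (- (kl \<pi> Q + \<kappa>)) * \<E> ?\<mu> (\<lambda>u. h u powr r) powr (1 / r) * \<E> ?\<nu> (\<lambda>v. k v powr r) powr (1 / r)
    \<le> \<E> Q (\<lambda>z. h (fst z) * k (snd z))"
    using reverse_holder_pair[of \<pi> Q \<kappa>] \<kappa> unfolding m by (auto elim: at_right_0_witness)
  then have single: "exp (- (kl \<pi> Q + \<kappa>)) * \<E> ?\<mu> (\<lambda>u. h u powr r) powr (1 / r) * \<E> ?\<nu> (\<lambda>v. k v powr r) powr (1 / r)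
    \<le> \<E> Q (\<lambda>z. h (fst z) * k (snd z))" if "\<And>u. 0 \<le> h u" "\<And>v. 0 \<le> k v" for h k
    using that by blast
  have "\<forall>\<^sub>F n in sequentially. exp (- (\<kappa> * r * real n)) \<le> \<E> (replicate_pmf n ?\<nu>) (acceptance \<Gamma> (g n) (replicate n 0))"
    using \<rho> f w \<open>0 < \<delta>\<close> acc r \<kappa> by (intro zero_input_acceptance[where w = w]) auto
  \<comment> \<open>Base 1 makes the second factor trivial: this only says that the constant
    \<open>\<delta>\<close> is eventually large enough.\<close>
  moreover have "\<forall>\<^sub>F n in sequentially. exp (- (\<kappa> * r * real n)) \<le> \<delta> * 1 powr w n"
    using w \<open>0 < \<delta>\<close> \<kappa> r by (intro subexponential) auto
  moreover have "\<forall>\<^sub>F n in sequentially. exp (- (\<kappa> * real n)) \<le> 1 * (1 / \<rho>) powr w n"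
    using w \<open>0 < \<delta>\<close> \<kappa> \<rho>(2) by (intro subexponential) auto
  ultimately show ?thesis
    using low eventually_ge_at_top[of 1]
  proof eventually_elim
    case (elim n)
    define F :: "'u list \<Rightarrow> real" where "F us = of_bool (real (weight (f n us)) \<le> w n)" for us
    define A where "A vs = acceptance \<Gamma> (g n) (replicate n 0) vs" for vs
    have "\<E> (replicate_pmf n Q) (\<lambda>zs. F (map fst zs)) =
        \<E> (replicate_pmf n Q) (indicator {zs. real (weight (f n (map fst zs))) \<le> w n})"
      by (intro expectation_cong) (simp add: F_def)
    with elim(4) have "\<delta> \<le> \<E> (replicate_pmf n Q) (\<lambda>zs. F (map fst zs))" by simp
    also have "\<dots> = \<E> (replicate_pmf n ?\<mu>) (\<lambda>us. F us powr r)"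
      unfolding expectation_map_replicate by (intro expectation_cong) (simp add: F_def)
    finally have F: "exp (- (\<kappa> * r * real n)) \<le> \<E> (replicate_pmf n ?\<mu>) (\<lambda>us. F us powr r)"
      using elim(2) by simp
    have "\<E> (replicate_pmf n ?\<nu>) A \<le> \<E> (replicate_pmf n ?\<nu>) (\<lambda>vs. A vs powr r)"
      using r by (intro expectation_mono powr_ge_self) (auto simp: A_def)
    with elim(1) have G: "exp (- (\<kappa> * r * real n)) \<le> \<E> (replicate_pmf n ?\<nu>) (\<lambda>vs. A vs powr r)"
      by (simp add: A_def[abs_def])
    have "exp (- (real n * (kl \<pi> Q + \<eta>))) = exp (- (\<kappa> * real n)) * exp (- (real n * (kl \<pi> Q + \<kappa> + 2 * \<kappa>)))"
      by (simp add: \<kappa>_def algebra_simps flip: exp_add)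
    also have "\<dots> \<le> (1 / \<rho>) powr w n * (exp (- (kl \<pi> Q + \<kappa>)) ^ n * \<E> (replicate_pmf n ?\<mu>) (\<lambda>us. F us powr r) powr (1 / r) *
        \<E> (replicate_pmf n ?\<nu>) (\<lambda>vs. A vs powr r) powr (1 / r))"
      using elim(3) F G r \<kappa> by (intro mult_mono reverse_holder_bound) auto
    also have "\<dots> \<le> (1 / \<rho>) powr w n * \<E> (replicate_pmf n Q) (\<lambda>zs. F (map fst zs) * A (map snd zs))"
      using r by (intro mult_left_mono reverse_holder_pair_replicate single) (auto simp: F_def A_def)
    also have "\<dots> = \<E> (replicate_pmf n Q) (\<lambda>zs. (1 / \<rho>) powr w n * (F (map fst zs) * A (map snd zs)))"
      by simp
    also have "\<dots> \<le> type_II_error Q \<Gamma> n (f n) (g n)"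
      unfolding type_II_error_eq
    proof (intro expectation_mono)
      fix zs assume "zs \<in> set_pmf (replicate_pmf n Q)"
      then have len: "length (f n (map fst zs)) = n"
        using f[OF elim(5)] by (auto simp: block_encoder_def dest: length_replicate_pmf)
      show "(1 / \<rho>) powr w n * (F (map fst zs) * A (map snd zs)) \<le> acceptance \<Gamma> (g n) (f n (map fst zs)) (map snd zs)"
      proof (cases "real (weight (f n (map fst zs))) \<le> w n")
        case True
        have "A (map snd zs) \<le> \<rho> ^ weight (f n (map fst zs)) * acceptance \<Gamma> (g n) (f n (map fst zs)) (map snd zs)"
          using acceptance_le_zero_input(2)[of \<Gamma> \<rho> "g n" "f n (map fst zs)"] \<rho> len by (simp add: A_def)
        also have "\<rho> ^ weight (f n (map fst zs)) = \<rho> powr real (weight (f n (map fst zs)))"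
          using \<rho>(2) by (simp add: powr_realpow)
        also have "\<dots> * acceptance \<Gamma> (g n) (f n (map fst zs)) (map snd zs) \<le> \<rho> powr w n * acceptance \<Gamma> (g n) (f n (map fst zs)) (map snd zs)"
          using True \<rho>(2) by (intro mult_right_mono powr_mono) auto
        finally show ?thesis using True \<rho>(2) by (simp add: F_def powr_divide field_simps)
      qed (simp add: F_def)
    qed simp
    finally show ?case .
  qed
qed

subsection \<open>Exponents\<close>

lemma exponent_le:
  assumes b: "b > 1" and \<theta>: "ereal \<theta> \<le> liminf (\<lambda>n. error_exponent b n (\<beta> n))"
    and \<beta>: "\<And>\<eta>. 0 < \<eta> \<Longrightarrow> \<forall>\<^sub>F n in sequentially. exp (- (real n * (E + \<eta>))) \<le> \<beta> n"
  shows "\<theta> \<le> E / ln b"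
proof (rule field_le_epsilon)
  fix e :: real assume e: "0 < e"
  have lb: "0 < ln b" using b by simp
  have "\<forall>\<^sub>F n in sequentially. error_exponent b n (\<beta> n) \<le> ereal (E / ln b + e)"
    using \<beta>[OF mult_pos_pos[OF e lb]] eventually_gt_at_top[of 0]
  proof eventually_elim
    case (elim n)
    have pos: "0 < \<beta> n" using elim(1) exp_gt_zero less_le_trans by blast
    then have "- (real n * (E + e * ln b)) \<le> ln (\<beta> n)"
      using elim(1) by (simp add: ln_ge_iff)
    then have "- ln (\<beta> n) / (real n * ln b) \<le> real n * (E + e * ln b) / (real n * ln b)"
      using lb by (intro divide_right_mono) auto
    also have "\<dots> = E / ln b + e" using lb elim(2) by (simp add: field_simps)
    finally show ?case using pos by (simp add: error_exponent_def log_def)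
  qed
  then have "liminf (\<lambda>n. error_exponent b n (\<beta> n)) \<le> liminf (\<lambda>n. ereal (E / ln b + e))"
    by (rule Liminf_mono)
  also have "\<dots> = ereal (E / ln b + e)" by (simp add: Liminf_const)
  finally show "\<theta> \<le> E / ln b + e" using \<theta> by (metis ereal_less_eq(3) order_trans)
qed

text \<open>Passage from the expected cost to a weight bound that fails with probability at most
  \<open>\<delta>\<close>; the bound \<open>w\<close> inherits sublinear growth from
  \<open>C\<close>.\<close>

lemma achievable_low_weight:
  fixes P Q :: "('u::finite \<times> 'v::finite) pmf" and \<Gamma> :: "'x::{finite,zero} \<Rightarrow> 'y::finite pmf"
  assumes \<theta>: "\<theta> \<in> achievable_exponents b P Q \<Gamma> c \<H> \<epsilon> C" and "H0 \<in> \<H>"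
    and c_nonneg: "\<And>x. c x \<ge> 0" and c_zero: "\<And>x. c x = 0 \<longleftrightarrow> x = 0"
    and nontrivial: "(UNIV :: 'x set) - {0} \<noteq> {}"
    and eps: "0 \<le> \<epsilon>" "\<epsilon> < 1"
    and C_unbounded: "filterlim C at_top sequentially"
    and C_sublinear: "(\<lambda>n. C n / real n) \<longlonglongrightarrow> 0"
  obtains f g w \<delta> where "\<And>n. n \<ge> 1 \<Longrightarrow> block_encoder n (f n)"
    and "(\<lambda>n. w n / real n) \<longlonglongrightarrow> 0" and "0 < \<delta>"
    and "\<forall>\<^sub>F n in sequentially. \<delta> \<le> \<E> (replicate_pmf n P) (\<lambda>zs. acceptance \<Gamma> (g n) (f n (map fst zs)) (map snd zs) *
       of_bool (real (weight (f n (map fst zs))) \<le> w n))"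
    and "H1 \<in> \<H> \<Longrightarrow> \<forall>\<^sub>F n in sequentially. \<delta> \<le> measure_pmf.prob (replicate_pmf n Q) {zs. real (weight (f n (map fst zs))) \<le> w n}"
    and "ereal \<theta> \<le> liminf (\<lambda>n. error_exponent b n (type_II_error Q \<Gamma> n (f n) (g n)))"
proof -
  obtain f :: "nat \<Rightarrow> ('u, 'x) encoder" and g :: "nat \<Rightarrow> ('v, 'y) decider" where
    f: "\<And>n. n \<ge> 1 \<Longrightarrow> block_encoder n (f n)" and
    cost: "\<And>n h. n \<ge> 1 \<Longrightarrow> h \<in> \<H> \<Longrightarrow> expected_cost (case h of H0 \<Rightarrow> P | H1 \<Rightarrow> Q) c n (f n) \<le> C n" and
    \<alpha>: "limsup (\<lambda>n. ereal (type_I_error P \<Gamma> n (f n) (g n))) \<le> ereal \<epsilon>" and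
    \<beta>: "ereal \<theta> \<le> liminf (\<lambda>n. error_exponent b n (type_II_error Q \<Gamma> n (f n) (g n)))"
    using \<theta> unfolding achievable_exponents_def by blast
  define k where "k = Min (c ` (UNIV - {0}))"
  have "k \<in> c ` (UNIV - {0})"
    unfolding k_def using nontrivial by (intro Min_in) auto
  then have k: "0 < k" "\<And>x. x \<noteq> 0 \<Longrightarrow> k \<le> c x"
    using c_nonneg c_zero by (auto simp: k_def less_le)
  \<comment> \<open>The type I error is eventually below the midpoint
    \<open>(1 + \<epsilon>) / 2\<close>, so acceptance has probability at least
    \<open>2 * \<delta>\<close>, of which heavy codewords take away at most
    \<open>\<delta>\<close>.\<close>
  define \<delta> where "\<delta> = (1 - \<epsilon>) / 4"
  have \<delta>: "0 < \<delta>" "\<delta> \<le> 1 / 4" using eps by (auto simp: \<delta>_def)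
  define w where "w n = C n / (\<delta> * k)" for n
  have "(\<lambda>n. C n / real n / (\<delta> * k)) \<longlonglongrightarrow> 0 / (\<delta> * k)"
    using k \<delta> by (intro tendsto_intros C_sublinear) auto
  then have w: "(\<lambda>n. w n / real n) \<longlonglongrightarrow> 0" by (simp add: w_def mult_ac)
  have high: "measure_pmf.prob (replicate_pmf n (case h of H0 \<Rightarrow> P | H1 \<Rightarrow> Q)) {zs. w n < weight (f n (map fst zs))} \<le> \<delta>"
    if "h \<in> \<H>" "n \<ge> 1" "0 < C n" for h n
    unfolding w_def using f cost that c_nonneg k \<delta> by (intro prob_high_weight_le) auto
  have C: "\<forall>\<^sub>F n in sequentially. 0 < C n"
    using C_unbounded by (rule filterlim_at_top_dense[THEN iffD1, rule_format])
  have "limsup (\<lambda>n. ereal (type_I_error P \<Gamma> n (f n) (g n))) < ereal ((1 + \<epsilon>) / 2)"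
    using \<alpha> eps by (elim le_less_trans) auto
  then have "\<forall>\<^sub>F n in sequentially. ereal (type_I_error P \<Gamma> n (f n) (g n)) < ereal ((1 + \<epsilon>) / 2)"
    by (rule Limsup_lessD)
  then have acc: "\<forall>\<^sub>F n in sequentially. \<delta> \<le> \<E> (replicate_pmf n P) (\<lambda>zs. acceptance \<Gamma> (g n) (f n (map fst zs)) (map snd zs) *
       of_bool (real (weight (f n (map fst zs))) \<le> w n))"
    using C eventually_ge_at_top[of 1]
  proof eventually_elim
    case (elim n)
    have "2 * \<delta> \<le> \<E> (replicate_pmf n P) (\<lambda>zs. acceptance \<Gamma> (g n) (f n (map fst zs)) (map snd zs))"
      using elim(1) by (simp add: type_I_error_eq type_II_error_eq \<delta>_def field_simps)
    also have "\<dots> \<le> \<E> (replicate_pmf n P) (\<lambda>zs. acceptance \<Gamma> (g n) (f n (map fst zs)) (map snd zs) *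
       of_bool (real (weight (f n (map fst zs))) \<le> w n) + indicator {zs. w n < weight (f n (map fst zs))} zs)"
      by (intro expectation_mono) (auto simp: indicator_def)
    also have "\<dots> = \<E> (replicate_pmf n P) (\<lambda>zs. acceptance \<Gamma> (g n) (f n (map fst zs)) (map snd zs) *
       of_bool (real (weight (f n (map fst zs))) \<le> w n)) +
       measure_pmf.prob (replicate_pmf n P) {zs. w n < weight (f n (map fst zs))}"
      by (simp add: expectation_add)
    also have "measure_pmf.prob (replicate_pmf n P) {zs. w n < weight (f n (map fst zs))} \<le> \<delta>"
      using high[OF \<open>H0 \<in> \<H>\<close> elim(3,2)] by simp
    finally show ?case by simp
  qed
  have low: "\<forall>\<^sub>F n in sequentially. \<delta> \<le> measure_pmf.prob (replicate_pmf n Q) {zs. real (weight (f n (map fst zs))) \<le> w n}"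
    if "H1 \<in> \<H>"
    using C eventually_ge_at_top[of 1]
  proof eventually_elim
    case (elim n)
    have eq: "{zs. real (weight (f n (map fst zs))) \<le> w n} = UNIV - {zs. w n < weight (f n (map fst zs))}" by auto
    have "measure_pmf.prob (replicate_pmf n Q) {zs. real (weight (f n (map fst zs))) \<le> w n} =
        1 - measure_pmf.prob (replicate_pmf n Q) {zs. w n < weight (f n (map fst zs))}"
      unfolding eq using measure_pmf.prob_compl[of "{zs. w n < weight (f n (map fst zs))}" "replicate_pmf n Q"] by simp
    then show ?case
      using high[OF that elim(2,1)] \<delta>(2) by simp
  qed
  show ?thesis by (rule that[OF f w \<delta>(1) acc low \<beta>])
qed

text \<open>The convention for the empty set is consistent: without achievable exponents the third
  assumption forces \<open>E = 0\<close>.\<close>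

lemma stein_exponent_eqI:
  assumes "\<And>\<theta>. \<theta> \<in> achievable_exponents b P Q \<Gamma> c \<H> \<epsilon> C \<Longrightarrow> \<theta> \<le> E" and "0 \<le> E"
    and "\<And>\<theta>. 0 < \<theta> \<Longrightarrow> \<theta> < E \<Longrightarrow> \<theta> \<in> achievable_exponents b P Q \<Gamma> c \<H> \<epsilon> C"
  shows "stein_exponent b P Q \<Gamma> c \<H> \<epsilon> C = ereal E"
proof -
  define A where "A = achievable_exponents b P Q \<Gamma> c \<H> \<epsilon> C"
  show ?thesis
  proof (cases "A = {}")
    case True
    then have "\<not> 0 < E" using assms(3)[of "E / 2"] by (auto simp: A_def)
    with assms(2) True show ?thesis by (simp add: stein_exponent_def A_def)
  next
    case False
    have "ereal E \<le> (SUP \<theta>\<in>A. ereal \<theta>)"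
    proof (rule ereal_le_epsilon2)
      fix e :: real assume "0 < e"
      show "ereal E \<le> (SUP \<theta>\<in>A. ereal \<theta>) + ereal e"
      proof (cases "0 < E")
        case True
        define \<theta> where "\<theta> = max (E / 2) (E - e)"
        have "\<theta> \<in> A" unfolding A_def using True \<open>0 < e\<close> by (intro assms(3)) (auto simp: \<theta>_def)
        then have "ereal \<theta> \<le> (SUP \<theta>\<in>A. ereal \<theta>)" by (rule SUP_upper)
        then have "ereal \<theta> + ereal e \<le> (SUP \<theta>\<in>A. ereal \<theta>) + ereal e" by (rule add_right_mono)
        moreover have "E \<le> \<theta> + e" by (simp add: \<theta>_def)
        then have "ereal E \<le> ereal \<theta> + ereal e" by simp
        ultimately show ?thesis by (rule order_trans[rotated])
      next
        case False': False
        obtain \<theta> where \<theta>: "\<theta> \<in> A" using False by blast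
        then have "0 < \<theta>" by (simp add: A_def achievable_exponents_def)
        moreover have "\<theta> \<le> E" using assms(1) \<theta> by (simp add: A_def)
        ultimately show ?thesis using False' by simp
      qed
    qed
    moreover have "(SUP \<theta>\<in>A. ereal \<theta>) \<le> ereal E"
      using assms(1) by (intro SUP_least) (auto simp: A_def)
    ultimately show ?thesis
      using False by (simp add: stein_exponent_def A_def antisym)
  qed
qed

section \<open>Coding schemes\<close>

text \<open>A vanishing type I error meets every \<open>\<epsilon> \<ge> 0\<close>, and the constant
  \<open>M\<close> changes the exponent only by \<open>ln M / n\<close> up to the base, which the
  strict inequality on \<open>\<theta>\<close> absorbs.\<close>

lemma achievableI:
  fixes P Q :: "('u::finite \<times> 'v::finite) pmf" and \<Gamma> :: "'x \<Rightarrow> 'y::finite pmf"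
  assumes b: "b > 1" and eps: "0 \<le> \<epsilon>" and \<theta>: "0 < \<theta>" "\<theta> < E / ln b"
    and f: "\<And>n. n \<ge> 1 \<Longrightarrow> block_encoder n (f n)"
    and cost: "\<And>n h. n \<ge> 1 \<Longrightarrow> h \<in> \<H> \<Longrightarrow> expected_cost (case h of H0 \<Rightarrow> P | H1 \<Rightarrow> Q) c n (f n) \<le> C n"
    and \<alpha>: "\<forall>\<^sub>F n in sequentially. type_I_error P \<Gamma> n (f n) (g n) \<le> a n" "a \<longlonglongrightarrow> 0"
    and \<beta>: "\<forall>\<^sub>F n in sequentially. type_II_error Q \<Gamma> n (f n) (g n) \<le> M * exp (- (real n * E))"
  shows "\<theta> \<in> achievable_exponents b P Q \<Gamma> c \<H> \<epsilon> C"
proof -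
  have lb: "0 < ln b" using b by simp
  have "limsup (\<lambda>n. ereal (type_I_error P \<Gamma> n (f n) (g n))) \<le> limsup (\<lambda>n. ereal (a n))"
    using \<alpha>(1) by (intro Limsup_mono) (auto elim: eventually_mono)
  also have "\<dots> = 0"
    using \<alpha>(2) by (intro lim_imp_Limsup) (auto simp: zero_ereal_def)
  also have "0 \<le> ereal \<epsilon>" using eps by simp
  finally have 1: "limsup (\<lambda>n. ereal (type_I_error P \<Gamma> n (f n) (g n))) \<le> ereal \<epsilon>" .
  have "(\<lambda>n. E / ln b - ln M / ln b / real n) \<longlonglongrightarrow> E / ln b - 0"
    by (intro tendsto_intros real_tendsto_divide_at_top filterlim_real_sequentially)
  then have "\<forall>\<^sub>F n in sequentially. \<theta> < E / ln b - ln M / ln b / real n"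
    using \<theta>(2) by (intro order_tendstoD) auto
  then have "\<forall>\<^sub>F n in sequentially. ereal \<theta> \<le> error_exponent b n (type_II_error Q \<Gamma> n (f n) (g n))"
    using \<beta> eventually_gt_at_top[of 0]
  proof eventually_elim
    case (elim n)
    define \<beta>n where "\<beta>n = type_II_error Q \<Gamma> n (f n) (g n)"
    show ?case
    proof (cases "\<beta>n = 0")
      case True
      then show ?thesis by (simp add: error_exponent_def \<beta>n_def)
    next
      case False
      then have pos: "0 < \<beta>n" by (simp add: \<beta>n_def type_II_error_def less_le)
      then have "0 < M * exp (- (real n * E))" using elim(2) by (simp add: \<beta>n_def)
      then have M: "0 < M" by (simp add: zero_less_mult_iff)
      have "ln \<beta>n \<le> ln (M * exp (- (real n * E)))"
        using elim(2) pos by (simp add: \<beta>n_def)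
      also have "\<dots> = ln M - real n * E" using M by (simp add: ln_mult)
      finally have "(real n * E - ln M) / (real n * ln b) \<le> - ln \<beta>n / (real n * ln b)"
        using lb by (intro divide_right_mono) auto
      moreover have "(real n * E - ln M) / (real n * ln b) = E / ln b - ln M / ln b / real n"
        using lb elim(3) by (simp add: field_simps)
      ultimately have "\<theta> \<le> - ln \<beta>n / (real n * ln b)" using elim(1) by linarith
      then show ?thesis using False by (simp add: error_exponent_def log_def \<beta>n_def)
    qed
  qed
  then have 2: "ereal \<theta> \<le> liminf (\<lambda>n. error_exponent b n (type_II_error Q \<Gamma> n (f n) (g n)))"
    by (rule Liminf_bounded)
  show ?thesis
    unfolding achievable_exponents_def using \<theta>(1) f cost 1 2 by blast
qed

lemma expected_cost_two_words:
  fixes S :: "('u::finite \<times> 'v::finite) pmf"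
  assumes "block_encoder n f" "0 \<le> d" "\<And>us. us \<in> T \<Longrightarrow> length us = n \<Longrightarrow> sum_list (map c (f us)) \<le> 0"
    "\<And>us. length us = n \<Longrightarrow> sum_list (map c (f us)) \<le> d"
  shows "expected_cost S c n f \<le> d * measure_pmf.prob (replicate_pmf n (map_pmf fst S)) (- T)"
proof -
  have "expected_cost S c n f \<le> \<E> (replicate_pmf n S) (\<lambda>zs. d * indicator (- T) (map fst zs))"
    unfolding expected_cost_eq[OF assms(1)] using assms
    by (intro expectation_mono) (auto simp: indicator_def dest: length_replicate_pmf)
  also have "\<dots> = \<E> (replicate_pmf n (map_pmf fst S)) (\<lambda>us. d * indicator (- T) us)"
    by (rule expectation_map_replicate)
  finally show ?thesis by simp
qed

text \<open>Typical \<open>U\<close> blocks send zeros, others repeat \<open>x'\<close>; the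
  decision is \<open>H0\<close> when \<open>vs\<close> lies in \<open>B\<close> and the output looks
  like that of zeros. A type II error needs either both blocks in \<open>T\<close> and
  \<open>B\<close>, or a word of letters \<open>x'\<close> mistaken for zeros while
  \<open>vs\<close> lies in \<open>B\<close>; in the second term the channel noise makes the
  probabilities multiply. As \<open>T\<close> fails with probability at most \<open>K / n\<close>,
  the expected cost is at most \<open>c x' * K\<close>.\<close>

lemma achievable_full_support:
  fixes P Q :: "('u::finite \<times> 'v::finite) pmf" and \<Gamma> :: "'x::{finite,zero} \<Rightarrow> 'y::finite pmf"
  assumes b: "b > 1" and eps: "0 \<le> \<epsilon>" and \<theta>: "0 < \<theta>" "\<theta> < E / ln b"
    and c: "c 0 = 0" "\<And>x. 0 \<le> c x"
    and C_nonneg: "\<And>n. n \<ge> 1 \<Longrightarrow> C n \<ge> 0" and C_unbounded: "filterlim C at_top sequentially"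
    and T: "\<And>n h. n \<ge> 1 \<Longrightarrow> h \<in> \<H> \<Longrightarrow>
      measure_pmf.prob (replicate_pmf n (map_pmf fst (case h of H0 \<Rightarrow> P | H1 \<Rightarrow> Q))) (- T) \<le> K / real n"
    and "H0 \<in> \<H>"
    and B: "\<And>n. n \<ge> 1 \<Longrightarrow> measure_pmf.prob (replicate_pmf n (map_pmf snd P)) (- B) \<le> KB / real n"
    and Y: "\<And>n. n \<ge> 1 \<Longrightarrow> measure_pmf.prob (replicate_pmf n (\<Gamma> 0)) (- Y) \<le> KY / real n"
    and rate: "\<And>n. measure_pmf.prob (replicate_pmf n Q) {zs. map fst zs \<in> T \<and> map snd zs \<in> B} +
      measure_pmf.prob (replicate_pmf n (map_pmf snd Q)) B * measure_pmf.prob (replicate_pmf n (\<Gamma> x')) Y \<le> M * exp (- (real n * E))"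
  shows "\<theta> \<in> achievable_exponents b P Q \<Gamma> c \<H> \<epsilon> C"
proof -
  define f :: "nat \<Rightarrow> ('u, 'x) encoder" where
    \<comment> \<open>When the budget is below \<open>c x' * K\<close>, which happens for only
      finitely many \<open>n\<close>, the free all-zero word is always sent.\<close>
    "f n us = (if us \<in> T \<or> C n < c x' * K then replicate n 0 else replicate n x')" for n us
  define g :: "nat \<Rightarrow> ('v, 'y) decider" where
    "g n vs ys = (if vs \<in> B \<and> ys \<in> Y then H0 else H1)" for n vs ys
  have acc: "acceptance \<Gamma> (g n) (replicate n x) vs = of_bool (vs \<in> B) * measure_pmf.prob (replicate_pmf n (\<Gamma> x)) Y" for n x vs
    by (simp add: acceptance_def dmc_replicate g_def)
  have "block_encoder n (f n)" for n
    by (simp add: block_encoder_def f_def)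
  moreover have "expected_cost (case h of H0 \<Rightarrow> P | H1 \<Rightarrow> Q) c n (f n) \<le> C n" if n: "n \<ge> 1" and h: "h \<in> \<H>" for n h
  proof (cases "C n < c x' * K")
    case True
    then have "expected_cost (case h of H0 \<Rightarrow> P | H1 \<Rightarrow> Q) c n (f n) \<le> 0 * measure_pmf.prob (replicate_pmf n (map_pmf fst (case h of H0 \<Rightarrow> P | H1 \<Rightarrow> Q))) (- UNIV)"
      using c by (intro expected_cost_two_words) (auto simp: block_encoder_def f_def sum_list_replicate)
    then show ?thesis using C_nonneg[OF n] by simp
  next
    case False
    then have "expected_cost (case h of H0 \<Rightarrow> P | H1 \<Rightarrow> Q) c n (f n) \<le>
        (real n * c x') * measure_pmf.prob (replicate_pmf n (map_pmf fst (case h of H0 \<Rightarrow> P | H1 \<Rightarrow> Q))) (- T)"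
      using c by (intro expected_cost_two_words) (auto simp: block_encoder_def f_def sum_list_replicate)
    also have "\<dots> \<le> (real n * c x') * (K / real n)"
      using T[OF n h] c by (intro mult_left_mono) auto
    also have "\<dots> = c x' * K" using n by simp
    finally show ?thesis using False by simp
  qed
  moreover have "type_I_error P \<Gamma> n (f n) (g n) \<le> (K + KB + KY) / real n" if n: "n \<ge> 1" for n
  proof -
    let ?y = "measure_pmf.prob (replicate_pmf n (\<Gamma> 0)) (- Y)"
    have y: "measure_pmf.prob (replicate_pmf n (\<Gamma> 0)) Y = 1 - ?y"
      using measure_pmf.prob_compl[of Y "replicate_pmf n (\<Gamma> 0)"] by (simp add: Compl_eq_Diff_UNIV)
    have "1 = \<E> (replicate_pmf n P) (\<lambda>_. 1)" by simp
    also have "\<dots> \<le> \<E> (replicate_pmf n P) (\<lambda>zs. acceptance \<Gamma> (g n) (f n (map fst zs)) (map snd zs)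
        + (indicator (- T) (map fst zs) + (indicator (- B) (map snd zs) + ?y)))"
    proof (rule expectation_mono)
      fix zs
      show "1 \<le> acceptance \<Gamma> (g n) (f n (map fst zs)) (map snd zs)
        + (indicator (- T) (map fst zs) + (indicator (- B) (map snd zs) + ?y))"
        by (cases "map fst zs \<in> T"; cases "map snd zs \<in> B") (simp_all add: f_def acc y)
    qed simp
    also have "\<dots> = type_II_error P \<Gamma> n (f n) (g n) + (\<E> (replicate_pmf n P) (\<lambda>zs. indicator (- T) (map fst zs)) +
        (\<E> (replicate_pmf n P) (\<lambda>zs. indicator (- B) (map snd zs)) + ?y))"
      by (simp add: expectation_add type_II_error_eq)
    also have "\<E> (replicate_pmf n P) (\<lambda>zs. indicator (- T) (map fst zs)) \<le> K / real n"
      unfolding expectation_map_replicate using T[OF n \<open>H0 \<in> \<H>\<close>] by simp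
    also have "\<E> (replicate_pmf n P) (\<lambda>zs. indicator (- B) (map snd zs)) \<le> KB / real n"
      unfolding expectation_map_replicate using B[OF n] by simp
    also have "?y \<le> KY / real n" using Y[OF n] .
    finally show ?thesis by (simp add: type_I_error_eq add_divide_distrib)
  qed
  moreover have "(\<lambda>n. (K + KB + KY) / real n) \<longlonglongrightarrow> 0"
    by (rule real_tendsto_divide_at_top[OF tendsto_const filterlim_real_sequentially])
  moreover have "\<forall>\<^sub>F n in sequentially. type_II_error Q \<Gamma> n (f n) (g n) \<le> M * exp (- (real n * E))"
    \<comment> \<open>Eventually the budget suffices and \<open>T\<close> alone selects the
      word.\<close>
    using filterlim_at_top[THEN iffD1, OF C_unbounded, rule_format, of "c x' * K"]
  proof eventually_elim
    case (elim n)
    let ?y = "measure_pmf.prob (replicate_pmf n (\<Gamma> x')) Y"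
    have "type_II_error Q \<Gamma> n (f n) (g n) \<le> \<E> (replicate_pmf n Q)
        (\<lambda>zs. indicator {zs. map fst zs \<in> T \<and> map snd zs \<in> B} zs + indicator B (map snd zs) * ?y)"
      unfolding type_II_error_eq using elim by (intro expectation_mono)
        (auto simp: f_def acc indicator_def intro!: order_trans[OF measure_pmf.prob_le_1])
    also have "\<dots> = measure_pmf.prob (replicate_pmf n Q) {zs. map fst zs \<in> T \<and> map snd zs \<in> B} +
        \<E> (replicate_pmf n Q) (\<lambda>zs. indicator B (map snd zs)) * ?y"
      by (simp add: expectation_add)
    also have "\<dots> \<le> M * exp (- (real n * E))"
      unfolding expectation_map_replicate using rate[of n] by simp
    finally show ?case .
  qed
  ultimately show ?thesis
    using b eps \<theta> by (intro achievableI[where f = f and g = g and a = "\<lambda>n. (K + KB + KY) / real n" and M = M])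
      (auto intro: eventually_mono[OF eventually_ge_at_top[of 1]])
qed

lemma prob_symbol_absent:
  fixes \<Gamma> :: "'x \<Rightarrow> 'y::finite pmf"
  shows "measure_pmf.prob (dmc \<Gamma> (replicate k x @ xs)) {ys. y \<notin> set (take k ys)} = (1 - pmf (\<Gamma> x) y) ^ k"
proof (induction k)
  case (Suc k)
  have "\<E> (dmc \<Gamma> (x # replicate k x @ xs)) (indicator {ys. y \<notin> set (take (Suc k) ys)})
      = \<E> (\<Gamma> x) (\<lambda>y'. indicator (- {y}) y' * \<E> (dmc \<Gamma> (replicate k x @ xs)) (indicator {ys. y \<notin> set (take k ys)}))"
    unfolding expectation_dmc_Cons integral_mult_right_zero[symmetric]
    by (intro expectation_cong) (auto simp: indicator_def)
  also have "\<dots> = measure_pmf.prob (\<Gamma> x) (- {y}) * (1 - pmf (\<Gamma> x) y) ^ k"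
    by (simp add: Suc.IH)
  also have "measure_pmf.prob (\<Gamma> x) (- {y}) = 1 - pmf (\<Gamma> x) y"
    using measure_pmf.prob_compl[of "{y}" "\<Gamma> x"] by (simp add: Compl_eq_Diff_UNIV measure_pmf_single)
  finally show ?case by simp
qed simp

text \<open>A short prefix conveys whether \<open>us\<close> lies in \<open>T\<close>: the output
  \<open>y\<close> cannot arise from \<open>x1\<close>, so seeing it proves that \<open>x0\<close>
  was sent, and type II errors occur only with both blocks in \<open>T\<close> and \<open>B\<close>.
  The cost bound holds for every source block, hence under either hypothesis.\<close>

lemma achievable_zero_error:
  fixes P Q :: "('u::finite \<times> 'v::finite) pmf" and \<Gamma> :: "'x::{finite,zero} \<Rightarrow> 'y::finite pmf"
  assumes b: "b > 1" and eps: "0 \<le> \<epsilon>" and \<theta>: "0 < \<theta>" "\<theta> < E / ln b"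
    and c: "c 0 = 0" "\<And>x. 0 \<le> c x"
    and C_nonneg: "\<And>n. n \<ge> 1 \<Longrightarrow> C n \<ge> 0" and C_unbounded: "filterlim C at_top sequentially"
    and T: "\<And>n. n \<ge> 1 \<Longrightarrow> measure_pmf.prob (replicate_pmf n (map_pmf fst P)) (- T) \<le> K / real n"
    and B: "\<And>n. n \<ge> 1 \<Longrightarrow> measure_pmf.prob (replicate_pmf n (map_pmf snd P)) (- B) \<le> KB / real n"
    and rate: "\<And>n. measure_pmf.prob (replicate_pmf n Q) {zs. map fst zs \<in> T \<and> map snd zs \<in> B} \<le> M * exp (- (real n * E))"
    and y: "0 < pmf (\<Gamma> x0) y" "pmf (\<Gamma> x1) y = 0"
  shows "\<theta> \<in> achievable_exponents b P Q \<Gamma> c \<H> \<epsilon> C"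
proof -
  \<comment> \<open>The summand 1 makes \<open>m\<close> positive, as needed for the division
    below.\<close>
  define m where "m = max (c x0) (c x1) + 1"
  have m: "0 < m" "c x0 \<le> m" "c x1 \<le> m" using c(2)[of x0] by (auto simp: m_def)
  \<comment> \<open>The largest prefix length that fits both the block and the budget; it tends to
    infinity, so \<open>y\<close> is missed with vanishing probability.\<close>
  define k where "k n = min n (nat \<lfloor>C n / m\<rfloor>)" for n
  define f :: "nat \<Rightarrow> ('u, 'x) encoder" where
    "f n us = replicate (k n) (if us \<in> T then x0 else x1) @ replicate (n - k n) 0" for n us
  define g :: "nat \<Rightarrow> ('v, 'y) decider" where
    "g n vs ys = (if vs \<in> B \<and> y \<in> set (take (k n) ys) then H0 else H1)" for n vs ys
  have acc: "acceptance \<Gamma> (g n) (f n us) vs = of_bool (vs \<in> B) * (1 - (1 - pmf (\<Gamma> (if us \<in> T then x0 else x1)) y) ^ k n)" for n us vs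
  proof -
    let ?p = "dmc \<Gamma> (replicate (k n) (if us \<in> T then x0 else x1) @ replicate (n - k n) 0)"
    have "measure_pmf.prob ?p {ys. y \<in> set (take (k n) ys)} = 1 - measure_pmf.prob ?p {ys. y \<notin> set (take (k n) ys)}"
      using measure_pmf.prob_compl[of "{ys. y \<notin> set (take (k n) ys)}" ?p]
      by (simp add: Collect_neg_eq[symmetric] Compl_eq_Diff_UNIV[symmetric])
    then show ?thesis
      unfolding prob_symbol_absent by (cases "us \<in> T") (simp_all add: acceptance_def g_def f_def)
  qed
  have block: "block_encoder n (f n)" for n
    by (simp add: block_encoder_def f_def k_def)
  moreover have "expected_cost S c n (f n) \<le> C n" if n: "n \<ge> 1" for n and S :: "('u \<times> 'v) pmf"
  proof -
    have "real (k n) \<le> real (nat \<lfloor>C n / m\<rfloor>)" by (simp add: k_def)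
    also have "\<dots> \<le> C n / m" using C_nonneg[OF n] m by (intro of_nat_floor) auto
    finally have "real (k n) \<le> C n / m" .
    then have "real (k n) * m \<le> C n" using m by (simp add: field_simps)
    moreover have "sum_list (map c (f n us)) \<le> real (k n) * m" for us
      using m c by (auto simp: f_def sum_list_replicate intro!: mult_left_mono)
    ultimately have "expected_cost S c n (f n) \<le> \<E> (replicate_pmf n S) (\<lambda>_. C n)"
      unfolding expected_cost_eq[OF block] by (intro expectation_mono) (auto intro: order_trans)
    then show ?thesis by simp
  qed
  moreover have "type_I_error P \<Gamma> n (f n) (g n) \<le> (K + KB) / real n + (1 - pmf (\<Gamma> x0) y) ^ k n" if n: "n \<ge> 1" for n
  proof -
    let ?y = "(1 - pmf (\<Gamma> x0) y) ^ k n"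
    have y0: "0 \<le> ?y" by (simp add: pmf_le_1)
    have "1 = \<E> (replicate_pmf n P) (\<lambda>_. 1)" by simp
    also have "\<dots> \<le> \<E> (replicate_pmf n P) (\<lambda>zs. acceptance \<Gamma> (g n) (f n (map fst zs)) (map snd zs)
        + (indicator (- T) (map fst zs) + (indicator (- B) (map snd zs) + ?y)))"
    proof (rule expectation_mono)
      fix zs
      show "1 \<le> acceptance \<Gamma> (g n) (f n (map fst zs)) (map snd zs)
        + (indicator (- T) (map fst zs) + (indicator (- B) (map snd zs) + ?y))"
        using y0 by (cases "map fst zs \<in> T"; cases "map snd zs \<in> B") (simp_all add: acc y)
    qed simp
    also have "\<dots> = type_II_error P \<Gamma> n (f n) (g n) + (\<E> (replicate_pmf n P) (\<lambda>zs. indicator (- T) (map fst zs)) +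
        (\<E> (replicate_pmf n P) (\<lambda>zs. indicator (- B) (map snd zs)) + ?y))"
      by (simp add: expectation_add type_II_error_eq)
    also have "\<E> (replicate_pmf n P) (\<lambda>zs. indicator (- T) (map fst zs)) \<le> K / real n"
      unfolding expectation_map_replicate using T[OF n] by simp
    also have "\<E> (replicate_pmf n P) (\<lambda>zs. indicator (- B) (map snd zs)) \<le> KB / real n"
      unfolding expectation_map_replicate using B[OF n] by simp
    finally show ?thesis by (simp add: type_I_error_eq add_divide_distrib)
  qed
  moreover have "(\<lambda>n. (K + KB) / real n + (1 - pmf (\<Gamma> x0) y) ^ k n) \<longlonglongrightarrow> 0 + 0"
  proof (intro tendsto_add)
    show "(\<lambda>n. (K + KB) / real n) \<longlonglongrightarrow> 0"
      by (rule real_tendsto_divide_at_top[OF tendsto_const filterlim_real_sequentially])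
    have "filterlim (\<lambda>n. 1 / m * C n) at_top sequentially"
      using m by (intro filterlim_tendsto_pos_mult_at_top[OF tendsto_const _ C_unbounded]) simp
    then have "filterlim (\<lambda>n. C n / m) at_top sequentially" by simp
    then have "filterlim (\<lambda>n. nat \<lfloor>C n / m\<rfloor>) at_top sequentially"
      by (intro filterlim_compose[OF filterlim_nat_sequentially] filterlim_compose[OF filterlim_floor_sequentially])
    then have "filterlim k at_top sequentially"
      unfolding filterlim_at_top by (auto simp: k_def eventually_conj_iff eventually_ge_at_top)
    moreover have "(\<lambda>j. (1 - pmf (\<Gamma> x0) y) ^ j) \<longlonglongrightarrow> 0"
      using y pmf_le_1[of "\<Gamma> x0" y] by (intro LIMSEQ_realpow_zero) auto
    ultimately show "(\<lambda>n. (1 - pmf (\<Gamma> x0) y) ^ k n) \<longlonglongrightarrow> 0"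
      by (rule filterlim_compose[rotated])
  qed
  moreover have "type_II_error Q \<Gamma> n (f n) (g n) \<le> M * exp (- (real n * E))" for n
  proof -
    have "type_II_error Q \<Gamma> n (f n) (g n) \<le> \<E> (replicate_pmf n Q) (indicator {zs. map fst zs \<in> T \<and> map snd zs \<in> B})"
      unfolding type_II_error_eq using y by (intro expectation_mono) (auto simp: acc indicator_def pmf_le_1)
    then show ?thesis using rate[of n] by simp
  qed
  ultimately show ?thesis
    using b eps \<theta> by (intro achievableI[where f = f and g = g and M = M and a = "\<lambda>n. (K + KB) / real n + (1 - pmf (\<Gamma> x0) y) ^ k n"])
      (auto intro: eventually_mono[OF eventually_ge_at_top[of 1]])
qed

text \<open>Mass of \<open>p\<close> at points where \<open>q\<close> vanishes does not enter the
  mean, so equality may fail.\<close>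

lemma likelihood_ratio_le_1:
  fixes p q :: "'a::finite pmf"
  shows "\<E> q (\<lambda>x. pmf p x / pmf q x) \<le> 1"
proof -
  have "\<E> q (\<lambda>x. pmf p x / pmf q x) \<le> (\<Sum>x\<in>UNIV. pmf p x)"
    unfolding expectation_eq_sum by (intro sum_mono) auto
  then show ?thesis by (simp add: sum_pmf_eq_1)
qed

text \<open>Likelihood ratios as weights: their mean under \<open>q\<close> is at most 1 and their
  mean logarithm under \<open>p\<close> is the divergence, as in Stein's lemma.\<close>

lemma prob_likelihood_typical_le:
  fixes p q :: "'a::finite pmf"
  shows "measure_pmf.prob (replicate_pmf n q) (typical p (\<lambda>x. pmf p x / pmf q x) \<kappa>) \<le> exp (- (real n * (kl p q - \<kappa>)))"
  using prob_typical_le[of "\<lambda>x. pmf p x / pmf q x" q] likelihood_ratio_le_1[of q p] by (simp add: kl_def)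

lemma prob_Un_le: "measure_pmf.prob p (A \<union> B) \<le> measure_pmf.prob p A + measure_pmf.prob p B"
  by (rule measure_Un_le) auto

text \<open>The reciprocal of the smallest positive transition probability serves as
  \<open>\<rho>\<close>.\<close>

lemma common_support_ratio:
  fixes \<Gamma> :: "'x::finite \<Rightarrow> 'y::finite pmf"
  assumes supp: "\<nexists>x0 x1 y. pmf (\<Gamma> x0) y > 0 \<and> pmf (\<Gamma> x1) y = 0"
  obtains \<rho> where "1 \<le> \<rho>" "\<And>x x' y. pmf (\<Gamma> x) y \<le> \<rho> * pmf (\<Gamma> x') y"
proof -
  define S where "S = {pmf (\<Gamma> x) y | x y. 0 < pmf (\<Gamma> x) y}"
  have "S \<subseteq> (\<lambda>(x, y). pmf (\<Gamma> x) y) ` UNIV" by (auto simp: S_def)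
  then have fin: "finite S" by (rule finite_subset) simp
  obtain y where "y \<in> set_pmf (\<Gamma> undefined)" using set_pmf_not_empty by fast
  then have ne: "S \<noteq> {}" by (auto simp: S_def intro: pmf_positive)
  define e where "e = Min S"
  have "e \<in> S" unfolding e_def using fin ne by (rule Min_in)
  then have e: "0 < e" "e \<le> 1" by (auto simp: S_def pmf_le_1)
  show ?thesis
  proof (rule that[of "1 / e"])
    fix x x' y
    show "pmf (\<Gamma> x) y \<le> 1 / e * pmf (\<Gamma> x') y"
    proof (cases "0 < pmf (\<Gamma> x) y")
      case True
      then have "0 < pmf (\<Gamma> x') y" using supp by (metis pmf_nonneg less_eq_real_def)
      then have "e \<le> pmf (\<Gamma> x') y" unfolding e_def using fin by (intro Min_le) (auto simp: S_def)
      then have "1 \<le> 1 / e * pmf (\<Gamma> x') y" using e by (simp add: field_simps)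
      then show ?thesis using pmf_le_1[of "\<Gamma> x" y] by linarith
    next
      case False
      then show ?thesis using e pmf_nonneg[of "\<Gamma> x'" y] by (simp add: not_less)
    qed
  qed (use e in simp)
qed

section \<open>Matching the converse with the coding schemes\<close>

theorem theorem4:
  fixes P Q :: "('u::finite \<times> 'v::finite) pmf"
    and \<Gamma> :: "'x::{finite,zero} \<Rightarrow> ('y::finite) pmf"
    and c :: "'x \<Rightarrow> real" and C :: "nat \<Rightarrow> real" and b \<epsilon> :: real
  defines "P\<^sub>U \<equiv> map_pmf fst P" and "P\<^sub>V \<equiv> map_pmf snd P"
    and "Q\<^sub>U \<equiv> map_pmf fst Q" and "Q\<^sub>V \<equiv> map_pmf snd Q"
  defines "E\<^sub>1 \<equiv> min_kl_div b P\<^sub>U P\<^sub>V Q"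
    and "E\<^sub>2 \<equiv> kl_div b P\<^sub>V Q\<^sub>V + Max ((\<lambda>x. kl_div b (\<Gamma> 0) (\<Gamma> x)) ` (UNIV - {0}))"
    and "E\<^sub>3 \<equiv> min_kl_div b Q\<^sub>U P\<^sub>V Q"
  assumes base: "b > 1"
    and nontrivial: "(UNIV :: 'x set) - {0} \<noteq> {}"
    and Q_pos: "\<And>u v. pmf Q (u, v) > 0"
    and c_nonneg: "\<And>x. c x \<ge> 0" and c_zero: "\<And>x. c x = 0 \<longleftrightarrow> x = 0"
    and eps: "0 \<le> \<epsilon>" "\<epsilon> < 1"
    and C_nonneg: "\<And>n. n \<ge> 1 \<Longrightarrow> C n \<ge> 0"
    and C_unbounded: "filterlim C at_top sequentially"
    and C_sublinear: "(\<lambda>n. C n / real n) \<longlonglongrightarrow> 0"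
  shows "((\<exists>x\<^sub>0 x\<^sub>1 y. pmf (\<Gamma> x\<^sub>0) y > 0 \<and> pmf (\<Gamma> x\<^sub>1) y = 0) \<longrightarrow>
            theta_expcost_both b P Q \<Gamma> c \<epsilon> C = theta_expcost_H0 b P Q \<Gamma> c \<epsilon> C \<and>
            theta_expcost_H0 b P Q \<Gamma> c \<epsilon> C = E\<^sub>1) \<and>
         ((\<nexists>x\<^sub>0 x\<^sub>1 y. pmf (\<Gamma> x\<^sub>0) y > 0 \<and> pmf (\<Gamma> x\<^sub>1) y = 0) \<longrightarrow>
            theta_expcost_H0 b P Q \<Gamma> c \<epsilon> C = min E\<^sub>1 E\<^sub>2 \<and>
            theta_expcost_both b P Q \<Gamma> c \<epsilon> C = Min {E\<^sub>1, E\<^sub>2, E\<^sub>3})"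
proof -
  have lb: "0 < ln b" using base by simp
  have Q': "0 < pmf Q z" for z using Q_pos by (cases z) auto
  have supp: "set_pmf \<pi> \<subseteq> set_pmf Q" for \<pi> using Q' by (auto simp: set_pmf_eq less_le)
  obtain \<pi>1 a1 b1 where \<pi>1: "\<pi>1 \<in> couplings P\<^sub>U P\<^sub>V"
    and m1: "\<And>c. c > 1 \<Longrightarrow> min_kl_div c P\<^sub>U P\<^sub>V Q = ereal (kl \<pi>1 Q / ln c)"
    and nn1: "\<And>u. 0 \<le> a1 u" "\<And>v. 0 \<le> b1 v"
    and pos1: "\<And>u. u \<in> set_pmf P\<^sub>U \<Longrightarrow> 0 < a1 u" "\<And>v. v \<in> set_pmf P\<^sub>V \<Longrightarrow> 0 < b1 v"
    and Q1: "\<E> Q (\<lambda>z. a1 (fst z) * b1 (snd z)) = 1"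
      "\<E> P\<^sub>U (\<lambda>u. ln (a1 u)) + \<E> P\<^sub>V (\<lambda>v. ln (b1 v)) = kl \<pi>1 Q"
    using that by (rule information_projection[OF Q_pos, of P\<^sub>U P\<^sub>V])
  have E1: "E\<^sub>1 = ereal (kl \<pi>1 Q / ln b)" unfolding E\<^sub>1_def using base by (rule m1)
  obtain \<pi>3 a3 b3 where \<pi>3: "\<pi>3 \<in> couplings Q\<^sub>U P\<^sub>V"
    and m3: "\<And>c. c > 1 \<Longrightarrow> min_kl_div c Q\<^sub>U P\<^sub>V Q = ereal (kl \<pi>3 Q / ln c)"
    and nn3: "\<And>u. 0 \<le> a3 u" "\<And>v. 0 \<le> b3 v"
    and pos3: "\<And>u. u \<in> set_pmf Q\<^sub>U \<Longrightarrow> 0 < a3 u" "\<And>v. v \<in> set_pmf P\<^sub>V \<Longrightarrow> 0 < b3 v"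
    and Q3: "\<E> Q (\<lambda>z. a3 (fst z) * b3 (snd z)) = 1"
      "\<E> Q\<^sub>U (\<lambda>u. ln (a3 u)) + \<E> P\<^sub>V (\<lambda>v. ln (b3 v)) = kl \<pi>3 Q"
    using that by (rule information_projection[OF Q_pos, of Q\<^sub>U P\<^sub>V])
  have E3: "E\<^sub>3 = ereal (kl \<pi>3 Q / ln b)" unfolding E\<^sub>3_def using base by (rule m3)
  have c0: "c 0 = 0" using c_zero by simp
  define A where "A \<H> = achievable_exponents b P Q \<Gamma> c \<H> \<epsilon> C" for \<H>
  \<comment> \<open>The bound by the first exponent holds for every set of constraints containing
    \<open>H0\<close> and serves both cases of the theorem.\<close>
  have le1: "\<theta> \<le> kl \<pi>1 Q / ln b" if \<theta>: "\<theta> \<in> A \<H>" and "H0 \<in> \<H>" for \<theta> \<H>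
  proof -
    obtain f g w \<delta> where f: "\<And>n. n \<ge> 1 \<Longrightarrow> block_encoder n (f n)"
      and w: "(\<lambda>n. w n / real n) \<longlonglongrightarrow> 0" and \<delta>: "0 < \<delta>"
      and acc: "\<forall>\<^sub>F n in sequentially. \<delta> \<le> \<E> (replicate_pmf n P) (\<lambda>zs. acceptance \<Gamma> (g n) (f n (map fst zs)) (map snd zs) *
         of_bool (real (weight (f n (map fst zs))) \<le> w n))"
      and low: "H1 \<in> \<H> \<Longrightarrow> \<forall>\<^sub>F n in sequentially. \<delta> \<le> measure_pmf.prob (replicate_pmf n Q) {zs. real (weight (f n (map fst zs))) \<le> w n}"
      and \<beta>: "ereal \<theta> \<le> liminf (\<lambda>n. error_exponent b n (type_II_error Q \<Gamma> n (f n) (g n)))"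
      using that
      by (rule achievable_low_weight[OF \<theta>[unfolded A_def] \<open>H0 \<in> \<H>\<close> c_nonneg c_zero nontrivial eps C_unbounded C_sublinear])
    have "\<forall>\<^sub>F n in sequentially. exp (- (real n * (kl \<pi>1 Q + \<eta>))) \<le> type_II_error Q \<Gamma> n (f n) (g n)"
      if "0 < \<eta>" for \<eta>
      by (rule converse_marginals[OF Q' \<pi>1[unfolded P\<^sub>U_def P\<^sub>V_def] f w \<delta> that acc])
    with base \<beta> show ?thesis by (rule exponent_le)
  qed
  have T1: "\<exists>K. \<forall>n\<ge>1. measure_pmf.prob (replicate_pmf n P\<^sub>U) (- typical P\<^sub>U a1 \<kappa>) \<le> K / real n" if "0 < \<kappa>" for \<kappa>
    using pos1(1) that by (rule prob_not_typical)
  have B1: "\<exists>K. \<forall>n\<ge>1. measure_pmf.prob (replicate_pmf n P\<^sub>V) (- typical P\<^sub>V b1 \<kappa>) \<le> K / real n" if "0 < \<kappa>" for \<kappa>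
    using pos1(2) that by (rule prob_not_typical)
  have rate1: "measure_pmf.prob (replicate_pmf n Q) {zs. map fst zs \<in> typical P\<^sub>U a1 \<kappa> \<and> map snd zs \<in> typical P\<^sub>V b1 \<kappa>}
      \<le> exp (- (real n * (kl \<pi>1 Q - 2 * \<kappa>)))" for n \<kappa>
    using prob_pair_typical_le[OF nn1 eq_refl[OF Q1(1)], of n P\<^sub>U \<kappa> P\<^sub>V] by (simp add: Q1(2))
  have case1: "stein_exponent b P Q \<Gamma> c \<H> \<epsilon> C = E\<^sub>1"
    if y: "0 < pmf (\<Gamma> x0) y" "pmf (\<Gamma> x1) y = 0" and "H0 \<in> \<H>" for x0 x1 y \<H>
    unfolding E1
  proof (rule stein_exponent_eqI)
    show "0 \<le> kl \<pi>1 Q / ln b" using kl_nonneg[OF supp] lb by simp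
    fix \<theta> assume \<theta>: "0 < \<theta>" "\<theta> < kl \<pi>1 Q / ln b"
    \<comment> \<open>A quarter of the gap in nats: the typicality slack \<open>2 * \<kappa>\<close>
      uses only half of it.\<close>
    define \<kappa> where "\<kappa> = (kl \<pi>1 Q - \<theta> * ln b) / 4"
    have \<kappa>: "0 < \<kappa>" using \<theta> lb by (simp add: \<kappa>_def field_simps)
    obtain K where K: "\<And>n. n \<ge> 1 \<Longrightarrow> measure_pmf.prob (replicate_pmf n P\<^sub>U) (- typical P\<^sub>U a1 \<kappa>) \<le> K / real n"
      using T1[OF \<kappa>] by blast
    obtain KB where KB: "\<And>n. n \<ge> 1 \<Longrightarrow> measure_pmf.prob (replicate_pmf n P\<^sub>V) (- typical P\<^sub>V b1 \<kappa>) \<le> KB / real n"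
      using B1[OF \<kappa>] by blast
    have \<theta>\<kappa>: "\<theta> < (kl \<pi>1 Q - 2 * \<kappa>) / ln b" using \<theta> lb by (simp add: \<kappa>_def field_simps)
    have rate: "measure_pmf.prob (replicate_pmf n Q) {zs. map fst zs \<in> typical P\<^sub>U a1 \<kappa> \<and> map snd zs \<in> typical P\<^sub>V b1 \<kappa>}
        \<le> 1 * exp (- (real n * (kl \<pi>1 Q - 2 * \<kappa>)))" for n
      using rate1 by simp
    show "\<theta> \<in> achievable_exponents b P Q \<Gamma> c \<H> \<epsilon> C"
      by (rule achievable_zero_error[where C = C and c = c and T = "typical P\<^sub>U a1 \<kappa>" and B = "typical P\<^sub>V b1 \<kappa>"
            and P = P and Q = Q and \<Gamma> = \<Gamma>, unfolded P\<^sub>U_def P\<^sub>V_def, OF base eps(1) \<theta>(1) \<theta>\<kappa> c0 c_nonneg C_nonneg C_unbounded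
            K[unfolded P\<^sub>U_def] KB[unfolded P\<^sub>V_def] rate[unfolded P\<^sub>U_def P\<^sub>V_def] y])
  qed (use le1 \<open>H0 \<in> \<H>\<close> in \<open>auto simp: A_def\<close>)
  have case2: "stein_exponent b P Q \<Gamma> c {H0} \<epsilon> C = min E\<^sub>1 E\<^sub>2 \<and>
      stein_exponent b P Q \<Gamma> c {H0, H1} \<epsilon> C = min (min E\<^sub>1 E\<^sub>2) E\<^sub>3"
    if common: "\<nexists>x0 x1 y. pmf (\<Gamma> x0) y > 0 \<and> pmf (\<Gamma> x1) y = 0"
  proof -
    obtain \<rho> where \<rho>: "1 \<le> \<rho>" "\<And>x x' y. pmf (\<Gamma> x) y \<le> \<rho> * pmf (\<Gamma> x') y"
      using common_support_ratio[OF common] by blast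
    have supp\<Gamma>: "set_pmf (\<Gamma> x) \<subseteq> set_pmf (\<Gamma> x')" for x x'
      using common by (auto simp: set_pmf_eq) (metis pmf_pos)
    have suppV: "set_pmf P\<^sub>V \<subseteq> set_pmf Q\<^sub>V"
    proof -
      have "set_pmf Q = UNIV" using Q' by (auto simp: set_pmf_eq) (metis less_irrefl)
      then have "set_pmf Q\<^sub>V = UNIV" by (simp add: Q\<^sub>V_def)
      then show ?thesis by simp
    qed
    have kl\<Gamma>: "kl_div b (\<Gamma> 0) (\<Gamma> x) = ereal (kl (\<Gamma> 0) (\<Gamma> x) / ln b)" for x
      using base supp\<Gamma> by (rule kl_div_eq_kl)
    let ?KL = "(\<lambda>x. kl_div b (\<Gamma> 0) (\<Gamma> x)) ` (UNIV - {0})"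
    have "Max ?KL \<in> ?KL" using nontrivial by (intro Max_in) auto
    then obtain x' where x': "x' \<noteq> 0" "Max ?KL = kl_div b (\<Gamma> 0) (\<Gamma> x')" by auto
    define D where "D = kl (\<Gamma> 0) (\<Gamma> x')"
    define DV where "DV = kl P\<^sub>V Q\<^sub>V"
    \<comment> \<open>The maximum ranges over nonzero letters, but codewords may contain zeros; for
      them the divergence is 0, which is at most \<open>D\<close>.\<close>
    have D: "kl (\<Gamma> 0) (\<Gamma> x) \<le> D" for x
    proof (cases "x = 0")
      case True
      have "kl (\<Gamma> 0) (\<Gamma> 0) = \<E> (\<Gamma> 0) (\<lambda>_. 0)"
        unfolding kl_def by (intro expectation_cong) (simp add: set_pmf_iff)
      then show ?thesis using True kl_nonneg[OF supp\<Gamma>[of 0 x']] by (simp add: D_def)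
    next
      case False
      then have "kl_div b (\<Gamma> 0) (\<Gamma> x) \<le> kl_div b (\<Gamma> 0) (\<Gamma> x')"
        unfolding x'(2)[symmetric] by (intro Max_ge) auto
      then show ?thesis using lb by (simp add: kl\<Gamma> D_def divide_le_cancel)
    qed
    have E2: "E\<^sub>2 = ereal ((DV + D) / ln b)"
      unfolding E\<^sub>2_def x'(2) unfolding kl\<Gamma> kl_div_eq_kl[OF base suppV] by (simp add: DV_def D_def add_divide_distrib)
    have nonneg: "0 \<le> kl \<pi>1 Q" "0 \<le> kl \<pi>3 Q" "0 \<le> DV + D"
      using kl_nonneg[OF supp] kl_nonneg[OF suppV] kl_nonneg[OF supp\<Gamma>[of 0 x']] by (auto simp: DV_def D_def)
    have le2: "\<theta> \<le> (DV + D) / ln b" and le3: "H1 \<in> \<H> \<Longrightarrow> \<theta> \<le> kl \<pi>3 Q / ln b"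
      if \<theta>: "\<theta> \<in> A \<H>" and "H0 \<in> \<H>" for \<theta> \<H>
    proof -
      obtain f g w \<delta> where f: "\<And>n. n \<ge> 1 \<Longrightarrow> block_encoder n (f n)"
        and w: "(\<lambda>n. w n / real n) \<longlonglongrightarrow> 0" and \<delta>: "0 < \<delta>"
        and acc: "\<forall>\<^sub>F n in sequentially. \<delta> \<le> \<E> (replicate_pmf n P) (\<lambda>zs. acceptance \<Gamma> (g n) (f n (map fst zs)) (map snd zs) *
           of_bool (real (weight (f n (map fst zs))) \<le> w n))"
        and low: "H1 \<in> \<H> \<Longrightarrow> \<forall>\<^sub>F n in sequentially. \<delta> \<le> measure_pmf.prob (replicate_pmf n Q) {zs. real (weight (f n (map fst zs))) \<le> w n}"
        and \<beta>: "ereal \<theta> \<le> liminf (\<lambda>n. error_exponent b n (type_II_error Q \<Gamma> n (f n) (g n)))"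
        using that
        by (rule achievable_low_weight[OF \<theta>[unfolded A_def] \<open>H0 \<in> \<H>\<close> c_nonneg c_zero nontrivial eps C_unbounded C_sublinear])
      have "\<forall>\<^sub>F n in sequentially. exp (- (real n * (DV + D + \<eta>))) \<le> type_II_error Q \<Gamma> n (f n) (g n)"
        if "0 < \<eta>" for \<eta>
        unfolding DV_def P\<^sub>V_def Q\<^sub>V_def
        by (rule converse_channel[OF suppV[unfolded P\<^sub>V_def Q\<^sub>V_def] \<rho>(2,1) D f w \<delta> that acc])
      with base \<beta> show "\<theta> \<le> (DV + D) / ln b" by (rule exponent_le)
      show "\<theta> \<le> kl \<pi>3 Q / ln b" if "H1 \<in> \<H>"
      proof -
        have "\<forall>\<^sub>F n in sequentially. exp (- (real n * (kl \<pi>3 Q + \<eta>))) \<le> type_II_error Q \<Gamma> n (f n) (g n)"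
          if "0 < \<eta>" for \<eta>
          by (rule converse_both[OF Q' \<pi>3[unfolded Q\<^sub>U_def P\<^sub>V_def] \<rho>(2,1) f w \<delta> that acc low[OF \<open>H1 \<in> \<H>\<close>]])
        with base \<beta> show ?thesis by (rule exponent_le)
      qed
    qed
    define aV where "aV v = pmf P\<^sub>V v / pmf Q\<^sub>V v" for v
    define aY where "aY y = pmf (\<Gamma> 0) y / pmf (\<Gamma> x') y" for y
    have BV: "\<exists>K. \<forall>n\<ge>1. measure_pmf.prob (replicate_pmf n P\<^sub>V) (- typical P\<^sub>V aV \<kappa>) \<le> K / real n" if "0 < \<kappa>" for \<kappa>
      using that suppV by (intro prob_not_typical) (auto simp: aV_def intro!: divide_pos_pos pmf_positive)
    have BY: "\<exists>K. \<forall>n\<ge>1. measure_pmf.prob (replicate_pmf n (\<Gamma> 0)) (- typical (\<Gamma> 0) aY \<kappa>) \<le> K / real n" if "0 < \<kappa>" for \<kappa>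
      using that supp\<Gamma>[of 0 x'] by (intro prob_not_typical) (auto simp: aY_def intro!: divide_pos_pos pmf_positive)
    have B3: "\<exists>K. \<forall>n\<ge>1. measure_pmf.prob (replicate_pmf n P\<^sub>V) (- typical P\<^sub>V b3 \<kappa>) \<le> K / real n" if "0 < \<kappa>" for \<kappa>
      using pos3(2) that by (rule prob_not_typical)
    have T3: "\<exists>K. \<forall>n\<ge>1. measure_pmf.prob (replicate_pmf n Q\<^sub>U) (- typical Q\<^sub>U a3 \<kappa>) \<le> K / real n" if "0 < \<kappa>" for \<kappa>
      using pos3(1) that by (rule prob_not_typical)
    have rate3: "measure_pmf.prob (replicate_pmf n Q) {zs. map fst zs \<in> typical Q\<^sub>U a3 \<kappa> \<and> map snd zs \<in> typical P\<^sub>V b3 \<kappa>}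
        \<le> exp (- (real n * (kl \<pi>3 Q - 2 * \<kappa>)))" for n \<kappa>
      using prob_pair_typical_le[OF nn3 eq_refl[OF Q3(1)], of n Q\<^sub>U \<kappa> P\<^sub>V] by (simp add: Q3(2))
    have rate2: "measure_pmf.prob (replicate_pmf n Q\<^sub>V) (typical P\<^sub>V aV \<kappa>) * measure_pmf.prob (replicate_pmf n (\<Gamma> x')) (typical (\<Gamma> 0) aY \<kappa>)
        \<le> exp (- (real n * (DV + D - 2 * \<kappa>)))" for n \<kappa>
    proof -
      have "measure_pmf.prob (replicate_pmf n Q\<^sub>V) (typical P\<^sub>V aV \<kappa>) * measure_pmf.prob (replicate_pmf n (\<Gamma> x')) (typical (\<Gamma> 0) aY \<kappa>)
        \<le> exp (- (real n * (DV - \<kappa>))) * exp (- (real n * (D - \<kappa>)))"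
        unfolding aV_def[abs_def] aY_def[abs_def] DV_def D_def by (intro mult_mono prob_likelihood_typical_le) auto
      then show ?thesis by (simp add: algebra_simps flip: exp_add)
    qed
    have ach: "\<theta> \<in> achievable_exponents b P Q \<Gamma> c \<H> \<epsilon> C"
      if "H0 \<in> \<H>" and \<theta>: "0 < \<theta>" "\<theta> < E / ln b" and E: "E \<le> kl \<pi>1 Q" "E \<le> DV + D" "H1 \<in> \<H> \<Longrightarrow> E \<le> kl \<pi>3 Q" for E \<theta> \<H>
    proof -
      define \<kappa> where "\<kappa> = (E - \<theta> * ln b) / 4"
      have \<kappa>: "0 < \<kappa>" using \<theta> lb by (simp add: \<kappa>_def field_simps)
      have \<theta>\<kappa>: "\<theta> < (E - 2 * \<kappa>) / ln b" using \<theta> lb by (simp add: \<kappa>_def field_simps)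
      \<comment> \<open>With a cost constraint under \<open>H1\<close>, blocks typical for
        \<open>Q\<close> must send zeros as well, so that the costly word stays rare there. This
        enlargement of \<open>T\<close> brings in the third exponent.\<close>
      define T where "T = typical P\<^sub>U a1 \<kappa> \<union> (if H1 \<in> \<H> then typical Q\<^sub>U a3 \<kappa> else {})"
      \<comment> \<open>A single test on \<open>V\<close> whose three components serve the first,
        second and third exponent respectively.\<close>
      define B where "B = typical P\<^sub>V b1 \<kappa> \<inter> typical P\<^sub>V aV \<kappa> \<inter> typical P\<^sub>V b3 \<kappa>"
      define Y where "Y = typical (\<Gamma> 0) aY \<kappa>"
      obtain K1 where K1: "\<And>n. n \<ge> 1 \<Longrightarrow> measure_pmf.prob (replicate_pmf n P\<^sub>U) (- typical P\<^sub>U a1 \<kappa>) \<le> K1 / real n"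
        using T1[OF \<kappa>] by blast
      obtain K3 where K3: "\<And>n. n \<ge> 1 \<Longrightarrow> measure_pmf.prob (replicate_pmf n Q\<^sub>U) (- typical Q\<^sub>U a3 \<kappa>) \<le> K3 / real n"
        using T3[OF \<kappa>] by blast
      obtain L1 where L1: "\<And>n. n \<ge> 1 \<Longrightarrow> measure_pmf.prob (replicate_pmf n P\<^sub>V) (- typical P\<^sub>V b1 \<kappa>) \<le> L1 / real n"
        using B1[OF \<kappa>] by blast
      obtain L2 where L2: "\<And>n. n \<ge> 1 \<Longrightarrow> measure_pmf.prob (replicate_pmf n P\<^sub>V) (- typical P\<^sub>V aV \<kappa>) \<le> L2 / real n"
        using BV[OF \<kappa>] by blast
      obtain L3 where L3: "\<And>n. n \<ge> 1 \<Longrightarrow> measure_pmf.prob (replicate_pmf n P\<^sub>V) (- typical P\<^sub>V b3 \<kappa>) \<le> L3 / real n"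
        using B3[OF \<kappa>] by blast
      obtain LY where LY: "\<And>n. n \<ge> 1 \<Longrightarrow> measure_pmf.prob (replicate_pmf n (\<Gamma> 0)) (- Y) \<le> LY / real n"
        using BY[OF \<kappa>] unfolding Y_def by blast
      have T: "measure_pmf.prob (replicate_pmf n (map_pmf fst (case h of H0 \<Rightarrow> P | H1 \<Rightarrow> Q))) (- T) \<le> max K1 K3 / real n"
        if n: "n \<ge> 1" and h: "h \<in> \<H>" for n h
      proof (cases h)
        case H0
        have "measure_pmf.prob (replicate_pmf n P\<^sub>U) (- T) \<le> measure_pmf.prob (replicate_pmf n P\<^sub>U) (- typical P\<^sub>U a1 \<kappa>)"
          by (intro measure_pmf.finite_measure_mono) (auto simp: T_def)
        also have "\<dots> \<le> K1 / real n" using K1[OF n] .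
        also have "\<dots> \<le> max K1 K3 / real n" by (intro divide_right_mono) auto
        finally show ?thesis using H0 by (simp add: P\<^sub>U_def)
      next
        case H1
        have "measure_pmf.prob (replicate_pmf n Q\<^sub>U) (- T) \<le> measure_pmf.prob (replicate_pmf n Q\<^sub>U) (- typical Q\<^sub>U a3 \<kappa>)"
          using h H1 by (intro measure_pmf.finite_measure_mono) (auto simp: T_def)
        also have "\<dots> \<le> K3 / real n" using K3[OF n] .
        also have "\<dots> \<le> max K1 K3 / real n" by (intro divide_right_mono) auto
        finally show ?thesis using H1 by (simp add: Q\<^sub>U_def)
      qed
      have B: "measure_pmf.prob (replicate_pmf n P\<^sub>V) (- B) \<le> (L1 + L2 + L3) / real n" if n: "n \<ge> 1" for n
      proof -
        have "measure_pmf.prob (replicate_pmf n P\<^sub>V) (- B) \<le> measure_pmf.prob (replicate_pmf n P\<^sub>V)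
            (- typical P\<^sub>V b1 \<kappa> \<union> (- typical P\<^sub>V aV \<kappa> \<union> - typical P\<^sub>V b3 \<kappa>))"
          by (intro measure_pmf.finite_measure_mono) (auto simp: B_def)
        also have "\<dots> \<le> measure_pmf.prob (replicate_pmf n P\<^sub>V) (- typical P\<^sub>V b1 \<kappa>) +
            (measure_pmf.prob (replicate_pmf n P\<^sub>V) (- typical P\<^sub>V aV \<kappa>) + measure_pmf.prob (replicate_pmf n P\<^sub>V) (- typical P\<^sub>V b3 \<kappa>))"
          by (intro order_trans[OF prob_Un_le] add_left_mono prob_Un_le)
        finally show ?thesis using L1[OF n] L2[OF n] L3[OF n] by (simp add: add_divide_distrib)
      qed
      have rate: "measure_pmf.prob (replicate_pmf n Q) {zs. map fst zs \<in> T \<and> map snd zs \<in> B} +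
          measure_pmf.prob (replicate_pmf n Q\<^sub>V) B * measure_pmf.prob (replicate_pmf n (\<Gamma> x')) Y \<le> 3 * exp (- (real n * (E - 2 * \<kappa>)))" for n
      proof -
        let ?e = "exp (- (real n * (E - 2 * \<kappa>)))"
        let ?S3 = "if H1 \<in> \<H> then {zs. map fst zs \<in> typical Q\<^sub>U a3 \<kappa> \<and> map snd zs \<in> typical P\<^sub>V b3 \<kappa>} else {}"
        have mono: "exp (- (real n * (F - 2 * \<kappa>))) \<le> ?e" if "E \<le> F" for F
          using that by (simp add: mult_left_mono)
        have "measure_pmf.prob (replicate_pmf n Q) {zs. map fst zs \<in> T \<and> map snd zs \<in> B} \<le>
          measure_pmf.prob (replicate_pmf n Q) ({zs. map fst zs \<in> typical P\<^sub>U a1 \<kappa> \<and> map snd zs \<in> typical P\<^sub>V b1 \<kappa>} \<union> ?S3)"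
          by (intro measure_pmf.finite_measure_mono) (auto simp: T_def B_def split: if_splits)
        also have "\<dots> \<le> measure_pmf.prob (replicate_pmf n Q) {zs. map fst zs \<in> typical P\<^sub>U a1 \<kappa> \<and> map snd zs \<in> typical P\<^sub>V b1 \<kappa>} +
            measure_pmf.prob (replicate_pmf n Q) ?S3"
          by (rule prob_Un_le)
        also have "measure_pmf.prob (replicate_pmf n Q) {zs. map fst zs \<in> typical P\<^sub>U a1 \<kappa> \<and> map snd zs \<in> typical P\<^sub>V b1 \<kappa>} \<le> ?e"
          using rate1 mono[OF E(1)] by (rule order_trans)
        also have "measure_pmf.prob (replicate_pmf n Q) ?S3 \<le> ?e"
          using order_trans[OF rate3 mono[OF E(3)]] by simp
        finally have 1: "measure_pmf.prob (replicate_pmf n Q) {zs. map fst zs \<in> T \<and> map snd zs \<in> B} \<le> ?e + ?e" by simp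
        have "measure_pmf.prob (replicate_pmf n Q\<^sub>V) B * measure_pmf.prob (replicate_pmf n (\<Gamma> x')) Y
          \<le> measure_pmf.prob (replicate_pmf n Q\<^sub>V) (typical P\<^sub>V aV \<kappa>) * measure_pmf.prob (replicate_pmf n (\<Gamma> x')) Y"
          by (intro mult_right_mono measure_pmf.finite_measure_mono) (auto simp: B_def)
        also have "\<dots> \<le> ?e"
          unfolding Y_def using rate2 mono[OF E(2)] by (rule order_trans)
        finally show ?thesis using 1 by simp
      qed
      show ?thesis
        by (rule achievable_full_support[where C = C and c = c and T = T and B = B and Y = Y and x' = x'
              and \<H> = \<H> and P = P and Q = Q and \<Gamma> = \<Gamma>, OF base eps(1) \<theta>(1) \<theta>\<kappa> c0 c_nonneg C_nonneg C_unbounded T \<open>H0 \<in> \<H>\<close>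
              B[unfolded P\<^sub>V_def] LY rate[unfolded Q\<^sub>V_def]])
    qed
    have "stein_exponent b P Q \<Gamma> c {H0} \<epsilon> C = ereal (min (kl \<pi>1 Q) (DV + D) / ln b)"
    proof (rule stein_exponent_eqI)
      show "\<theta> \<le> min (kl \<pi>1 Q) (DV + D) / ln b" if "\<theta> \<in> achievable_exponents b P Q \<Gamma> c {H0} \<epsilon> C" for \<theta>
        using le1[of \<theta> "{H0}"] le2[of \<theta> "{H0}"] that by (auto simp: A_def min_def)
      show "0 \<le> min (kl \<pi>1 Q) (DV + D) / ln b" using nonneg lb by simp
      show "\<theta> \<in> achievable_exponents b P Q \<Gamma> c {H0} \<epsilon> C" if "0 < \<theta>" "\<theta> < min (kl \<pi>1 Q) (DV + D) / ln b" for \<theta>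
        using that by (intro ach[of _ _ "min (kl \<pi>1 Q) (DV + D)"]) auto
    qed
    moreover have "stein_exponent b P Q \<Gamma> c {H0, H1} \<epsilon> C = ereal (min (min (kl \<pi>1 Q) (DV + D)) (kl \<pi>3 Q) / ln b)"
    proof (rule stein_exponent_eqI)
      show "\<theta> \<le> min (min (kl \<pi>1 Q) (DV + D)) (kl \<pi>3 Q) / ln b" if "\<theta> \<in> achievable_exponents b P Q \<Gamma> c {H0, H1} \<epsilon> C" for \<theta>
        using le1[of \<theta> "{H0, H1}"] le2[of \<theta> "{H0, H1}"] le3[of \<theta> "{H0, H1}"] that by (auto simp: A_def min_def)
      show "0 \<le> min (min (kl \<pi>1 Q) (DV + D)) (kl \<pi>3 Q) / ln b" using nonneg lb by simp
      show "\<theta> \<in> achievable_exponents b P Q \<Gamma> c {H0, H1} \<epsilon> C"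
        if "0 < \<theta>" "\<theta> < min (min (kl \<pi>1 Q) (DV + D)) (kl \<pi>3 Q) / ln b" for \<theta>
        using that by (intro ach[of _ _ "min (min (kl \<pi>1 Q) (DV + D)) (kl \<pi>3 Q)"]) auto
    qed
    \<comment> \<open>Minima taken in nats agree with those in base \<open>b\<close> because
      \<open>ln b\<close> is positive.\<close>
    moreover have "min (x / ln b) (y / ln b) = min x y / ln b" for x y
      using lb by (auto simp: min_def divide_le_cancel)
    ultimately show ?thesis by (simp add: E1 E3 E2 flip: ereal_min)
  qed
  show ?thesis
  proof (intro conjI impI)
    assume "\<exists>x\<^sub>0 x\<^sub>1 y. pmf (\<Gamma> x\<^sub>0) y > 0 \<and> pmf (\<Gamma> x\<^sub>1) y = 0"
    then obtain x0 x1 y where y: "0 < pmf (\<Gamma> x0) y" "pmf (\<Gamma> x1) y = 0" by blast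
    show "theta_expcost_both b P Q \<Gamma> c \<epsilon> C = theta_expcost_H0 b P Q \<Gamma> c \<epsilon> C"
      "theta_expcost_H0 b P Q \<Gamma> c \<epsilon> C = E\<^sub>1"
      using case1[OF y] by (simp_all add: theta_expcost_both_def theta_expcost_H0_def)
  next
    assume "\<nexists>x\<^sub>0 x\<^sub>1 y. pmf (\<Gamma> x\<^sub>0) y > 0 \<and> pmf (\<Gamma> x\<^sub>1) y = 0"
    from case2[OF this] show "theta_expcost_H0 b P Q \<Gamma> c \<epsilon> C = min E\<^sub>1 E\<^sub>2"
      "theta_expcost_both b P Q \<Gamma> c \<epsilon> C = Min {E\<^sub>1, E\<^sub>2, E\<^sub>3}"
      by (simp_all add: theta_expcost_both_def theta_expcost_H0_def min.assoc)
  qed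
qed

end
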